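(* There is an algebra isomorphism $\Phi_\imath:U(\mathfrak g[u]^{\check\omega})\to\mathrm{Gr}_{\kappa^\imath}\mathfrak g[t,t^{-1}]^\omega$ such that $$2t_{i,r}\mapsto\overline\theta_{i,r,1},\qquad x_{i,m}\mapsto\overline\beta_{i,m,1}\qquad(i\in\mathbb I^0,\ r,m\ge0\text{ with }r\text{ odd}).$$ Moreover, the diagram $$\begin{array}{ccc}U(\mathfrak g[u]^{\check\omega})&\xrightarrow{\ \Phi_\imath\ }&\mathrm{Gr}_{\kappa^\imath}\mathfrak g[t,t^{-1}]^\omega\\ \downarrow&&\downarrow\\ U(\mathfrak g[u])&\xrightarrow{\ \Phi\ }&\mathrm{Gr}_\kappa\mathfrak g[t,t^{-1}]\end{array}$$ commutes, where the vertical arrows are the natural inclusions.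
   Context: $\mathfrak g$ is a finite-dimensional complex simple Lie algebra with Chevalley generators $e_i,f_i,h_i$ ($i\in\mathbb I^0=\{1,\dots,n\}$) and Chevalley involution $\omega_0:f_i\mapsto-e_i$, $e_i\mapsto-f_i$, $h_i\mapsto-h_i$. $\omega$ is the involution $gt^k\mapsto\omega_0(g)t^{-k}$ of $\mathfrak g[t,t^{-1}]$; $\check\omega$ is the involution $gu^r\mapsto(-1)^r\omega_0(g)u^r$ of $\mathfrak g[u]$; superscripts denote fixed point subalgebras. In $\mathfrak g[u]^{\check\omega}$ put $t_{i,r}=h_iu^r$ ($r$ odd), $x_{i,m}=((-1)^mf_i-e_i)u^m$. For $g\in\mathfrak g$, $k\in\mathbb Z$, $r\ge0$ put $g_{r,k}=g(t-1)^rt^k\in\mathfrak g[t,t^{-1}]$. Let $\kappa_r$ be the ideal of $U(\mathfrak g[t,t^{-1}])$ generated by the products $(g_1)_{r_1,k_1}\cdots(g_a)_{r_a,k_a}$ with $a\ge0$, $g_i\in\mathfrak g$, $k_i\in\mathbb Z$, $r_1+\dots+r_a\ge r$, and $\mathrm{Gr}_\kappa\mathfrak g[t,t^{-1}]=\bigoplus_{r\ge0}\kappa_r/\kappa_{r+1}$. There is an algebra isomorphism $\Phi:U(\mathfrak g[u])\to\mathrm{Gr}_\kappa\mathfrak g[t,t^{-1}]$ sending $gu^r$ to the class $\overline{g_{r,0}}\in\kappa_r/\kappa_{r+1}$. Let $\kappa^\imath_m=\kappa_m\cap U(\mathfrak g[t,t^{-1}]^\omega)$ and $\mathrm{Gr}_{\kappa^\imath}\mathfrak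 g[t,t^{-1}]^\omega=\bigoplus_{m\ge0}\kappa^\imath_m/\kappa^\imath_{m+1}$, naturally a subalgebra of $\mathrm{Gr}_\kappa\mathfrak g[t,t^{-1}]$. Put $\theta_{i,m}=h_it^m-h_it^{-m}$ ($m\ge1$), $b_{i,k}=f_it^{-k}-e_it^k$ ($k\in\mathbb Z$), and for $r\ge0$, $l\ge1$, $k\in\mathbb Z$, $$\theta_{i,r,l}=\sum_{s=0}^r(-1)^{r-s}\binom rs\theta_{i,s+l},\qquad\beta_{i,r,k}=\sum_{s=0}^r(-1)^{r-s}\binom rsb_{i,s+k};$$ these lie in $\kappa^\imath_r$, and $\overline\theta_{i,r,l},\overline\beta_{i,r,k}$ denote their images in $\kappa_r^\imath/\kappa_{r+1}^\imath$. *)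

theory Defs
  imports Complex_Main "HOL-Library.Poly_Mapping" "HOL-Algebra.QuotRing" "HOL-Algebra.Module"
begin

section \<open>Simple Lie algebras with Chevalley generators\<close>

locale lie_algebra = vector_space scale
  for scale :: "complex \<Rightarrow> 'g::ab_group_add \<Rightarrow> 'g" +
  fixes bracket :: "'g \<Rightarrow> 'g \<Rightarrow> 'g"
  assumes bracket_add_left: "bracket (x + y) z = bracket x z + bracket y z"
    and bracket_add_right: "bracket x (y + z) = bracket x y + bracket x z"
    and bracket_scale_left: "bracket (scale c x) y = scale c (bracket x y)"
    and bracket_scale_right: "bracket x (scale c y) = scale c (bracket x y)"
    and bracket_self: "bracket x x = 0"
    and jacobi: "bracket x (bracket y z) + bracket y (bracket z x) + bracket z (bracket x y) = 0"
begin

definition lie_ideal :: "'g set \<Rightarrow> bool" where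
  "lie_ideal I \<longleftrightarrow> subspace I \<and> (\<forall>x. \<forall>y\<in>I. bracket x y \<in> I)"

definition lie_subalgebra :: "'g set \<Rightarrow> bool" where
  "lie_subalgebra S \<longleftrightarrow> subspace S \<and> (\<forall>x\<in>S. \<forall>y\<in>S. bracket x y \<in> S)"

end

locale fd_simple_lie_algebra = lie_algebra +
  assumes finite_dim: "\<exists>B. finite B \<and> span B = UNIV"
    and nonabelian: "\<exists>x y. bracket x y \<noteq> 0"
    and simple: "lie_ideal I \<Longrightarrow> I = {0} \<or> I = UNIV"

text \<open>Cartan matrices of finite type, indexed by \<open>{1..n}\<close>: generalized Cartan matrices with a
  positive definite symmetrization.\<close>

definition cartan_matrix :: "nat \<Rightarrow> (nat \<Rightarrow> nat \<Rightarrow> int) \<Rightarrow> bool" where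
  "cartan_matrix n A \<longleftrightarrow>
     (\<forall>i\<in>{1..n}. A i i = 2) \<and>
     (\<forall>i\<in>{1..n}. \<forall>j\<in>{1..n}. i \<noteq> j \<longrightarrow> A i j \<le> 0 \<and> (A i j = 0 \<longleftrightarrow> A j i = 0)) \<and>
     (\<exists>d :: nat \<Rightarrow> real.
        (\<forall>i\<in>{1..n}. d i > 0) \<and>
        (\<forall>i\<in>{1..n}. \<forall>j\<in>{1..n}. d i * of_int (A i j) = d j * of_int (A j i)) \<and>
        (\<forall>x :: nat \<Rightarrow> real. (\<exists>i\<in>{1..n}. x i \<noteq> 0) \<longrightarrow>
           (\<Sum>i\<in>{1..n}. \<Sum>j\<in>{1..n}. x i * (d i * of_int (A i j)) * x j) > 0))"

text \<open>The Chevalley generators are a generating set satisfying the Chevalley--Serre relations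
  of a Cartan matrix of finite type, with linearly independent \<open>h\<^sub>i\<close>.
  The map \<open>\<omega>\<^sub>0\<close> is the Chevalley involution.\<close>

locale chevalley_lie_algebra = fd_simple_lie_algebra scale bracket
  for scale :: "complex \<Rightarrow> 'g::ab_group_add \<Rightarrow> 'g" and bracket :: "'g \<Rightarrow> 'g \<Rightarrow> 'g" +
  fixes n :: nat and A :: "nat \<Rightarrow> nat \<Rightarrow> int"
    and e f h :: "nat \<Rightarrow> 'g" and \<omega>\<^sub>0 :: "'g \<Rightarrow> 'g"
  assumes cartan: "cartan_matrix n A"
    and h_inj: "inj_on h {1..n}"
    and h_independent: "independent (h ` {1..n})"
    and rel_hh: "\<lbrakk>i \<in> {1..n}; j \<in> {1..n}\<rbrakk> \<Longrightarrow> bracket (h i) (h j) = 0"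
    and rel_ef: "\<lbrakk>i \<in> {1..n}; j \<in> {1..n}\<rbrakk> \<Longrightarrow> bracket (e i) (f j) = (if i = j then h i else 0)"
    and rel_he: "\<lbrakk>i \<in> {1..n}; j \<in> {1..n}\<rbrakk> \<Longrightarrow> bracket (h i) (e j) = scale (of_int (A i j)) (e j)"
    and rel_hf: "\<lbrakk>i \<in> {1..n}; j \<in> {1..n}\<rbrakk> \<Longrightarrow> bracket (h i) (f j) = scale (- of_int (A i j)) (f j)"
    and serre_e: "\<lbrakk>i \<in> {1..n}; j \<in> {1..n}; i \<noteq> j\<rbrakk> \<Longrightarrow> (bracket (e i) ^^ nat (1 - A i j)) (e j) = 0"
    and serre_f: "\<lbrakk>i \<in> {1..n}; j \<in> {1..n}; i \<noteq> j\<rbrakk> \<Longrightarrow> (bracket (f i) ^^ nat (1 - A i j)) (f j) = 0"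
    and generate:
      "\<lbrakk>lie_subalgebra S; e ` {1..n} \<union> f ` {1..n} \<union> h ` {1..n} \<subseteq> S\<rbrakk> \<Longrightarrow> S = UNIV"
    and omega0_add: "\<omega>\<^sub>0 (x + y) = \<omega>\<^sub>0 x + \<omega>\<^sub>0 y"
    and omega0_scale: "\<omega>\<^sub>0 (scale c x) = scale c (\<omega>\<^sub>0 x)"
    and omega0_bracket: "\<omega>\<^sub>0 (bracket x y) = bracket (\<omega>\<^sub>0 x) (\<omega>\<^sub>0 y)"
    and omega0_involution: "\<omega>\<^sub>0 (\<omega>\<^sub>0 x) = x"
    and omega0_f: "i \<in> {1..n} \<Longrightarrow> \<omega>\<^sub>0 (f i) = - e i"
    and omega0_e: "i \<in> {1..n} \<Longrightarrow> \<omega>\<^sub>0 (e i) = - f i"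
    and omega0_h: "i \<in> {1..n} \<Longrightarrow> \<omega>\<^sub>0 (h i) = - h i"

section \<open>Associative algebras\<close>

text \<open>Unital associative complex algebras are modelled as HOL-Algebra rings with a scalar
  multiplication, using the record type of modules; multiplication need not commute.\<close>

definition alg_iso ::
  "(complex, 'a, 'x) module_scheme \<Rightarrow> (complex, 'b, 'y) module_scheme \<Rightarrow> ('a \<Rightarrow> 'b) set" where
  "alg_iso A B = {\<phi> \<in> ring_iso A B. \<forall>c. \<forall>x\<in>carrier A. \<phi> (c \<odot>\<^bsub>A\<^esub> x) = c \<odot>\<^bsub>B\<^esub> \<phi> x}"

definition quot_alg ::
  "(complex, 'a, 'x) module_scheme \<Rightarrow> 'a set \<Rightarrow> (complex, 'a set) module" where
  "quot_alg A I = ring.extend (A Quot I)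
     (module.fields (\<lambda>c X. \<Union>x\<in>X. I +>\<^bsub>A\<^esub> (c \<odot>\<^bsub>A\<^esub> x)))"

text \<open>For a decreasing chain of ideals \<open>K 0 \<supseteq> K 1 \<supseteq> \<dots>\<close> of \<open>A\<close> with \<open>K i K j \<subseteq> K (i + j)\<close>, an
  element of \<open>\<Oplus>\<^sub>n K n / K (n + 1)\<close> is a family of cosets, almost all of them zero.\<close>

definition gr_class ::
  "(complex, 'a, 'x) module_scheme \<Rightarrow> (nat \<Rightarrow> 'a set) \<Rightarrow> nat \<Rightarrow> 'a \<Rightarrow> nat \<Rightarrow> 'a set" where
  "gr_class A K r x = (\<lambda>n. if n = r then K (Suc r) +>\<^bsub>A\<^esub> x else K (Suc n))"

definition Gr ::
  "(complex, 'a, 'x) module_scheme \<Rightarrow> (nat \<Rightarrow> 'a set) \<Rightarrow> (complex, nat \<Rightarrow> 'a set) module" where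
  "Gr A K =
    \<lparr> carrier = {\<xi>. (\<forall>n. \<exists>x\<in>K n. \<xi> n = K (Suc n) +>\<^bsub>A\<^esub> x) \<and> finite {n. \<xi> n \<noteq> K (Suc n)}},
      mult = (\<lambda>\<xi> \<eta> n. finsum (A Quot K (Suc n))
                (\<lambda>i. [mod K (Suc n):] \<xi> i \<Otimes>\<^bsub>A\<^esub> \<eta> (n - i)) {..n}),
      one = gr_class A K 0 \<one>\<^bsub>A\<^esub>,
      zero = (\<lambda>n. K (Suc n)),
      add = (\<lambda>\<xi> \<eta> n. \<xi> n <+>\<^bsub>A\<^esub> \<eta> n),
      smult = (\<lambda>c \<xi> n. \<Union>x\<in>\<xi> n. K (Suc n) +>\<^bsub>A\<^esub> (c \<odot>\<^bsub>A\<^esub> x)) \<rparr>"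

text \<open>For \<open>B\<close> a subalgebra of \<open>A\<close> with the induced filtration, this sends each class modulo
  the filtration of \<open>B\<close> to the class of the same element modulo the filtration \<open>K\<close> of \<open>A\<close>.\<close>

definition gr_incl ::
  "(complex, 'a, 'x) module_scheme \<Rightarrow> (nat \<Rightarrow> 'a set) \<Rightarrow> (nat \<Rightarrow> 'a set) \<Rightarrow> nat \<Rightarrow> 'a set" where
  "gr_incl A K \<xi> = (\<lambda>n. \<Union>x\<in>\<xi> n. K (Suc n) +>\<^bsub>A\<^esub> x)"

section \<open>Universal enveloping algebras\<close>

text \<open>Words form a monoid under concatenation, so \<open>'l list \<Rightarrow>\<^sub>0 complex\<close> with the convolution
  product is the free associative algebra on \<open>'l\<close>.\<close>

instantiation list :: (type) monoid_add
begin
definition zero_list :: "'a list" where "zero_list = []"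
definition plus_list :: "'a list \<Rightarrow> 'a list \<Rightarrow> 'a list" where "plus_list = (@)"
instance by standard (simp_all add: zero_list_def plus_list_def)
end

definition free_alg :: "'l set \<Rightarrow> (complex, 'l list \<Rightarrow>\<^sub>0 complex) module" where
  "free_alg S =
    \<lparr> carrier = {p. Poly_Mapping.keys p \<subseteq> lists S}, mult = (*), one = 1, zero = 0, add = (+),
      smult = (\<lambda>c. Poly_Mapping.map ((*) c)) \<rparr>"

text \<open>\<open>S\<close> is a Lie subalgebra of the Lie algebra with scalar multiplication \<open>scale\<close> and bracket
  \<open>br\<close>.  The first two families of relations turn the free algebra into the tensor algebra.\<close>

definition uea_rels ::
  "(complex \<Rightarrow> 'l \<Rightarrow> 'l) \<Rightarrow> ('l \<Rightarrow> 'l \<Rightarrow> 'l) \<Rightarrow> 'l::ab_group_add set \<Rightarrow> ('l list \<Rightarrow>\<^sub>0 complex) set" where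
  "uea_rels scale br S =
     {Poly_Mapping.single [x + y] 1 - Poly_Mapping.single [x] 1 - Poly_Mapping.single [y] 1
        | x y. x \<in> S \<and> y \<in> S} \<union>
     {Poly_Mapping.single [scale c x] 1 - Poly_Mapping.single [x] c | c x. x \<in> S} \<union>
     {Poly_Mapping.single [x, y] 1 - Poly_Mapping.single [y, x] 1 - Poly_Mapping.single [br x y] 1
        | x y. x \<in> S \<and> y \<in> S}"

definition uea_ideal ::
  "(complex \<Rightarrow> 'l \<Rightarrow> 'l) \<Rightarrow> ('l \<Rightarrow> 'l \<Rightarrow> 'l) \<Rightarrow> 'l::ab_group_add set \<Rightarrow> ('l list \<Rightarrow>\<^sub>0 complex) set" where
  "uea_ideal scale br S = Idl\<^bsub>free_alg S\<^esub> (uea_rels scale br S)"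

definition uea ::
  "(complex \<Rightarrow> 'l \<Rightarrow> 'l) \<Rightarrow> ('l \<Rightarrow> 'l \<Rightarrow> 'l) \<Rightarrow> 'l::ab_group_add set
     \<Rightarrow> (complex, ('l list \<Rightarrow>\<^sub>0 complex) set) module" where
  "uea scale br S = quot_alg (free_alg S) (uea_ideal scale br S)"

definition uea_gen ::
  "(complex \<Rightarrow> 'l \<Rightarrow> 'l) \<Rightarrow> ('l \<Rightarrow> 'l \<Rightarrow> 'l) \<Rightarrow> 'l::ab_group_add set \<Rightarrow> 'l
     \<Rightarrow> ('l list \<Rightarrow>\<^sub>0 complex) set" where
  "uea_gen scale br S x = uea_ideal scale br S +>\<^bsub>free_alg S\<^esub> Poly_Mapping.single [x] 1"

text \<open>For Lie subalgebras \<open>S \<subseteq> T\<close>, the algebra homomorphism \<open>U(S) \<rightarrow> U(T)\<close> extending the inclusion: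
  a class modulo the ideal of \<open>S\<close> goes to the class modulo the ideal of \<open>T\<close> containing it.\<close>

definition uea_incl ::
  "(complex \<Rightarrow> 'l \<Rightarrow> 'l) \<Rightarrow> ('l \<Rightarrow> 'l \<Rightarrow> 'l) \<Rightarrow> 'l::ab_group_add set
     \<Rightarrow> ('l list \<Rightarrow>\<^sub>0 complex) set \<Rightarrow> ('l list \<Rightarrow>\<^sub>0 complex) set" where
  "uea_incl scale br T X = (\<Union>p\<in>X. uea_ideal scale br T +>\<^bsub>free_alg T\<^esub> p)"

section \<open>Loop and current algebras\<close>

text \<open>\<open>\<gg>[u]\<close> is \<open>nat \<Rightarrow>\<^sub>0 'g\<close> and \<open>\<gg>[t, t\<^sup>-\<^sup>1]\<close> is \<open>int \<Rightarrow>\<^sub>0 'g\<close>, the coefficient of the \<open>k\<close>-th power of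
  the variable being the value at \<open>k\<close>; thus \<open>g t\<^sup>k\<close> is \<open>Poly_Mapping.single k g\<close>.\<close>

definition pm_scale ::
  "(complex \<Rightarrow> 'g \<Rightarrow> 'g) \<Rightarrow> complex \<Rightarrow> ('k \<Rightarrow>\<^sub>0 'g::ab_group_add) \<Rightarrow> ('k \<Rightarrow>\<^sub>0 'g)" where
  "pm_scale scale c = Poly_Mapping.map (scale c)"

definition pm_bracket ::
  "('g \<Rightarrow> 'g \<Rightarrow> 'g) \<Rightarrow> ('k::monoid_add \<Rightarrow>\<^sub>0 'g::ab_group_add) \<Rightarrow> ('k \<Rightarrow>\<^sub>0 'g) \<Rightarrow> ('k \<Rightarrow>\<^sub>0 'g)" where
  "pm_bracket br p q =
     (\<Sum>j\<in>Poly_Mapping.keys p. \<Sum>k\<in>Poly_Mapping.keys q.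
        Poly_Mapping.single (j + k) (br (Poly_Mapping.lookup p j) (Poly_Mapping.lookup q k)))"

definition loop_omega :: "('g \<Rightarrow> 'g) \<Rightarrow> (int \<Rightarrow>\<^sub>0 'g::ab_group_add) \<Rightarrow> (int \<Rightarrow>\<^sub>0 'g)" where
  "loop_omega \<omega>\<^sub>0 p =
     (\<Sum>k\<in>Poly_Mapping.keys p. Poly_Mapping.single (- k) (\<omega>\<^sub>0 (Poly_Mapping.lookup p k)))"

definition current_omega ::
  "(complex \<Rightarrow> 'g \<Rightarrow> 'g) \<Rightarrow> ('g \<Rightarrow> 'g) \<Rightarrow> (nat \<Rightarrow>\<^sub>0 'g::ab_group_add) \<Rightarrow> (nat \<Rightarrow>\<^sub>0 'g)" where
  "current_omega scale \<omega>\<^sub>0 p =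
     (\<Sum>r\<in>Poly_Mapping.keys p.
        Poly_Mapping.single r (scale ((- 1) ^ r) (\<omega>\<^sub>0 (Poly_Mapping.lookup p r))))"

definition loop_fixed :: "('g \<Rightarrow> 'g) \<Rightarrow> (int \<Rightarrow>\<^sub>0 'g::ab_group_add) set" where
  "loop_fixed \<omega>\<^sub>0 = {p. loop_omega \<omega>\<^sub>0 p = p}"

definition current_fixed ::
  "(complex \<Rightarrow> 'g \<Rightarrow> 'g) \<Rightarrow> ('g \<Rightarrow> 'g) \<Rightarrow> (nat \<Rightarrow>\<^sub>0 'g::ab_group_add) set" where
  "current_fixed scale \<omega>\<^sub>0 = {p. current_omega scale \<omega>\<^sub>0 p = p}"

abbreviation U_current ::
  "(complex \<Rightarrow> 'g \<Rightarrow> 'g) \<Rightarrow> ('g \<Rightarrow> 'g \<Rightarrow> 'g)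
     \<Rightarrow> (complex, ((nat \<Rightarrow>\<^sub>0 'g::ab_group_add) list \<Rightarrow>\<^sub>0 complex) set) module" where
  "U_current scale br \<equiv> uea (pm_scale scale) (pm_bracket br) UNIV"

abbreviation U_current_fixed ::
  "(complex \<Rightarrow> 'g \<Rightarrow> 'g) \<Rightarrow> ('g \<Rightarrow> 'g \<Rightarrow> 'g) \<Rightarrow> ('g \<Rightarrow> 'g)
     \<Rightarrow> (complex, ((nat \<Rightarrow>\<^sub>0 'g::ab_group_add) list \<Rightarrow>\<^sub>0 complex) set) module" where
  "U_current_fixed scale br \<omega>\<^sub>0 \<equiv> uea (pm_scale scale) (pm_bracket br) (current_fixed scale \<omega>\<^sub>0)"

abbreviation U_loop ::
  "(complex \<Rightarrow> 'g \<Rightarrow> 'g) \<Rightarrow> ('g \<Rightarrow> 'g \<Rightarrow> 'g)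
     \<Rightarrow> (complex, ((int \<Rightarrow>\<^sub>0 'g::ab_group_add) list \<Rightarrow>\<^sub>0 complex) set) module" where
  "U_loop scale br \<equiv> uea (pm_scale scale) (pm_bracket br) UNIV"

abbreviation loop_gen ::
  "(complex \<Rightarrow> 'g \<Rightarrow> 'g) \<Rightarrow> ('g \<Rightarrow> 'g \<Rightarrow> 'g) \<Rightarrow> (int \<Rightarrow>\<^sub>0 'g::ab_group_add)
     \<Rightarrow> ((int \<Rightarrow>\<^sub>0 'g) list \<Rightarrow>\<^sub>0 complex) set" where
  "loop_gen scale br \<equiv> uea_gen (pm_scale scale) (pm_bracket br) UNIV"

text \<open>The subalgebra \<open>U(\<gg>[t, t\<^sup>-\<^sup>1]\<^sup>\<omega>)\<close> of \<open>U(\<gg>[t, t\<^sup>-\<^sup>1])\<close>.\<close>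

definition U_loop_fixed ::
  "(complex \<Rightarrow> 'g \<Rightarrow> 'g) \<Rightarrow> ('g \<Rightarrow> 'g \<Rightarrow> 'g) \<Rightarrow> ('g \<Rightarrow> 'g)
     \<Rightarrow> (complex, ((int \<Rightarrow>\<^sub>0 'g::ab_group_add) list \<Rightarrow>\<^sub>0 complex) set) module" where
  "U_loop_fixed scale br \<omega>\<^sub>0 = (U_loop scale br)\<lparr> carrier :=
     uea_incl (pm_scale scale) (pm_bracket br) UNIV `
       carrier (uea (pm_scale scale) (pm_bracket br) (loop_fixed \<omega>\<^sub>0)) \<rparr>"

section \<open>The filtrations\<close>

text \<open>\<open>g (t - 1)\<^sup>r t\<^sup>k\<close>, with the Laurent polynomial computed in \<open>int \<Rightarrow>\<^sub>0 complex\<close>.\<close>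

definition loop_elem ::
  "(complex \<Rightarrow> 'g \<Rightarrow> 'g) \<Rightarrow> 'g \<Rightarrow> nat \<Rightarrow> int \<Rightarrow> (int \<Rightarrow>\<^sub>0 'g::ab_group_add)" where
  "loop_elem scale g r k =
     Poly_Mapping.map (\<lambda>c. scale c g)
       ((Poly_Mapping.single 1 1 - 1) ^ r * Poly_Mapping.single k 1)"

definition kappa ::
  "(complex \<Rightarrow> 'g \<Rightarrow> 'g) \<Rightarrow> ('g \<Rightarrow> 'g \<Rightarrow> 'g) \<Rightarrow> nat
     \<Rightarrow> ((int \<Rightarrow>\<^sub>0 'g::ab_group_add) list \<Rightarrow>\<^sub>0 complex) set set" where
  "kappa scale br r = Idl\<^bsub>U_loop scale br\<^esub>
     {foldr (\<lambda>(g, s, k) z. loop_gen scale br (loop_elem scale g s k) \<otimes>\<^bsub>U_loop scale br\<^esub> z)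
        ws \<one>\<^bsub>U_loop scale br\<^esub>
        | ws :: ('g \<times> nat \<times> int) list. r \<le> (\<Sum>(g, s, k)\<leftarrow>ws. s)}"

definition kappa_i ::
  "(complex \<Rightarrow> 'g \<Rightarrow> 'g) \<Rightarrow> ('g \<Rightarrow> 'g \<Rightarrow> 'g) \<Rightarrow> ('g \<Rightarrow> 'g) \<Rightarrow> nat
     \<Rightarrow> ((int \<Rightarrow>\<^sub>0 'g::ab_group_add) list \<Rightarrow>\<^sub>0 complex) set set" where
  "kappa_i scale br \<omega>\<^sub>0 m = kappa scale br m \<inter> carrier (U_loop_fixed scale br \<omega>\<^sub>0)"

abbreviation Gr_kappa ::
  "(complex \<Rightarrow> 'g \<Rightarrow> 'g) \<Rightarrow> ('g \<Rightarrow> 'g \<Rightarrow> 'g)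
     \<Rightarrow> (complex, nat \<Rightarrow> ((int \<Rightarrow>\<^sub>0 'g::ab_group_add) list \<Rightarrow>\<^sub>0 complex) set set) module" where
  "Gr_kappa scale br \<equiv> Gr (U_loop scale br) (kappa scale br)"

abbreviation Gr_kappa_i ::
  "(complex \<Rightarrow> 'g \<Rightarrow> 'g) \<Rightarrow> ('g \<Rightarrow> 'g \<Rightarrow> 'g) \<Rightarrow> ('g \<Rightarrow> 'g)
     \<Rightarrow> (complex, nat \<Rightarrow> ((int \<Rightarrow>\<^sub>0 'g::ab_group_add) list \<Rightarrow>\<^sub>0 complex) set set) module" where
  "Gr_kappa_i scale br \<omega>\<^sub>0 \<equiv> Gr (U_loop_fixed scale br \<omega>\<^sub>0) (kappa_i scale br \<omega>\<^sub>0)"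

section \<open>Distinguished elements\<close>

text \<open>The families \<open>h\<close>, \<open>e\<close>, \<open>f\<close> are the Chevalley generators.\<close>

definition t_elem :: "(nat \<Rightarrow> 'g) \<Rightarrow> nat \<Rightarrow> nat \<Rightarrow> (nat \<Rightarrow>\<^sub>0 'g::ab_group_add)" where
  "t_elem h i r = Poly_Mapping.single r (h i)"

definition x_elem ::
  "(complex \<Rightarrow> 'g \<Rightarrow> 'g) \<Rightarrow> (nat \<Rightarrow> 'g) \<Rightarrow> (nat \<Rightarrow> 'g) \<Rightarrow> nat \<Rightarrow> nat
     \<Rightarrow> (nat \<Rightarrow>\<^sub>0 'g::ab_group_add)" where
  "x_elem scale e f i m = Poly_Mapping.single m (scale ((- 1) ^ m) (f i) - e i)"

definition theta :: "(nat \<Rightarrow> 'g) \<Rightarrow> nat \<Rightarrow> nat \<Rightarrow> (int \<Rightarrow>\<^sub>0 'g::ab_group_add)" where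
  "theta h i m = Poly_Mapping.single (int m) (h i) - Poly_Mapping.single (- int m) (h i)"

definition b_elem ::
  "(nat \<Rightarrow> 'g) \<Rightarrow> (nat \<Rightarrow> 'g) \<Rightarrow> nat \<Rightarrow> int \<Rightarrow> (int \<Rightarrow>\<^sub>0 'g::ab_group_add)" where
  "b_elem e f i k = Poly_Mapping.single (- k) (f i) - Poly_Mapping.single k (e i)"

definition theta_rl ::
  "(complex \<Rightarrow> 'g \<Rightarrow> 'g) \<Rightarrow> (nat \<Rightarrow> 'g) \<Rightarrow> nat \<Rightarrow> nat \<Rightarrow> nat \<Rightarrow> (int \<Rightarrow>\<^sub>0 'g::ab_group_add)" where
  "theta_rl scale h i r l =
     (\<Sum>s = 0..r. pm_scale scale ((- 1) ^ (r - s) * of_nat (r choose s)) (theta h i (s + l)))"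

definition beta_rk ::
  "(complex \<Rightarrow> 'g \<Rightarrow> 'g) \<Rightarrow> (nat \<Rightarrow> 'g) \<Rightarrow> (nat \<Rightarrow> 'g) \<Rightarrow> nat \<Rightarrow> nat \<Rightarrow> int
     \<Rightarrow> (int \<Rightarrow>\<^sub>0 'g::ab_group_add)" where
  "beta_rk scale e f i r k =
     (\<Sum>s = 0..r. pm_scale scale ((- 1) ^ (r - s) * of_nat (r choose s)) (b_elem e f i (int s + k)))"

end

theory Submission
  imports Defs "HOL-Algebra.Subrings" "HOL-Library.Multiset"
begin

text \<open>
  Write \<open>\<omega>\<close> for both involutions.  The homomorphism \<open>\<Phi>\<^sub>i\<close> is induced by lifting
  \<open>g u\<^sup>r\<close>, where \<open>(-1)\<^sup>r \<omega>\<^sub>0(g) = g\<close>, to the \<open>\<omega>\<close>-fixed element \<open>g (t - 1)\<^sup>r (1 + t\<^sup>-\<^sup>r) / 2\<close>, which has the same symbol as \<open>g (t - 1)\<^sup>r\<close>.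
  These lifts also yield a filtration \<open>\<kappa>'\<close> of \<open>U(\<gg>[t, t\<^sup>-\<^sup>1]\<^sup>\<omega>)\<close>, by weights of words in
  \<open>\<omega>\<close>-fixed elements, together with a surjection \<open>U(\<gg>[u]\<^sup>\<omega>) \<rightarrow> Gr \<kappa>'\<close>.  Its composition
  with \<open>Gr \<kappa>' \<rightarrow> Gr \<kappa>\<close> is \<open>\<Phi>\<close> restricted along \<open>U(\<gg>[u]\<^sup>\<omega>) \<rightarrow> U(\<gg>[u])\<close>.  As the latter
  is injective, \<open>Gr \<kappa>' \<rightarrow> Gr \<kappa>\<close> is injective as well, whence \<open>\<kappa>'\<^sub>m = \<kappa>\<^sub>m \<inter> U(\<gg>[t, t\<^sup>-\<^sup>1]\<^sup>\<omega>)\<close>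
  by induction on \<open>m\<close>.

  For the injectivity no ordered basis is needed: since \<open>\<gg>[u]\<close> is centreless, the matrix
  coefficients of its adjoint representation separate points; products of such functionals with
  respect to the coproduct detect the top-degree part of an element of \<open>U(\<gg>[u]\<^sup>\<omega>)\<close>.
\<close>

text \<open>The factor \<open>(1 + t^-r) / 2\<close> is an average over the involution:
  \<open>\<omega>\<close> sends \<open>g (t - 1)^r\<close> to
  \<open>(-1)^r \<omega>\<^sub>0(g) t^-r (t - 1)^r\<close>, which is \<open>g t^-r (t - 1)^r\<close>
  when \<open>(-1)^r \<omega>\<^sub>0(g) = g\<close>. The obstacle is that the filtration of the
  fixed subalgebra is an intersection. An element written in fixed letters may, by cancellation, lie
  deeper in the ambient filtration than the weights of its letters show, so no spanning set of the
  intersection is known in advance. The weight filtration has spanning words by construction, which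
  makes surjectivity accessible, and the injectivity of \<open>\<Phi>\<close> is what rules out
  hidden cancellation. The lift is linear but not a Lie homomorphism: it respects brackets only up
  to one further power of \<open>t - 1\<close>, which is all that an associated graded algebra sees.
  Computations take place on representatives in free algebras; the filtrations are pulled back there
  and contain the defining ideal, so that congruences become memberships.\<close>

abbreviation sgl :: "'a \<Rightarrow> 'b::zero \<Rightarrow> 'a \<Rightarrow>\<^sub>0 'b" where "sgl \<equiv> Poly_Mapping.single"
abbreviation coef :: "('a \<Rightarrow>\<^sub>0 'b::zero) \<Rightarrow> 'a \<Rightarrow> 'b" where "coef \<equiv> Poly_Mapping.lookup"

section \<open>Additive maps on finitely supported functions\<close>

lemma pm_sum_singles: "(\<Sum>k\<in>Poly_Mapping.keys p. sgl k (coef p k)) = p"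
  for p :: "'a \<Rightarrow>\<^sub>0 'b::comm_monoid_add"
  by (rule poly_mapping_eqI)
     (auto simp: lookup_sum lookup_single when_def sum.delta not_in_keys_iff_lookup_eq_zero)

lemma pm_induct_on [consumes 1, case_names zero single add]:
  fixes p :: "'a \<Rightarrow>\<^sub>0 'b::comm_monoid_add"
  assumes "Poly_Mapping.keys p \<subseteq> A" and "P 0" and "\<And>k v. k \<in> A \<Longrightarrow> P (sgl k v)"
    and add: "\<And>p q. P p \<Longrightarrow> P q \<Longrightarrow> P (p + q)"
  shows "P p"
proof -
  have "P (\<Sum>k\<in>K. sgl k (coef p k))" if "finite K" "K \<subseteq> A" for K
    using that by (induction K rule: finite_induct) (auto simp: assms)
  from this[of "Poly_Mapping.keys p"] assms(1) show ?thesis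
    by (simp add: pm_sum_singles)
qed

lemma pm_induct [case_names single add]:
  fixes p :: "'a \<Rightarrow>\<^sub>0 'b::comm_monoid_add"
  assumes "\<And>k v. P (sgl k v)" and "\<And>p q. P p \<Longrightarrow> P q \<Longrightarrow> P (p + q)"
  shows "P p"
proof -
  have "P 0" using assms(1)[of undefined 0] by simp
  then show ?thesis by (intro pm_induct_on[of p UNIV P]) (auto simp: assms)
qed

definition additive_map :: "('a::ab_group_add \<Rightarrow> 'b::ab_group_add) \<Rightarrow> bool" where
  "additive_map F \<longleftrightarrow> (\<forall>x y. F (x + y) = F x + F y)"

lemma additive_mapI: "(\<And>x y. F (x + y) = F x + F y) \<Longrightarrow> additive_map F"
  by (simp add: additive_map_def)

lemma additive_map_add: "additive_map F \<Longrightarrow> F (x + y) = F x + F y"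
  by (simp add: additive_map_def)

lemma additive_map_0: "additive_map F \<Longrightarrow> F 0 = 0"
  using additive_map_add[of F 0 0] by simp

lemma additive_map_uminus: "additive_map F \<Longrightarrow> F (- x) = - F x"
  using additive_map_add[of F x "- x"] by (simp add: additive_map_0 eq_neg_iff_add_eq_0 add.commute)

lemma additive_map_diff: "additive_map F \<Longrightarrow> F (x - y) = F x - F y"
  using additive_map_add[of F x "- y"] by (simp add: additive_map_uminus)

lemma additive_map_sum: "additive_map F \<Longrightarrow> F (sum g A) = (\<Sum>a\<in>A. F (g a))"
  by (induction A rule: infinite_finite_induct) (auto simp: additive_map_0 additive_map_add)

text \<open>The map out of a direct sum with components \<open>F k\<close>. The maps
  \<open>word_ext\<close>, \<open>shift\<close>, \<open>ev1\<close> and \<open>psi\<close> are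
  instances, and their additivity comes from \<open>additive_pm_ext\<close>.\<close>

definition pm_ext :: "('a \<Rightarrow> 'c::zero \<Rightarrow> 'b::comm_monoid_add) \<Rightarrow> ('a \<Rightarrow>\<^sub>0 'c) \<Rightarrow> 'b" where
  "pm_ext F p = (\<Sum>k\<in>Poly_Mapping.keys p. F k (coef p k))"

lemma additive_pm_ext:
  fixes F :: "'a \<Rightarrow> 'c::ab_group_add \<Rightarrow> 'b::ab_group_add"
  assumes "\<And>k. additive_map (F k)"
  shows "additive_map (pm_ext F)"
  unfolding additive_map_def pm_ext_def
  by (intro allI setsum_keys_plus_distrib) (simp_all add: additive_map_0[OF assms] additive_map_add[OF assms])

lemma pm_ext_single: "F k 0 = 0 \<Longrightarrow> pm_ext F (sgl k v) = F k v"
  by (simp add: pm_ext_def)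

lemma additive_single: "additive_map (sgl k)"
  by (simp add: additive_map_def single_add)

section \<open>Free algebras\<close>

lemma single_Nil_1 [simp]: "sgl [] (1::'c::zero_neq_one) = 1"
  by (metis single_one zero_list_def)

lemma word_mult: "sgl (u :: 'l list) a * sgl v b = sgl (u @ v) (a * b :: 'c::semiring_0)"
  by (simp add: mult_single plus_list_def)

lemma Nil_mult_commute: "p * sgl [] c = sgl [] c * p" for p :: "'l list \<Rightarrow>\<^sub>0 complex"
  by (induction p rule: pm_induct) (simp_all add: word_mult algebra_simps)

text \<open>Scalars are treated as the central elements \<open>sgl [] c\<close> of the free algebra,
  so that ring ideals are closed under them without a separate linear structure.\<close>

lemma map_scale_conv: "Poly_Mapping.map ((*) c) p = sgl [] c * p" for p :: "'l list \<Rightarrow>\<^sub>0 complex"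
  using mult_map_scale_conv_mult[of c p] by (simp add: zero_list_def)

lemma free_alg_simps [simp]:
  "carrier (free_alg S) = {p. Poly_Mapping.keys p \<subseteq> lists S}"
  "monoid.mult (free_alg S) = (*)" "one (free_alg S) = 1" "zero (free_alg S) = 0" "add (free_alg S) = (+)"
  "smult (free_alg S) c p = sgl [] c * p"
  by (simp_all add: free_alg_def map_scale_conv)

lemma keys_mult_lists:
  fixes p q :: "'l list \<Rightarrow>\<^sub>0 complex"
  assumes "Poly_Mapping.keys p \<subseteq> lists S" "Poly_Mapping.keys q \<subseteq> lists S"
  shows "Poly_Mapping.keys (p * q) \<subseteq> lists S"
proof
  fix w assume "w \<in> Poly_Mapping.keys (p * q)"
  then obtain u v where "w = u @ v" "u \<in> Poly_Mapping.keys p" "v \<in> Poly_Mapping.keys q"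
    using keys_mult[of p q] unfolding plus_list_def by blast
  then show "w \<in> lists S" using assms by (metis append_in_lists_conv subsetD)
qed

lemma keys_add_lists:
  fixes p q :: "'l list \<Rightarrow>\<^sub>0 complex"
  assumes "Poly_Mapping.keys p \<subseteq> lists S" "Poly_Mapping.keys q \<subseteq> lists S"
  shows "Poly_Mapping.keys (p + q) \<subseteq> lists S" "Poly_Mapping.keys (p - q) \<subseteq> lists S"
    "Poly_Mapping.keys (- p) \<subseteq> lists S"
proof -
  have "Poly_Mapping.keys (p - q) \<subseteq> Poly_Mapping.keys p \<union> Poly_Mapping.keys q"
    by (auto simp: in_keys_iff lookup_minus)
  then show "Poly_Mapping.keys (p - q) \<subseteq> lists S" using assms by blast
  show "Poly_Mapping.keys (p + q) \<subseteq> lists S" using assms keys_add[of p q] by blast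
  have "Poly_Mapping.keys (- p) = Poly_Mapping.keys p" by (auto simp: in_keys_iff)
  then show "Poly_Mapping.keys (- p) \<subseteq> lists S" using assms by simp
qed

lemma ring_free_alg: "ring (free_alg S)"
proof (rule ringI)
  show "abelian_group (free_alg S)"
  proof (rule abelian_groupI)
    fix x assume "x \<in> carrier (free_alg S)"
    then show "\<exists>y\<in>carrier (free_alg S). y \<oplus>\<^bsub>free_alg S\<^esub> x = \<zero>\<^bsub>free_alg S\<^esub>"
      by (intro bexI[of _ "- x"]) (simp_all add: keys_add_lists(3))
  qed (simp_all add: keys_add_lists algebra_simps)
  show "monoid (free_alg S)"
    by (rule monoidI) (simp_all add: keys_mult_lists mult.assoc zero_list_def)
qed (simp_all add: algebra_simps)

lemma free_alg_a_inv:
  assumes "p \<in> carrier (free_alg S)" shows "\<ominus>\<^bsub>free_alg S\<^esub> p = - p"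
proof -
  interpret ring "free_alg S" by (rule ring_free_alg)
  have "- p \<in> carrier (free_alg S)" using assms by (simp add: keys_add_lists(3))
  then show ?thesis using assms
    by (intro minus_equality) auto
qed

lemma free_alg_coset: "I +>\<^bsub>free_alg S\<^esub> p = (\<lambda>i. i + p) ` I"
  by (auto simp: a_r_coset_def r_coset_def)

lemma free_alg_ideal_simps:
  assumes "ideal I (free_alg S)"
  shows "0 \<in> I" "p \<in> I \<Longrightarrow> - p \<in> I" "p \<in> I \<Longrightarrow> q \<in> I \<Longrightarrow> p + q \<in> I" "p \<in> I \<Longrightarrow> q \<in> I \<Longrightarrow> p - q \<in> I"
    "p \<in> I \<Longrightarrow> q \<in> carrier (free_alg S) \<Longrightarrow> p * q \<in> I"
    "p \<in> I \<Longrightarrow> q \<in> carrier (free_alg S) \<Longrightarrow> q * p \<in> I"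
    "I \<subseteq> carrier (free_alg S)"
proof -
  interpret ideal I "free_alg S" by (rule assms)
  show "I \<subseteq> carrier (free_alg S)" by (rule a_subset)
  show 0: "0 \<in> I" using additive_subgroup.zero_closed[OF is_additive_subgroup] by simp
  show neg: "- p \<in> I" if "p \<in> I" for p using additive_subgroup.a_inv_closed[OF is_additive_subgroup that] free_alg_a_inv[OF subsetD[OF a_subset that]] by simp
  show add: "p + q \<in> I" if "p \<in> I" "q \<in> I" for p q using additive_subgroup.a_closed[OF is_additive_subgroup that] by simp
  show "p - q \<in> I" if "p \<in> I" "q \<in> I" for p q using add[OF that(1) neg[OF that(2)]] by simp
  show "p * q \<in> I" if "p \<in> I" "q \<in> carrier (free_alg S)" for p q using I_r_closed[OF that] by simp
  show "q * p \<in> I" if "p \<in> I" "q \<in> carrier (free_alg S)" for p q using I_l_closed[OF that] by simp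
qed

lemma free_alg_idealI:
  fixes I :: "('l list \<Rightarrow>\<^sub>0 complex) set"
  assumes "I \<subseteq> carrier (free_alg S)" "0 \<in> I" "\<And>p q. p \<in> I \<Longrightarrow> q \<in> I \<Longrightarrow> p + q \<in> I"
    and l: "\<And>p q. p \<in> I \<Longrightarrow> q \<in> carrier (free_alg S) \<Longrightarrow> q * p \<in> I"
    and "\<And>p q. p \<in> I \<Longrightarrow> q \<in> carrier (free_alg S) \<Longrightarrow> p * q \<in> I"
  shows "ideal I (free_alg S)"
proof (rule idealI[OF ring_free_alg])
  \<comment> \<open>Negation is multiplication by the constant -1.\<close>
  have "- p \<in> I" if "p \<in> I" for p
  proof -
    have "sgl [] (-1) = - (1 :: 'l list \<Rightarrow>\<^sub>0 complex)" by (metis single_uminus single_Nil_1)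
    moreover have "sgl [] (-1) * p \<in> I" using that by (rule l) simp
    ultimately show ?thesis by simp
  qed
  then have neg: "\<ominus>\<^bsub>free_alg S\<^esub> p \<in> I" if "p \<in> I" for p
    using that free_alg_a_inv[OF subsetD[OF assms(1) that]] by simp
  interpret ring "free_alg S" by (rule ring_free_alg)
  show "subgroup I (add_monoid (free_alg S))"
  proof (rule add.subgroupI)
    show "I \<noteq> {}" using assms(2) by blast
    show "p \<oplus>\<^bsub>free_alg S\<^esub> q \<in> I" if "p \<in> I" "q \<in> I" for p q
      using assms(3)[OF that] by simp
  next
    show "\<ominus>\<^bsub>free_alg S\<^esub> p \<in> I" if "p \<in> I" for p
      using that by (rule neg)
  qed (fact assms(1))
  show "q \<otimes>\<^bsub>free_alg S\<^esub> p \<in> I" "p \<otimes>\<^bsub>free_alg S\<^esub> q \<in> I" if "p \<in> I" "q \<in> carrier (free_alg S)" for p q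
    using assms(4,5)[OF that] by (simp_all only: free_alg_simps(2))
qed

section \<open>Enveloping algebras as quotients\<close>

locale lie_sub =
  fixes sc :: "complex \<Rightarrow> 'l::ab_group_add \<Rightarrow> 'l" and br :: "'l \<Rightarrow> 'l \<Rightarrow> 'l" and S :: "'l set"
  assumes zero_closed: "0 \<in> S" and add_closed: "x \<in> S \<Longrightarrow> y \<in> S \<Longrightarrow> x + y \<in> S"
    and sc_closed: "x \<in> S \<Longrightarrow> sc c x \<in> S"
    and br_closed: "x \<in> S \<Longrightarrow> y \<in> S \<Longrightarrow> br x y \<in> S"
begin

abbreviation "F \<equiv> free_alg S"
abbreviation "I \<equiv> uea_ideal sc br S"
abbreviation "U \<equiv> uea sc br S"
definition proj where "proj p = I +>\<^bsub>F\<^esub> p"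

lemma rels_closed: "uea_rels sc br S \<subseteq> carrier F"
proof -
  have 1: "sgl w c \<in> carrier F" if "set w \<subseteq> S" for w and c :: complex
    using that by (simp add: in_lists_conv_set subset_iff)
  have 2: "p - q \<in> carrier F" if "p \<in> carrier F" "q \<in> carrier F" for p q
    using that by (simp add: keys_add_lists)
  show ?thesis
    unfolding uea_rels_def
    by (intro Un_least subsetI; elim CollectE exE conjE; hypsubst; intro 1 2)
       (simp_all add: add_closed sc_closed br_closed)
qed

lemma ideal_I: "ideal I F"
  unfolding uea_ideal_def by (rule ring.genideal_ideal[OF ring_free_alg rels_closed])

lemmas I_simps = free_alg_ideal_simps[OF ideal_I]

lemma I_rels:
  "x \<in> S \<Longrightarrow> y \<in> S \<Longrightarrow> sgl [x + y] 1 - sgl [x] 1 - sgl [y] 1 \<in> I"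
  "x \<in> S \<Longrightarrow> sgl [sc c x] 1 - sgl [x] c \<in> I"
  "x \<in> S \<Longrightarrow> y \<in> S \<Longrightarrow> sgl [x, y] 1 - sgl [y, x] 1 - sgl [br x y] 1 \<in> I"
proof -
  have sub: "uea_rels sc br S \<subseteq> I"
    unfolding uea_ideal_def by (rule ring.genideal_self[OF ring_free_alg rels_closed])
  show "sgl [x + y] 1 - sgl [x] 1 - sgl [y] 1 \<in> I" if "x \<in> S" "y \<in> S"
    by (rule subsetD[OF sub], unfold uea_rels_def, rule UnI1, rule UnI1, rule CollectI,
        rule exI[of _ x], rule exI[of _ y]) (simp add: that)
  show "sgl [sc c x] 1 - sgl [x] c \<in> I" if "x \<in> S"
    by (rule subsetD[OF sub], unfold uea_rels_def, rule UnI1, rule UnI2, rule CollectI,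
        rule exI[of _ c], rule exI[of _ x]) (simp add: that)
  show "sgl [x, y] 1 - sgl [y, x] 1 - sgl [br x y] 1 \<in> I" if "x \<in> S" "y \<in> S"
    by (rule subsetD[OF sub], unfold uea_rels_def, rule UnI2, rule CollectI,
        rule exI[of _ x], rule exI[of _ y]) (simp add: that)
qed

lemma I_minimal: "ideal X F \<Longrightarrow> uea_rels sc br S \<subseteq> X \<Longrightarrow> I \<subseteq> X"
  unfolding uea_ideal_def by (rule ring.genideal_minimal[OF ring_free_alg])

lemma in_proj_iff: "q \<in> proj p \<longleftrightarrow> q - p \<in> I"
  unfolding proj_def free_alg_coset image_iff by (metis add_diff_cancel_right' diff_add_cancel)

lemma proj_eq_iff: "proj p = proj q \<longleftrightarrow> p - q \<in> I"
proof
  assume "proj p = proj q"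
  then show "p - q \<in> I" by (metis in_proj_iff I_simps(1) diff_self)
next
  assume pq: "p - q \<in> I"
  have "r - p \<in> I \<longleftrightarrow> r - q \<in> I" for r
  proof
    assume "r - p \<in> I" from I_simps(3)[OF this pq] show "r - q \<in> I" by simp
  next
    assume "r - q \<in> I" from I_simps(4)[OF this pq] show "r - p \<in> I" by simp
  qed
  then show "proj p = proj q" using in_proj_iff by blast
qed

lemma U_carrier: "carrier U = proj ` carrier F"
  by (auto simp: uea_def quot_alg_def ring.defs module.defs FactRing_def A_RCOSETS_def' proj_def)

text \<open>The scalar multiplication of \<open>quot_alg\<close> and the map \<open>uea_incl\<close>
  are unions over a coset. A family that is constant on the coset collapses to its value at one
  representative.\<close>

lemma F_Union_image:
  assumes "\<And>p. q - p \<in> I \<Longrightarrow> G p = G q"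
  shows "(\<Union>p\<in>proj q. G p) = G q"
proof -
  have "q \<in> proj q" using in_proj_iff I_simps(1) by simp
  moreover have "G p = G q" if "p \<in> proj q" for p
    using assms[of p] I_simps(2)[of "p - q"] that unfolding in_proj_iff minus_diff_eq by blast
  ultimately show ?thesis by fast
qed

lemma U_mult: "p \<in> carrier F \<Longrightarrow> q \<in> carrier F \<Longrightarrow> proj p \<otimes>\<^bsub>U\<^esub> proj q = proj (p * q)"
  using ideal.rcoset_mult_add[OF ideal_I, of p q]
  by (simp add: uea_def quot_alg_def ring.defs module.defs FactRing_def proj_def)

lemma U_add: "p \<in> carrier F \<Longrightarrow> q \<in> carrier F \<Longrightarrow> proj p \<oplus>\<^bsub>U\<^esub> proj q = proj (p + q)"
  using abelian_subgroup.a_rcos_sum[OF ideal.axioms(1)[OF ideal_I, THEN abelian_subgroupI3], of p q]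
    ring.is_abelian_group[OF ring_free_alg, of S]
  apply (simp add: uea_def quot_alg_def ring.defs module.defs FactRing_def proj_def)
  done

lemma U_one: "\<one>\<^bsub>U\<^esub> = proj 1"
  by (simp add: uea_def quot_alg_def ring.defs module.defs FactRing_def proj_def)

lemma U_zero: "\<zero>\<^bsub>U\<^esub> = proj 0"
  by (simp add: uea_def quot_alg_def ring.defs module.defs FactRing_def proj_def free_alg_coset)

lemma U_smult: "c \<odot>\<^bsub>U\<^esub> proj p = proj (sgl [] c * p)"
proof -
  have "c \<odot>\<^bsub>U\<^esub> proj p = (\<Union>x\<in>proj p. proj (sgl [] c * x))"
    by (simp add: uea_def quot_alg_def ring.defs module.defs proj_def)
  also have "\<dots> = proj (sgl [] c * p)"
  proof (rule F_Union_image)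
    fix q assume "p - q \<in> I"
    then have "sgl [] c * (q - p) \<in> I" using I_simps(2)[of "p - q"] by (intro I_simps(6)) simp_all
    then show "proj (sgl [] c * q) = proj (sgl [] c * p)" by (simp add: proj_eq_iff algebra_simps)
  qed
  finally show ?thesis .
qed

lemma uea_gen_eq: "uea_gen sc br S x = proj (sgl [x] 1)"
  by (simp add: uea_gen_def proj_def)

lemma carrier_F_closed:
  "p \<in> carrier F \<Longrightarrow> q \<in> carrier F \<Longrightarrow> p + q \<in> carrier F"
  "p \<in> carrier F \<Longrightarrow> q \<in> carrier F \<Longrightarrow> p - q \<in> carrier F"
  "p \<in> carrier F \<Longrightarrow> q \<in> carrier F \<Longrightarrow> p * q \<in> carrier F"
  "p \<in> carrier F \<Longrightarrow> - p \<in> carrier F" "0 \<in> carrier F" "1 \<in> carrier F"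
  by (simp_all add: keys_add_lists keys_mult_lists zero_list_def)

lemma U_memI: "p \<in> carrier F \<Longrightarrow> proj p \<in> carrier U"
  by (simp add: U_carrier)

lemma U_memE:
  assumes "x \<in> carrier U" obtains p where "p \<in> carrier F" "x = proj p"
  using assms by (auto simp: U_carrier)

lemmas U_simps = U_add U_zero U_one U_mult U_memI carrier_F_closed

lemma ring_U: "ring U"
proof (rule ringI)
  show "abelian_group U"
  proof (rule abelian_groupI)
    fix x assume "x \<in> carrier U"
    then obtain p where p: "p \<in> carrier F" "x = proj p" by (rule U_memE)
    have "proj (- p) \<oplus>\<^bsub>U\<^esub> x = \<zero>\<^bsub>U\<^esub>" "proj (- p) \<in> carrier U"
      using p(1) unfolding p(2) by (simp_all only: U_simps left_minus)
    then show "\<exists>y\<in>carrier U. y \<oplus>\<^bsub>U\<^esub> x = \<zero>\<^bsub>U\<^esub>" by blast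
  next
    show "x \<oplus>\<^bsub>U\<^esub> y \<in> carrier U" if "x \<in> carrier U" "y \<in> carrier U" for x y
      using that by (elim U_memE) (simp only: U_simps)
    show "x \<oplus>\<^bsub>U\<^esub> y \<oplus>\<^bsub>U\<^esub> z = x \<oplus>\<^bsub>U\<^esub> (y \<oplus>\<^bsub>U\<^esub> z)"
      if "x \<in> carrier U" "y \<in> carrier U" "z \<in> carrier U" for x y z
      using that by (elim U_memE) (simp only: U_simps ac_simps)
    show "x \<oplus>\<^bsub>U\<^esub> y = y \<oplus>\<^bsub>U\<^esub> x" if "x \<in> carrier U" "y \<in> carrier U" for x y
      using that by (elim U_memE) (simp only: U_simps ac_simps)
    show "\<zero>\<^bsub>U\<^esub> \<oplus>\<^bsub>U\<^esub> x = x" if "x \<in> carrier U" for x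
      using that by (elim U_memE) (simp only: U_simps add_0_left)
  qed (simp only: U_simps)
  show "monoid U"
  proof (rule monoidI)
    show "x \<otimes>\<^bsub>U\<^esub> y \<in> carrier U" if "x \<in> carrier U" "y \<in> carrier U" for x y
      using that by (elim U_memE) (simp only: U_simps)
    show "x \<otimes>\<^bsub>U\<^esub> y \<otimes>\<^bsub>U\<^esub> z = x \<otimes>\<^bsub>U\<^esub> (y \<otimes>\<^bsub>U\<^esub> z)"
      if "x \<in> carrier U" "y \<in> carrier U" "z \<in> carrier U" for x y z
      using that by (elim U_memE) (simp only: U_simps ac_simps)
    show "\<one>\<^bsub>U\<^esub> \<otimes>\<^bsub>U\<^esub> x = x" "x \<otimes>\<^bsub>U\<^esub> \<one>\<^bsub>U\<^esub> = x" if "x \<in> carrier U" for x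
      using that by (elim U_memE; simp only: U_simps mult_1_left mult_1_right)+
  qed (simp only: U_simps)
  show "(x \<oplus>\<^bsub>U\<^esub> y) \<otimes>\<^bsub>U\<^esub> z = x \<otimes>\<^bsub>U\<^esub> z \<oplus>\<^bsub>U\<^esub> y \<otimes>\<^bsub>U\<^esub> z"
    "z \<otimes>\<^bsub>U\<^esub> (x \<oplus>\<^bsub>U\<^esub> y) = z \<otimes>\<^bsub>U\<^esub> x \<oplus>\<^bsub>U\<^esub> z \<otimes>\<^bsub>U\<^esub> y"
    if "x \<in> carrier U" "y \<in> carrier U" "z \<in> carrier U" for x y z
    using that by (elim U_memE; simp only: U_simps distrib_right distrib_left)+
qed

text \<open>The easy half of the comparison of the two ideals: \<open>T.I \<inter> carrier F\<close>
  is an ideal of \<open>F\<close> that contains the relations of \<open>S\<close>. The converse is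
  \<open>uea_ideal_contracts\<close>.\<close>

lemma I_subset_UNIV: "I \<subseteq> uea_ideal sc br UNIV"
proof -
  interpret T: lie_sub sc br UNIV by unfold_locales auto
  have "I \<subseteq> T.I \<inter> carrier F"
  proof (rule I_minimal)
    show "ideal (T.I \<inter> carrier F) F"
    proof (rule free_alg_idealI)
      show "q * p \<in> T.I \<inter> carrier F" "p * q \<in> T.I \<inter> carrier F"
        if "p \<in> T.I \<inter> carrier F" "q \<in> carrier F" for p q
        using that T.I_simps(5,6)[of p q] carrier_F_closed(3) by auto
    qed (use T.I_simps(1,3) carrier_F_closed in blast)+
    have "uea_rels sc br S \<subseteq> uea_rels sc br UNIV" unfolding uea_rels_def by blast
    moreover have "uea_rels sc br UNIV \<subseteq> T.I"
      unfolding uea_ideal_def by (rule ring.genideal_self[OF ring_free_alg T.rels_closed])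
    ultimately show "uea_rels sc br S \<subseteq> T.I \<inter> carrier F" using rels_closed by blast
  qed
  then show ?thesis by blast
qed

lemma uea_incl_proj: "uea_incl sc br UNIV (proj p) = lie_sub.proj sc br UNIV p"
proof -
  interpret T: lie_sub sc br UNIV by unfold_locales auto
  have "uea_incl sc br UNIV (proj p) = (\<Union>q\<in>proj p. T.proj q)"
    by (simp add: uea_incl_def T.proj_def)
  also have "\<dots> = T.proj p"
  proof (rule F_Union_image)
    fix q assume "p - q \<in> I"
    then have "q - p \<in> T.I" using I_subset_UNIV I_simps(2)[of "p - q"] by auto
    then show "T.proj q = T.proj p" by (simp add: T.proj_eq_iff)
  qed
  finally show ?thesis .
qed

text \<open>The carrier \<open>P\<close> allows for subalgebras of the enveloping algebra.\<close>

lemma ideal_proj_image: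
  assumes P: "P \<subseteq> carrier F" "1 \<in> P" "\<And>p q. p \<in> P \<Longrightarrow> q \<in> P \<Longrightarrow> p + q \<in> P"
    "\<And>p q. p \<in> P \<Longrightarrow> q \<in> P \<Longrightarrow> p * q \<in> P" "\<And>p. p \<in> P \<Longrightarrow> - p \<in> P"
    and X: "X \<subseteq> P" "0 \<in> X" "\<And>p q. p \<in> X \<Longrightarrow> q \<in> X \<Longrightarrow> p + q \<in> X" "\<And>p. p \<in> X \<Longrightarrow> - p \<in> X"
    "\<And>p q. p \<in> X \<Longrightarrow> q \<in> P \<Longrightarrow> p * q \<in> X" "\<And>p q. p \<in> X \<Longrightarrow> q \<in> P \<Longrightarrow> q * p \<in> X"
  shows "ideal (proj ` X) (U\<lparr>carrier := proj ` P\<rparr>)"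
proof -
  interpret U: ring U by (rule ring_U)
  have inv: "\<ominus>\<^bsub>U\<^esub> proj p = proj (- p)" if "p \<in> carrier F" for p
    by (rule U.minus_equality) (use that in \<open>simp_all only: U_simps left_minus\<close>)
  have XF: "p \<in> carrier F" if "p \<in> X" for p using that X(1) P(1) by blast
  have PF: "p \<in> carrier F" if "p \<in> P" for p using that P(1) by blast
  have sub: "subring (proj ` P) U"
  proof (rule U.subringI)
    show "proj ` P \<subseteq> carrier U" using PF U_memI by blast
    show "\<one>\<^bsub>U\<^esub> \<in> proj ` P" using P(2) U_one by simp
    show "\<ominus>\<^bsub>U\<^esub> x \<in> proj ` P" if "x \<in> proj ` P" for x
      using that by (elim imageE) (simp only: inv PF P(5) imageI)
    show "x \<otimes>\<^bsub>U\<^esub> y \<in> proj ` P" "x \<oplus>\<^bsub>U\<^esub> y \<in> proj ` P" if "x \<in> proj ` P" "y \<in> proj ` P" for x y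
      using that by (elim imageE, simp only: U_mult U_add PF P(3,4) imageI)+
  qed
  interpret V: ring "U\<lparr>carrier := proj ` P\<rparr>" by (rule U.subring_is_ring[OF sub])
  have invV: "\<ominus>\<^bsub>U\<lparr>carrier := proj ` P\<rparr>\<^esub> proj p = proj (- p)" if "p \<in> P" for p
    by (rule V.minus_equality) (use that PF P(5)[OF that] carrier_F_closed(4) in \<open>simp_all add: U_add U_zero del: free_alg_simps\<close>)
  show ?thesis
  proof (rule idealI[OF V.ring_axioms])
    show "subgroup (proj ` X) (add_monoid (U\<lparr>carrier := proj ` P\<rparr>))"
    proof (rule V.add.subgroupI)
      show "proj ` X \<subseteq> carrier (U\<lparr>carrier := proj ` P\<rparr>)" using X(1) by auto
      show "proj ` X \<noteq> {}" using X(2) by auto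
      show "\<ominus>\<^bsub>U\<lparr>carrier := proj ` P\<rparr>\<^esub> x \<in> proj ` X" if "x \<in> proj ` X" for x
        using that X(1) by (elim imageE) (simp only: invV subsetD[OF X(1)] X(4) imageI)
      show "x \<oplus>\<^bsub>U\<lparr>carrier := proj ` P\<rparr>\<^esub> y \<in> proj ` X" if "x \<in> proj ` X" "y \<in> proj ` X" for x y
        using that by (elim imageE) (simp del: free_alg_simps add: U_add XF X(3))
    qed
    fix a x assume "a \<in> proj ` X" "x \<in> carrier (U\<lparr>carrier := proj ` P\<rparr>)"
    then obtain p q where pq: "a = proj p" "p \<in> X" "x = proj q" "q \<in> P" by auto
    then show "x \<otimes>\<^bsub>U\<lparr>carrier := proj ` P\<rparr>\<^esub> a \<in> proj ` X" "a \<otimes>\<^bsub>U\<lparr>carrier := proj ` P\<rparr>\<^esub> x \<in> proj ` X"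
      by (simp_all del: free_alg_simps add: U_mult XF PF X(5,6))
  qed
qed

end

lemma (in lie_sub) finsum_proj:
  assumes "finite B" "\<And>i. i \<in> B \<Longrightarrow> g i \<in> carrier F"
  shows "finsum U (\<lambda>i. proj (g i)) B = proj (sum g B) \<and> sum g B \<in> carrier F"
  using assms
proof (induction B rule: finite_induct)
  case empty
  interpret ring U by (rule ring_U)
  show ?case by (simp add: U_zero)
next
  case (insert i B)
  interpret ring U by (rule ring_U)
  have "finsum U (\<lambda>i. proj (g i)) (insert i B) = proj (g i) \<oplus>\<^bsub>U\<^esub> finsum U (\<lambda>i. proj (g i)) B"
    using insert U_memI by (intro finsum_insert) auto
  then show ?case using insert carrier_F_closed(1)[of "g i" "sum g B"] by (simp add: U_add del: free_alg_simps)
qed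

section \<open>Injectivity of enveloping algebras of subalgebras\<close>

text \<open>Word functions satisfying the relations of the enveloping algebra, that is, linear
  functionals on it.\<close>

definition uea_fun :: "(complex \<Rightarrow> 'l \<Rightarrow> 'l) \<Rightarrow> ('l \<Rightarrow> 'l \<Rightarrow> 'l) \<Rightarrow> ('l::ab_group_add list \<Rightarrow> complex) \<Rightarrow> bool" where
  "uea_fun sc br f \<longleftrightarrow>
     (\<forall>u v x y. f (u @ (x + y) # v) = f (u @ x # v) + f (u @ y # v)) \<and>
     (\<forall>u v c x. f (u @ sc c x # v) = c * f (u @ x # v)) \<and>
     (\<forall>u v x y. f (u @ x # y # v) - f (u @ y # x # v) = f (u @ br x y # v))"

lemma uea_funD:
  assumes "uea_fun sc br f"
  shows "f (u @ (x + y) # v) = f (u @ x # v) + f (u @ y # v)"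
    "f (u @ sc c x # v) = c * f (u @ x # v)"
    "f (u @ x # y # v) - f (u @ y # x # v) = f (u @ br x y # v)"
  using assms unfolding uea_fun_def by blast+

text \<open>Precomposition of a functional with left multiplication by \<open>a\<close>; the
  inductions along words in \<open>uea_fun_conv\<close> pass to it.\<close>

lemma uea_fun_Cons:
  assumes "uea_fun sc br f" shows "uea_fun sc br (\<lambda>w. f (a # w))"
  unfolding uea_fun_def using uea_funD[OF assms, where u = "a # u" for u] by simp

lemma uea_fun_add:
  assumes f: "uea_fun sc br f" and g: "uea_fun sc br g" shows "uea_fun sc br (\<lambda>w. f w + g w)"
  unfolding uea_fun_def by (simp add: uea_funD[OF f] uea_funD[OF g] add_diff_add distrib_left)

lemma uea_fun_cmult:
  assumes f: "uea_fun sc br f" shows "uea_fun sc br (\<lambda>w. c * f w)"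
  unfolding uea_fun_def by (simp add: uea_funD[OF f] distrib_left flip: right_diff_distrib)

lemma uea_fun_zero: "uea_fun sc br (\<lambda>w. 0)"
  unfolding uea_fun_def by simp

lemma uea_fun_sum: "(\<And>i. i \<in> A \<Longrightarrow> uea_fun sc br (f i)) \<Longrightarrow> uea_fun sc br (\<lambda>w. \<Sum>i\<in>A. f i w)"
  by (induction A rule: infinite_finite_induct) (simp_all add: uea_fun_zero uea_fun_add)

lemma uea_fun_counit: "uea_fun sc br (\<lambda>w. if w = [] then 1 else 0)"
  unfolding uea_fun_def by simp

text \<open>The product of functionals that is dual to the coproduct for which Lie algebra elements
  are primitive.\<close>

fun conv :: "('l list \<Rightarrow> complex) \<Rightarrow> ('l list \<Rightarrow> complex) \<Rightarrow> 'l list \<Rightarrow> complex" where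
  "conv f g [] = f [] * g []"
| "conv f g (x # w) = conv (\<lambda>w. f (x # w)) g w + conv f (\<lambda>w. g (x # w)) w"

lemma conv_add_left: "conv (\<lambda>w. f w + f' w) g w = conv f g w + conv f' g w"
  by (induction w arbitrary: f f' g) (simp_all add: algebra_simps)

lemma conv_add_right: "conv f (\<lambda>w. g w + g' w) w = conv f g w + conv f g' w"
  by (induction w arbitrary: f g g') (simp_all add: algebra_simps)

lemma conv_cmult_left: "conv (\<lambda>w. c * f w) g w = c * conv f g w"
  by (induction w arbitrary: f g) (simp_all add: algebra_simps)

lemma conv_cmult_right: "conv f (\<lambda>w. c * g w) w = c * conv f g w"
  by (induction w arbitrary: f g) (simp_all add: algebra_simps)

text \<open>By the recursion of \<open>conv\<close>, left translation by a letter is a derivation of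
  this product. In the commutator of two such derivations the mixed terms cancel, so it is the
  derivation belonging to the bracket.\<close>

lemma uea_fun_conv:
  assumes "uea_fun sc br f" "uea_fun sc br g"
  shows "uea_fun sc br (conv f g)"
proof -
  have "conv f g (u @ (x + y) # v) = conv f g (u @ x # v) + conv f g (u @ y # v)" for u v x y
    using assms
  proof (induction u arbitrary: f g)
    case Nil
    have *: "f ((x + y) # w) = f (x # w) + f (y # w)" "g ((x + y) # w) = g (x # w) + g (y # w)" for w
      using uea_funD(1)[OF Nil(1), of "[]"] uea_funD(1)[OF Nil(2), of "[]"] by simp_all
    show ?case by (simp add: * conv_add_left conv_add_right)
  next
    case (Cons a u)
    then show ?case using uea_fun_Cons[of sc br _ a] by simp
  qed
  moreover have "conv f g (u @ sc c x # v) = c * conv f g (u @ x # v)" for u v c x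
    using assms
  proof (induction u arbitrary: f g)
    case Nil
    have *: "f (sc c x # w) = c * f (x # w)" "g (sc c x # w) = c * g (x # w)" for w
      using uea_funD(2)[OF Nil(1), of "[]"] uea_funD(2)[OF Nil(2), of "[]"] by simp_all
    show ?case by (simp add: * conv_cmult_left conv_cmult_right algebra_simps)
  next
    case (Cons a u)
    then show ?case using uea_fun_Cons[of sc br _ a] by (simp add: algebra_simps)
  qed
  moreover have "conv f g (u @ x # y # v) - conv f g (u @ y # x # v) = conv f g (u @ br x y # v)" for u v x y
    using assms
  proof (induction u arbitrary: f g)
    case Nil
    have *: "f (x # y # w) = f (y # x # w) + f (br x y # w)"
      "g (x # y # w) = g (y # x # w) + g (br x y # w)" for w
      using uea_funD(3)[OF Nil(1), of "[]" x y w] uea_funD(3)[OF Nil(2), of "[]" x y w]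
      by (simp_all add: algebra_simps)
    show ?case by (simp add: * conv_add_left conv_add_right)
  next
    case (Cons a u)
    then show ?case using uea_fun_Cons[of sc br _ a] by (simp add: algebra_simps)
  qed
  ultimately show ?thesis unfolding uea_fun_def by blast
qed

text \<open>Every other way of distributing the letters of \<open>w\<close> over the two factors
  leaves \<open>g\<close> with a shorter word.\<close>

lemma conv_lowest:
  assumes "\<And>w'. length w' < length w \<Longrightarrow> g w' = 0"
  shows "conv f g w = f [] * g w"
  using assms
proof (induction w arbitrary: f g)
  case (Cons x w)
  have "conv (\<lambda>w. f (x # w)) g w = f [x] * g w" by (rule Cons.IH) (simp add: Cons.prems)
  moreover have "conv f (\<lambda>w. g (x # w)) w = f [] * g (x # w)" by (rule Cons.IH) (simp add: Cons.prems)
  ultimately show ?case by (simp add: Cons.prems)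
qed simp

text \<open>At least one letter must go to \<open>f\<close>, since \<open>f [] = 0\<close>, and at
  most one may, since \<open>g\<close> vanishes on words with fewer than \<open>n\<close> letters.
  The sum runs over the position of that letter.\<close>

lemma conv_primitive_lowest:
  assumes "f [] = 0" "\<And>w'. length w' < n \<Longrightarrow> g w' = 0" "length w = Suc n"
  shows "conv f g w = (\<Sum>i<Suc n. f [w ! i] * g (take i w @ drop (Suc i) w))"
  using assms(2,3)
proof (induction w arbitrary: g n)
  case (Cons x w)
  have 1: "conv (\<lambda>w. f (x # w)) g w = f [x] * g w"
    using Cons.prems by (intro conv_lowest) simp
  show ?case
  proof (cases n)
    case 0
    then show ?thesis using 1 Cons.prems assms(1) by simp
  next
    case (Suc m)
    have "conv f (\<lambda>w. g (x # w)) w = (\<Sum>i<Suc m. f [w ! i] * g (x # take i w @ drop (Suc i) w))"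
      using Cons.prems Suc by (intro Cons.IH) simp_all
    then show ?thesis using 1 unfolding Suc
      by (subst sum.lessThan_Suc_shift) simp
  qed
qed simp

fun conv_list :: "('l list \<Rightarrow> complex) list \<Rightarrow> 'l list \<Rightarrow> complex" where
  "conv_list [] = (\<lambda>w. if w = [] then 1 else 0)"
| "conv_list (f # fs) = conv f (conv_list fs)"

lemma uea_fun_conv_list: "(\<And>f. f \<in> set fs \<Longrightarrow> uea_fun sc br f) \<Longrightarrow> uea_fun sc br (conv_list fs)"
  by (induction fs) (simp_all add: uea_fun_counit uea_fun_conv)

text \<open>With fewer letters than factors, some factor is evaluated at the empty word.\<close>

lemma conv_list_short:
  "(\<And>f. f \<in> set fs \<Longrightarrow> f [] = 0) \<Longrightarrow> length w < length fs \<Longrightarrow> conv_list fs w = 0"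
proof (induction fs arbitrary: w)
  case (Cons f fs)
  have "conv f (conv_list fs) w = f [] * conv_list fs w"
    using Cons by (intro conv_lowest) simp
  then show ?case using Cons.prems by simp
qed simp

text \<open>On words with as many letters as there are factors, the product counts the matchings of
  letters with functionals, so it depends only on the multiset of letters. The constant
  \<open>C\<close> built by the induction is the product of the factorials of the multiplicities in
  \<open>bs\<close>: each new \<open>b\<close> can be matched with any of its occurrences. It is
  nonzero in characteristic 0.\<close>

lemma conv_list_dual:
  assumes \<alpha>: "\<And>b. b \<in> B \<Longrightarrow> \<alpha> b [] = (0::complex)"
    "\<And>b b'. b \<in> B \<Longrightarrow> b' \<in> B \<Longrightarrow> \<alpha> b [b'] = (if b = b' then 1 else 0)"
  shows "bs \<in> lists B \<Longrightarrow> \<exists>C. C \<noteq> 0 \<and> (\<forall>w\<in>lists B. length w = length bs \<longrightarrow>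
     conv_list (map \<alpha> bs) w = (if mset w = mset bs then C else 0))"
proof (induction bs)
  case Nil
  show ?case by (intro exI[of _ 1]) simp
next
  case (Cons b bs)
  then obtain C where C: "C \<noteq> 0" "\<And>w. w \<in> lists B \<Longrightarrow> length w = length bs \<Longrightarrow>
     conv_list (map \<alpha> bs) w = (if mset w = mset bs then C else 0)" by auto
  have b: "b \<in> B" "bs \<in> lists B" using Cons.prems by auto
  let ?n = "count (mset (b # bs)) b"
  have "conv_list (map \<alpha> (b # bs)) w = (if mset w = mset (b # bs) then of_nat ?n * C else 0)"
    if w: "w \<in> lists B" "length w = length (b # bs)" for w
  proof -
    have t: "\<alpha> b [w ! i] * conv_list (map \<alpha> bs) (take i w @ drop (Suc i) w) =
       (if w ! i = b then if mset w = mset (b # bs) then C else 0 else 0)" if i: "i < Suc (length bs)" for i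
    proof (cases "w ! i = b")
      case True
      let ?w = "take i w @ drop (Suc i) w"
      have "set ?w \<subseteq> set w" using set_take_subset set_drop_subset by fastforce
      then have l: "?w \<in> lists B" "length ?w = length bs" using w i by auto
      have "mset w = mset (take i w @ w ! i # drop (Suc i) w)"
        using w i by (simp flip: id_take_nth_drop)
      then have "mset w = add_mset b (mset ?w)" using True by simp
      then have "mset ?w = mset bs \<longleftrightarrow> mset w = mset (b # bs)" by auto
      then show ?thesis using True C(2)[OF l] \<alpha>(2)[OF b(1) b(1)] by simp
    next
      case False
      have "w ! i \<in> B" using w i by (metis in_listsD length_Cons nth_mem)
      then show ?thesis using False \<alpha>(2)[OF b(1)] by auto
    qed
    have "conv_list (map \<alpha> (b # bs)) w =
       (\<Sum>i<Suc (length bs). \<alpha> b [w ! i] * conv_list (map \<alpha> bs) (take i w @ drop (Suc i) w))"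
      unfolding conv_list.simps list.map
      by (rule conv_primitive_lowest) (use b w \<alpha>(1) in \<open>auto intro!: conv_list_short\<close>)
    also have "\<dots> = (\<Sum>i<length w. if w ! i = b then if mset w = mset (b # bs) then C else 0 else 0)"
      using w t by (intro sum.cong) auto
    also have "\<dots> = of_nat (card {i. i < length w \<and> w ! i = b}) * (if mset w = mset (b # bs) then C else 0)"
      by (simp flip: sum.inter_filter add: Collect_conj_eq lessThan_def)
    also have "card {i. i < length w \<and> w ! i = b} = count (mset w) b"
      by (simp add: count_mset count_list_eq_length_filter length_filter_conv_card eq_commute)
    finally show ?thesis by auto
  qed
  moreover have "of_nat ?n * C \<noteq> 0" using C(1) by (simp del: of_nat_Suc)
  ultimately show ?case by blast
qed

section \<open>Functionals on the free algebra that kill the defining ideal\<close>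

definition word_ext :: "('l list \<Rightarrow> complex) \<Rightarrow> ('l list \<Rightarrow>\<^sub>0 complex) \<Rightarrow> complex" where
  "word_ext f = pm_ext (\<lambda>w c. c * f w)"

lemma additive_word_ext: "additive_map (word_ext f)"
  unfolding word_ext_def by (intro additive_pm_ext additive_mapI) (simp add: algebra_simps)

lemma word_ext_single: "word_ext f (sgl w c) = c * f w"
  unfolding word_ext_def by (simp add: pm_ext_single)

lemmas word_ext_simps = word_ext_single additive_map_add[OF additive_word_ext]
  additive_map_diff[OF additive_word_ext] additive_map_0[OF additive_word_ext]

lemma word_ext_mult_vanish:
  assumes "\<And>u v. word_ext f (sgl u 1 * p * sgl v 1) = 0"
  shows "word_ext f (q * p * r) = 0"
proof -
  have s: "word_ext f (sgl [] c * p') = c * word_ext f p'" for c p'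
    by (induction p' rule: pm_induct) (simp_all add: word_mult word_ext_simps distrib_left)
  have "word_ext f (sgl u c * p * sgl v d) = 0" for u v c d
  proof -
    have "sgl u c * p * sgl v d = sgl [] (c * d) * (sgl u 1 * p * sgl v 1)"
      using Nil_mult_commute[of "sgl u 1 * p" d]
      by (metis (no_types, lifting) append_Nil mult.assoc mult.right_neutral word_mult)
    then show ?thesis by (simp add: s assms)
  qed
  then have "word_ext f (sgl u c * p * r) = 0" for u c
    by (induction r rule: pm_induct) (simp_all add: word_ext_simps distrib_left)
  then show ?thesis
    by (induction q rule: pm_induct) (simp_all add: word_ext_simps distrib_right)
qed

lemma (in lie_sub) uea_fun_vanishes:
  assumes f: "uea_fun sc br f" and "p \<in> I"
  shows "word_ext f p = 0"
proof -
  \<comment> \<open>The kernel of a functional need not be an ideal; requiring all two-sided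
    multiples to be killed gives an ideal inside it.\<close>
  let ?X = "{p \<in> carrier F. \<forall>q r. word_ext f (q * p * r) = 0}"
  have "ideal ?X F"
  proof (rule free_alg_idealI)
    show "q * p \<in> ?X" if "p \<in> ?X" "q \<in> carrier F" for p q
    proof -
      have "word_ext f (q' * (q * p) * r) = 0" for q' r
        using that(1) by (simp flip: mult.assoc)
      then show ?thesis using that carrier_F_closed(3) by blast
    qed
    show "p * q \<in> ?X" if "p \<in> ?X" "q \<in> carrier F" for p q
    proof -
      have "word_ext f (q' * (p * q) * r) = 0" for q' r
        using that(1) by (simp add: mult.assoc)
      then show ?thesis using that carrier_F_closed(3) by blast
    qed
  qed (auto simp: word_ext_simps distrib_left distrib_right carrier_F_closed simp del: free_alg_simps(1))
  moreover have "word_ext f (q * p * r) = 0" if "p \<in> uea_rels sc br S" for p q r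
  proof (rule word_ext_mult_vanish)
    fix u v
    show "word_ext f (sgl u 1 * p * sgl v 1) = 0"
      using that unfolding uea_rels_def
      by (elim UnE CollectE exE conjE; hypsubst)
         (simp_all add: left_diff_distrib right_diff_distrib word_mult word_ext_simps uea_funD[OF f])
  qed
  ultimately have "I \<subseteq> ?X"
    using rels_closed by (intro I_minimal) blast+
  then have "word_ext f (1 * p * 1) = 0" using assms(2) by blast
  then show ?thesis by simp
qed

lemma uea_fun_lincomb:
  assumes f: "uea_fun sc br f" and sc: "vector_space sc"
  shows "f [(\<Sum>b\<in>B. sc (g b) b)] = (\<Sum>b\<in>B. g b * f [b])"
proof -
  interpret vector_space sc by (rule sc)
  have "f [0] = 0" using uea_funD(1)[OF f, of "[]" 0 0 "[]"] by simp
  then show ?thesis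
    by (induction B rule: infinite_finite_induct)
       (simp_all add: uea_funD(1,2)[OF f, where u = "[]", simplified])
qed

text \<open>A Gram-Schmidt argument: point separation yields a functional for each new basis vector,
  which is then made orthogonal to the old ones.\<close>

lemma dual_functionals:
  assumes "vector_space sc"
    and sep: "\<And>x. x \<noteq> 0 \<Longrightarrow> \<exists>f. uea_fun sc br f \<and> f [] = 0 \<and> f [x] \<noteq> 0"
  shows "finite B \<Longrightarrow> \<not> module.dependent sc B \<Longrightarrow>
    \<exists>\<alpha>. \<forall>b\<in>B. uea_fun sc br (\<alpha> b) \<and> \<alpha> b [] = 0 \<and> (\<forall>b'\<in>B. \<alpha> b [b'] = (if b = b' then 1 else 0))"
proof (induction B rule: finite_induct)
  case (insert b B)
  interpret vector_space sc by fact
  have ind: "independent B" "b \<notin> span B" using insert.hyps insert.prems by (auto simp: independent_insert)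
  then obtain \<alpha> where \<alpha>: "\<And>c. c \<in> B \<Longrightarrow> uea_fun sc br (\<alpha> c)" "\<And>c. c \<in> B \<Longrightarrow> \<alpha> c [] = 0"
    "\<And>c c'. c \<in> B \<Longrightarrow> c' \<in> B \<Longrightarrow> \<alpha> c [c'] = (if c = c' then 1 else 0)"
    using insert.IH by blast
  \<comment> \<open>The vector \<open>b - s\<close> is killed by all the old functionals and is
    nonzero because \<open>b\<close> is not in the span of \<open>B\<close>. A functional that
    separates it from 0 sees what the old ones miss.\<close>
  define s where "s = (\<Sum>c\<in>B. sc (\<alpha> c [b]) c)"
  have "s \<in> span B" unfolding s_def by (intro span_sum span_scale span_base)
  then have "b - s \<noteq> 0" using ind(2) by auto
  then obtain f where f: "uea_fun sc br f" "f [] = 0" "f [b - s] \<noteq> 0" using sep by blast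
  have "f [b] = f [b - s] + f [s]" using uea_funD(1)[OF f(1), of "[]" "b - s" s "[]"] by simp
  then have y: "f [b - s] = f [b] - (\<Sum>c\<in>B. \<alpha> c [b] * f [c])"
    unfolding s_def by (simp add: uea_fun_lincomb[OF f(1) vector_space_axioms])
  define \<beta> where "\<beta> = (\<lambda>w. (1 / f [b - s]) * (f w + (\<Sum>c\<in>B. (- f [c]) * \<alpha> c w)))"
  have good: "uea_fun sc br \<beta>" unfolding \<beta>_def
    by (intro uea_fun_cmult uea_fun_add uea_fun_sum f \<alpha>)
  have nil: "\<beta> [] = 0" unfolding \<beta>_def using \<alpha>(2) f(2) by simp
  have \<beta>B: "\<beta> [c] = 0" if "c \<in> B" for c
  proof -
    have "(\<Sum>c'\<in>B. (- f [c']) * \<alpha> c' [c]) = (\<Sum>c'\<in>B. if c' = c then - f [c] else 0)"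
      using that \<alpha>(3) by (intro sum.cong) auto
    then show ?thesis using that insert.hyps unfolding \<beta>_def by simp
  qed
  have "(\<Sum>c\<in>B. \<alpha> c [b] * f [c]) = (\<Sum>c\<in>B. f [c] * \<alpha> c [b])" by (simp add: mult.commute)
  then have \<beta>b: "\<beta> [b] = 1" unfolding \<beta>_def using f(3) y by (simp add: sum_negf)
  \<comment> \<open>The old functionals are corrected to vanish at \<open>b\<close>; as
    \<open>\<beta>\<close> vanishes on \<open>B\<close>, their values on \<open>B\<close> do not
    change.\<close>
  define \<alpha>' where "\<alpha>' = (\<lambda>c. if c = b then \<beta> else (\<lambda>w. \<alpha> c w + (- \<alpha> c [b]) * \<beta> w))"
  have "uea_fun sc br (\<alpha>' c)" if "c \<in> insert b B" for c
    using that good \<alpha>(1)[of c] by (auto simp: \<alpha>'_def intro!: uea_fun_add uea_fun_cmult simp del: mult_minus_left)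
  moreover have "\<alpha>' c [] = 0" if "c \<in> insert b B" for c
    using that nil \<alpha>(2) by (auto simp: \<alpha>'_def)
  moreover have "\<alpha>' c [c'] = (if c = c' then 1 else 0)" if "c \<in> insert b B" "c' \<in> insert b B" for c c'
    using that \<beta>B \<beta>b \<alpha>(3) insert.hyps(2) by (auto simp: \<alpha>'_def)
  ultimately show ?case by blast
qed simp

section \<open>The length filtration and the contraction of the ambient ideal\<close>

locale lie_sub_separated = lie_sub + vector_space sc +
  assumes sep: "x \<noteq> 0 \<Longrightarrow> \<exists>f. uea_fun sc br f \<and> f [] = 0 \<and> f [x] \<noteq> 0"
begin

text \<open>The inequality is strict, so \<open>short B 0\<close> contains only 0; this starts the
  induction in \<open>uea_ideal_contracts\<close>.\<close>

definition short :: "'a set \<Rightarrow> nat \<Rightarrow> ('a list \<Rightarrow>\<^sub>0 complex) set" where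
  "short B d = {p. Poly_Mapping.keys p \<subseteq> {w \<in> lists B. length w < d}}"

text \<open>The standard filtration of the enveloping algebra of \<open>S\<close>, pulled back to
  the free algebra, with the degree shifted by one.\<close>

definition len_filt :: "nat \<Rightarrow> ('a list \<Rightarrow>\<^sub>0 complex) set" where
  "len_filt d = {p. \<exists>q\<in>short S d. p - q \<in> I}"

lemma short_closed:
  "0 \<in> short B d" "p \<in> short B d \<Longrightarrow> q \<in> short B d \<Longrightarrow> p + q \<in> short B d"
  "w \<in> lists B \<Longrightarrow> length w < d \<Longrightarrow> sgl w c \<in> short B d"
  using keys_add[of p q] by (auto simp: short_def)

lemma short_mult_left:
  assumes "p \<in> short B d" "w \<in> lists B"
  shows "sgl w c * p \<in> short B (length w + d)"
proof -
  have "Poly_Mapping.keys p \<subseteq> {w \<in> lists B. length w < d}" using assms(1) by (simp add: short_def)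
  then show ?thesis
    by (induction p rule: pm_induct_on) (use assms(2) in \<open>auto simp: word_mult distrib_left intro!: short_closed\<close>)
qed

lemma short_subset_F: "B \<subseteq> S \<Longrightarrow> short B d \<subseteq> carrier F"
  unfolding short_def using lists_mono[of B S] by auto

lemma len_filt_closed:
  "0 \<in> len_filt d" "p \<in> len_filt d \<Longrightarrow> q \<in> len_filt d \<Longrightarrow> p + q \<in> len_filt d"
  "p \<in> short S d \<Longrightarrow> p \<in> len_filt d" "p - q \<in> I \<Longrightarrow> q \<in> len_filt d \<Longrightarrow> p \<in> len_filt d"
proof -
  show "0 \<in> len_filt d" unfolding len_filt_def using short_closed(1) I_simps(1)
    by (intro CollectI bexI[of _ 0]) simp_all
  show "p \<in> len_filt d" if "p \<in> short S d" using that I_simps(1) unfolding len_filt_def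
    by (intro CollectI bexI[of _ p]) simp_all
  show "p + q \<in> len_filt d" if pq: "p \<in> len_filt d" "q \<in> len_filt d"
  proof -
    obtain p' q' where "p' \<in> short S d" "p - p' \<in> I" "q' \<in> short S d" "q - q' \<in> I"
      using pq unfolding len_filt_def by blast
    then show ?thesis using I_simps(3)[of "p - p'" "q - q'"] short_closed(2)[of p' S d q']
      unfolding len_filt_def by (intro CollectI bexI[of _ "p' + q'"]) (simp_all add: add_diff_add)
  qed
  show "p \<in> len_filt d" if pq: "p - q \<in> I" "q \<in> len_filt d"
  proof -
    obtain q' where "q' \<in> short S d" "q - q' \<in> I"
      using pq unfolding len_filt_def by blast
    then show ?thesis using I_simps(3)[of "p - q" "q - q'"] pq(1)
      unfolding len_filt_def by (intro CollectI bexI[of _ q']) simp_all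
  qed
qed

lemma len_filt_sum: "(\<And>i. i \<in> A \<Longrightarrow> f i \<in> len_filt d) \<Longrightarrow> sum f A \<in> len_filt d"
  by (induction A rule: infinite_finite_induct) (simp_all add: len_filt_closed)

lemma len_filt_mult_left:
  assumes "p \<in> len_filt d" "w \<in> lists S"
  shows "sgl w c * p \<in> len_filt (length w + d)"
proof -
  obtain q where q: "q \<in> short S d" "p - q \<in> I" using assms(1) unfolding len_filt_def by blast
  have "sgl w c * (p - q) \<in> I" using q(2) assms(2) by (intro I_simps(6)) simp_all
  then show ?thesis using short_mult_left[OF q(1) assms(2)]
    unfolding len_filt_def by (intro CollectI bexI[of _ "sgl w c * q"]) (simp_all add: right_diff_distrib)
qed

text \<open>Modulo \<open>I\<close> the difference is the word with the single letter
  \<open>br x y\<close> in place of the two letters.\<close>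

lemma swap_in_len_filt:
  assumes "x \<in> S" "y \<in> S" "w \<in> lists S"
  shows "sgl (x # y # w) c - sgl (y # x # w) c \<in> len_filt (Suc (Suc (length w)))"
proof (rule len_filt_closed(4))
  have "(sgl [x, y] 1 - sgl [y, x] 1 - sgl [br x y] 1) * sgl w c \<in> I"
    using assms by (intro I_simps(5) I_rels) simp_all
  then show "sgl (x # y # w) c - sgl (y # x # w) c - sgl (br x y # w) c \<in> I"
    by (simp add: left_diff_distrib word_mult)
  show "sgl (br x y # w) c \<in> len_filt (Suc (Suc (length w)))"
    using assms br_closed by (intro len_filt_closed short_closed) simp_all
qed

lemma diff_trans_len_filt: "p - q \<in> len_filt d \<Longrightarrow> q - r \<in> len_filt d \<Longrightarrow> p - r \<in> len_filt d"
  using len_filt_closed(2)[of "p - q" d "q - r"] by simp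

lemma move_in_len_filt:
  assumes "x \<in> S" "u \<in> lists S" "v \<in> lists S"
  shows "sgl (x # u @ v) c - sgl (u @ x # v) c \<in> len_filt (Suc (length (u @ v)))"
  using assms(2)
proof (induction u rule: list.induct)
  case Nil
  show ?case by (simp add: len_filt_closed)
next
  case (Cons y u)
  have "sgl (x # y # u @ v) c - sgl (y # x # u @ v) c \<in> len_filt (Suc (Suc (length (u @ v))))"
    using Cons.prems assms by (intro swap_in_len_filt) auto
  moreover have "sgl [y] 1 * (sgl (x # u @ v) c - sgl (u @ x # v) c) \<in> len_filt (length [y] + Suc (length (u @ v)))"
    using Cons by (intro len_filt_mult_left) auto
  then have "sgl (y # x # u @ v) c - sgl (y # u @ x # v) c \<in> len_filt (Suc (Suc (length (u @ v))))"
    by (simp add: right_diff_distrib word_mult)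
  ultimately show ?case using diff_trans_len_filt by fastforce
qed

text \<open>Letters commute modulo shorter words, so the top-degree part of a word is a commutative
  monomial. The induction moves the first letter of \<open>w\<close> to its place in
  \<open>w'\<close>.\<close>

lemma mset_eq_in_len_filt:
  "w \<in> lists S \<Longrightarrow> mset w = mset w' \<Longrightarrow> sgl w c - sgl w' c \<in> len_filt (length w)"
proof (induction w arbitrary: w')
  case Nil
  then show ?case by (simp add: len_filt_closed)
next
  case (Cons x w)
  have "x \<in> set w'" using Cons.prems(2) by (metis list.set_intros(1) mset_eq_setD)
  then obtain u v where w': "w' = u @ x # v" by (auto simp: in_set_conv_decomp)
  then have m: "mset w = mset (u @ v)" using Cons.prems(2) by simp
  have "set (u @ v) = set w" "length (u @ v) = length w" using m mset_eq_setD size_mset by metis+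
  then have uv: "u \<in> lists S" "v \<in> lists S" "length (u @ v) = length w" using Cons.prems(1) by auto
  have "sgl w c - sgl (u @ v) c \<in> len_filt (length w)" using Cons.IH[of "u @ v"] Cons.prems m by auto
  then have "sgl [x] 1 * (sgl w c - sgl (u @ v) c) \<in> len_filt (length [x] + length w)"
    using Cons.prems by (intro len_filt_mult_left) auto
  then have "sgl (x # w) c - sgl (x # u @ v) c \<in> len_filt (Suc (length w))"
    by (simp add: right_diff_distrib word_mult)
  moreover have "sgl (x # u @ v) c - sgl (u @ x # v) c \<in> len_filt (Suc (length w))"
    using move_in_len_filt[of x u v c] Cons.prems uv by simp
  ultimately show ?case unfolding w' using diff_trans_len_filt by fastforce
qed

text \<open>Replacing each word of length \<open>N\<close> by a chosen word with the same letters
  costs only shorter words. Afterwards the coefficients of equal multisets add up, and these sums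
  are zero.\<close>

lemma coefficient_sums_imp_len_filt:
  assumes "B \<subseteq> S" and p: "p \<in> short B (Suc N)"
    and 0: "\<And>bs. bs \<in> lists B \<Longrightarrow> length bs = N \<Longrightarrow>
      (\<Sum>w | w \<in> Poly_Mapping.keys p \<and> mset w = mset bs. coef p w) = 0"
  shows "p \<in> len_filt N"
proof -
  define K where "K = {w \<in> Poly_Mapping.keys p. length w = N}"
  \<comment> \<open>One arbitrary arrangement for each multiset takes the place of an ordering of
    \<open>B\<close>.\<close>
  define r where "r M = (SOME w. mset w = M)" for M :: "'a multiset"
  have r: "mset (r M) = M" for M unfolding r_def by (rule someI_ex[OF ex_mset])
  have fin: "finite K" unfolding K_def by simp
  have keysB: "Poly_Mapping.keys p \<subseteq> {w \<in> lists B. length w < Suc N}" using p by (simp add: short_def)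
  have "(\<Sum>w\<in>K. sgl (r (mset w)) (coef p w)) =
    (\<Sum>M\<in>mset ` K. \<Sum>w | w \<in> K \<and> mset w = M. sgl (r (mset w)) (coef p w))"
    using fin by (rule sum.image_gen)
  also have "\<dots> = (\<Sum>M\<in>mset ` K. 0)"
  proof (rule sum.cong[OF refl], clarify)
    fix bs assume bs: "bs \<in> K"
    have eq: "{w \<in> K. mset w = mset bs} = {w. w \<in> Poly_Mapping.keys p \<and> mset w = mset bs}"
      using bs unfolding K_def by (auto dest: mset_eq_length)
    have "(\<Sum>w | w \<in> K \<and> mset w = mset bs. sgl (r (mset w)) (coef p w)) =
       sgl (r (mset bs)) (\<Sum>w | w \<in> K \<and> mset w = mset bs. coef p w)"
      by (simp add: additive_map_sum[OF additive_single])
    also have "(\<Sum>w | w \<in> K \<and> mset w = mset bs. coef p w) = 0"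
      unfolding eq using bs keysB by (intro 0) (auto simp: K_def)
    finally show "(\<Sum>w | w \<in> K \<and> mset w = mset bs. sgl (r (mset w)) (coef p w)) = 0" by simp
  qed
  finally have z: "(\<Sum>w\<in>K. sgl (r (mset w)) (coef p w)) = 0" by simp
  have "(\<Sum>w\<in>K. sgl w (coef p w) - sgl (r (mset w)) (coef p w)) \<in> len_filt N"
  proof (rule len_filt_sum)
    fix w assume "w \<in> K"
    then have "w \<in> lists S" "length w = N" using keysB assms(1) unfolding K_def by auto
    then show "sgl w (coef p w) - sgl (r (mset w)) (coef p w) \<in> len_filt N"
      using mset_eq_in_len_filt[of w "r (mset w)"] r by simp
  qed
  then have top: "(\<Sum>w\<in>K. sgl w (coef p w)) \<in> len_filt N" by (simp add: sum_subtractf z)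
  have "(\<Sum>w\<in>Poly_Mapping.keys p - K. sgl w (coef p w)) \<in> len_filt N"
  proof (rule len_filt_sum)
    fix w assume "w \<in> Poly_Mapping.keys p - K"
    then have "w \<in> lists S" "length w < N" using keysB assms(1) unfolding K_def by auto
    then show "sgl w (coef p w) \<in> len_filt N" by (intro len_filt_closed short_closed)
  qed
  moreover have "p = (\<Sum>w\<in>Poly_Mapping.keys p - K. sgl w (coef p w)) + (\<Sum>w\<in>K. sgl w (coef p w))"
  proof -
    have "K \<subseteq> Poly_Mapping.keys p" unfolding K_def by blast
    from sum.subset_diff[OF this finite_keys, of "\<lambda>w. sgl w (coef p w)"] show ?thesis
      by (simp only: pm_sum_singles)
  qed
  ultimately show ?thesis using len_filt_closed(2)[OF _ top] by metis
qed

text \<open>The product of the functionals dual to the letters of \<open>bs\<close> kills all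
  shorter words and all words of length \<open>N\<close> with other letters. Its value at
  \<open>p\<close> is therefore \<open>C\<close> times the sum, and it is 0 because the functional
  lives on the ambient enveloping algebra.\<close>

lemma coefficient_sums_vanish:
  assumes B: "independent B" and p: "p \<in> short B (Suc N)" and pI: "p \<in> uea_ideal sc br UNIV"
    and bs: "bs \<in> lists B" "length bs = N"
  shows "(\<Sum>w | w \<in> Poly_Mapping.keys p \<and> mset w = mset bs. coef p w) = 0"
proof -
  interpret T: lie_sub sc br UNIV by unfold_locales auto
  let ?K = "Poly_Mapping.keys p"
  \<comment> \<open>Dual functionals exist for finite independent sets, so only the letters that
    occur in \<open>bs\<close> and \<open>p\<close> are kept.\<close>
  define B' where "B' = set bs \<union> (\<Union>w\<in>?K. set w)"
  have keysB: "?K \<subseteq> {w \<in> lists B. length w < Suc N}" using p by (simp add: short_def)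
  have "B' \<subseteq> B" using bs keysB unfolding B'_def by auto
  then have "independent B'" using B independent_mono by blast
  moreover have "finite B'" unfolding B'_def by simp
  ultimately have "\<exists>\<alpha>. \<forall>b\<in>B'. uea_fun sc br (\<alpha> b) \<and> \<alpha> b [] = 0 \<and>
      (\<forall>b'\<in>B'. \<alpha> b [b'] = (if b = b' then 1 else 0))"
    by (intro dual_functionals[OF vector_space_axioms sep])
  then obtain \<alpha> where "\<forall>b\<in>B'. uea_fun sc br (\<alpha> b) \<and> \<alpha> b [] = 0 \<and>
      (\<forall>b'\<in>B'. \<alpha> b [b'] = (if b = b' then 1 else 0))" by (rule exE)
  then have \<alpha>: "\<And>b. b \<in> B' \<Longrightarrow> uea_fun sc br (\<alpha> b)" "\<And>b. b \<in> B' \<Longrightarrow> \<alpha> b [] = 0"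
    "\<And>b b'. b \<in> B' \<Longrightarrow> b' \<in> B' \<Longrightarrow> \<alpha> b [b'] = (if b = b' then 1 else 0)"
    by simp_all
  have bs': "bs \<in> lists B'" unfolding B'_def by auto
  from conv_list_dual[of B' \<alpha>, OF \<alpha>(2,3) bs']
  obtain C where C0: "C \<noteq> 0 \<and> (\<forall>w\<in>lists B'. length w = length bs \<longrightarrow>
     conv_list (map \<alpha> bs) w = (if mset w = mset bs then C else 0))" by (rule exE)
  then have C: "C \<noteq> 0" "\<And>w. w \<in> lists B' \<Longrightarrow> length w = length bs \<Longrightarrow>
     conv_list (map \<alpha> bs) w = (if mset w = mset bs then C else 0)" by simp_all
  have val: "conv_list (map \<alpha> bs) w = (if mset w = mset bs then C else 0)" if w: "w \<in> ?K" for w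
  proof (cases "length w = length bs")
    case True
    moreover have "w \<in> lists B'" using w unfolding B'_def by auto
    ultimately show ?thesis by (intro C(2))
  next
    case False
    then have "length w < length bs" "mset w \<noteq> mset bs" using w keysB bs(2) by (auto dest: mset_eq_length)
    moreover have "conv_list (map \<alpha> bs) w = 0"
      using calculation bs' \<alpha>(2) by (intro conv_list_short) auto
    ultimately show ?thesis by simp
  qed
  have "0 = word_ext (conv_list (map \<alpha> bs)) p"
    using bs' \<alpha>(1) pI by (intro T.uea_fun_vanishes[symmetric] uea_fun_conv_list) auto
  also have "\<dots> = (\<Sum>w\<in>?K. if mset w = mset bs then C * coef p w else 0)"
    unfolding word_ext_def pm_ext_def using val by (intro sum.cong) auto
  also have "\<dots> = C * (\<Sum>w | w \<in> ?K \<and> mset w = mset bs. coef p w)"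
    by (simp flip: sum.inter_filter add: sum_distrib_left)
  finally show ?thesis using C(1) by simp
qed

lemma span_letter:
  assumes "B \<subseteq> S" "x \<in> span B"
  shows "x \<in> S \<and> (\<exists>q. Poly_Mapping.keys q \<subseteq> (\<lambda>b. [b]) ` B \<and> sgl [x] 1 - q \<in> I)"
  using assms(2)
proof (induction x rule: span_induct_alt)
  case base
  have "- (sgl [0 + 0] 1 - sgl [0] 1 - sgl [0] 1) \<in> I" using zero_closed by (intro I_simps(2) I_rels)
  then show ?case using zero_closed by (intro conjI exI[of _ 0]) simp_all
next
  case (step c b y)
  then obtain q where q: "y \<in> S" "Poly_Mapping.keys q \<subseteq> (\<lambda>b. [b]) ` B" "sgl [y] 1 - q \<in> I" by blast
  have b: "b \<in> S" "sc c b \<in> S" using step assms(1) sc_closed by auto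
  have "(sgl [sc c b + y] 1 - sgl [sc c b] 1 - sgl [y] 1) + (sgl [sc c b] 1 - sgl [b] c) + (sgl [y] 1 - q) \<in> I"
    using b q by (intro I_simps(3) I_rels) simp_all
  then have "sgl [sc c b + y] 1 - (sgl [b] c + q) \<in> I" by (simp add: algebra_simps)
  moreover have "Poly_Mapping.keys (sgl [b] c + q) \<subseteq> (\<lambda>b. [b]) ` B"
    using keys_add[of "sgl [b] c" q] q(2) step(1) by (auto split: if_splits)
  ultimately show ?case using add_closed b(2) q(1) by blast
qed

lemma basis_words_span:
  assumes B: "B \<subseteq> S" "S \<subseteq> span B" and p: "p \<in> short S d"
  shows "\<exists>q\<in>short B d. p - q \<in> I"
proof -
  have word: "\<exists>q\<in>short B (Suc (length w)). sgl w 1 - q \<in> I" if "w \<in> lists S" for w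
    using that
  proof (induction w rule: list.induct)
    case Nil
    show ?case using I_simps(1) by (intro bexI[of _ 1]) (auto intro!: short_closed simp flip: single_Nil_1)
  next
    case (Cons x w)
    then obtain q where q: "q \<in> short B (Suc (length w))" "sgl w 1 - q \<in> I" by auto
    obtain r where r: "Poly_Mapping.keys r \<subseteq> (\<lambda>b. [b]) ` B" "sgl [x] 1 - r \<in> I"
      using span_letter[OF B(1), of x] B(2) Cons.prems by auto
    have rq: "r * q \<in> short B (Suc (Suc (length w)))" using r(1)
    proof (induction r rule: pm_induct_on)
      case (single k v)
      then show ?case using short_mult_left[OF q(1), of k v] by auto
    qed (auto simp: short_closed distrib_right)
    have qF: "q \<in> carrier F" using q(1) short_subset_F[OF B(1)] by blast
    have x: "sgl [x] 1 \<in> carrier F" using Cons.prems by simp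
    have "(sgl [x] 1 - r) * q \<in> I" using r(2) qF by (rule I_simps(5))
    moreover have "sgl [x] 1 * (sgl w 1 - q) \<in> I" using q(2) x by (rule I_simps(6))
    ultimately have "sgl [x] 1 * (sgl w 1 - q) + (sgl [x] 1 - r) * q \<in> I" using I_simps(3) by blast
    then have "sgl (x # w) 1 - r * q \<in> I" by (simp add: algebra_simps word_mult)
    then show ?case using rq by auto
  qed
  have "Poly_Mapping.keys p \<subseteq> {w \<in> lists S. length w < d}" using p by (simp add: short_def)
  then show ?thesis
  proof (induction p rule: pm_induct_on)
    case zero
    show ?case using short_closed(1) I_simps(1) by (intro bexI[of _ 0]) simp_all
  next
    case (single w c)
    then obtain q where q: "q \<in> short B (Suc (length w))" "sgl w 1 - q \<in> I" using word[of w] by blast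
    have "sgl [] c * (sgl w 1 - q) \<in> I" using q(2) by (intro I_simps(6)) simp_all
    then have "sgl w c - sgl [] c * q \<in> I" by (simp add: right_diff_distrib word_mult)
    moreover have "short B (Suc (length w)) \<subseteq> short B d" using single by (auto simp: short_def)
    then have "sgl [] c * q \<in> short B d" using short_mult_left[OF q(1), of "[]" c] by auto
    ultimately show ?case by blast
  next
    case (add p1 p2)
    then obtain q1 q2 where "q1 \<in> short B d" "p1 - q1 \<in> I" "q2 \<in> short B d" "p2 - q2 \<in> I" by blast
    then show ?case using I_simps(3)[of "p1 - q1" "p2 - q2"] short_closed(2)[of q1 B d q2]
      by (intro bexI[of _ "q1 + q2"]) (simp_all add: add_diff_add)
  qed
qed

text \<open>This is the injectivity of the map from the enveloping algebra of \<open>S\<close> to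
  that of the whole Lie algebra. The induction is on the length bound: once \<open>p\<close> is
  written in words over a basis of \<open>S\<close>, the functionals show that its top-degree part
  vanishes, so modulo \<open>I\<close> it is a combination of shorter words, still in the ambient
  ideal.\<close>

theorem uea_ideal_contracts:
  assumes "p \<in> carrier F" "p \<in> uea_ideal sc br UNIV"
  shows "p \<in> I"
proof -
  interpret T: lie_sub sc br UNIV by unfold_locales auto
  obtain B where B: "B \<subseteq> S" "independent B" "S \<subseteq> span B" using maximal_independent_subset by blast
  have "p \<in> I" if "p \<in> short S d" "p \<in> T.I" for p d
    using that
  proof (induction d arbitrary: p)
    case 0
    then show ?case using I_simps(1) by (simp add: short_def)
  next
    case (Suc N)
    obtain q where q: "q \<in> short B (Suc N)" "p - q \<in> I" using basis_words_span[OF B(1,3) Suc.prems(1)] by blast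
    have "p - (p - q) \<in> T.I" by (rule T.I_simps(4)[OF Suc.prems(2) subsetD[OF I_subset_UNIV q(2)]])
    then have "q \<in> T.I" by simp
    then have "q \<in> len_filt N"
      by (intro coefficient_sums_imp_len_filt[OF B(1) q(1)] coefficient_sums_vanish[OF B(2) q(1)])
    then obtain r where r: "r \<in> short S N" "q - r \<in> I" unfolding len_filt_def by blast
    have "q - (q - r) \<in> T.I" by (rule T.I_simps(4)[OF \<open>q \<in> T.I\<close> subsetD[OF I_subset_UNIV r(2)]])
    then have "r \<in> I" using Suc.IH[OF r(1)] by simp
    then have "(p - q) + ((q - r) + r) \<in> I" by (intro I_simps(3) q(2) r(2))
    then show ?case by simp
  qed
  moreover have "p \<in> short S (Suc (Max (length ` Poly_Mapping.keys p)))"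
    using assms(1) by (auto simp: short_def less_Suc_eq_le)
  ultimately show ?thesis using assms(2) by blast
qed

end

section \<open>Loop and current algebras\<close>

context lie_algebra
begin

lemma additive_bracket: "additive_map (bracket x)" "additive_map (\<lambda>x. bracket x y)"
  by (simp_all add: additive_map_def bracket_add_right bracket_add_left)

lemmas bracket_0 = additive_bracket(1)[THEN additive_map_0] additive_bracket(2)[THEN additive_map_0]
lemmas bracket_uminus = additive_bracket(1)[THEN additive_map_uminus] additive_bracket(2)[THEN additive_map_uminus]

lemma bracket_skew: "bracket x y = - bracket y x"
proof -
  have "bracket x y + bracket y x = 0"
    using bracket_self[of "x + y"] unfolding bracket_add_left bracket_add_right
    by (simp add: bracket_self add.commute)
  then show ?thesis by (simp add: eq_neg_iff_add_eq_0)
qed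

lemma jacobi_ad: "bracket (bracket x y) z = bracket x (bracket y z) - bracket y (bracket x z)"
  using jacobi[of x y z] bracket_skew[of z "bracket x y"] bracket_skew[of z x]
  by (simp add: bracket_uminus algebra_simps)

lemma lookup_pm_scale: "coef (pm_scale scale c p) k = scale c (coef p k)"
  by (simp add: pm_scale_def map.rep_eq when_def)

lemma pm_scale_single: "pm_scale scale c (sgl k a) = sgl k (scale c a)"
  by (rule poly_mapping_eqI) (simp add: lookup_pm_scale lookup_single when_def)

lemma vector_space_pm_scale: "vector_space (pm_scale scale)"
  by unfold_locales
     (rule poly_mapping_eqI, simp add: lookup_pm_scale lookup_add scale_right_distrib scale_left_distrib)+

lemma additive_pm_scale: "additive_map (pm_scale scale c)"
  by (rule additive_mapI, rule poly_mapping_eqI) (simp add: lookup_pm_scale lookup_add scale_right_distrib)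

lemma pm_bracket_ext: "pm_bracket bracket p q = pm_ext (\<lambda>j a. pm_ext (\<lambda>k b. sgl (j + k) (bracket a b)) q) p"
  by (simp add: pm_bracket_def pm_ext_def)

lemma pm_bracket_add:
  fixes p :: "'k::monoid_add \<Rightarrow>\<^sub>0 'g"
  shows
  "pm_bracket bracket p (q + q') = pm_bracket bracket p q + pm_bracket bracket p q'"
  "pm_bracket bracket (p + p') q = pm_bracket bracket p q + pm_bracket bracket p' q"
proof -
  have inner: "additive_map (pm_ext (\<lambda>k b. sgl (j + k) (bracket a b)))" for j :: 'k and a
    by (intro additive_pm_ext additive_mapI) (simp add: bracket_add_right single_add)
  show "pm_bracket bracket p (q + q') = pm_bracket bracket p q + pm_bracket bracket p q'"
    unfolding pm_bracket_ext by (simp add: pm_ext_def[of _ p] sum.distrib additive_map_add[OF inner])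
  have "additive_map (pm_ext (\<lambda>j a. pm_ext (\<lambda>k b. sgl (j + k) (bracket a b)) q))"
    by (intro additive_pm_ext additive_mapI)
       (simp add: pm_ext_def bracket_add_left single_add sum.distrib)
  then show "pm_bracket bracket (p + p') q = pm_bracket bracket p q + pm_bracket bracket p' q"
    unfolding pm_bracket_ext by (rule additive_map_add)
qed

lemma additive_pm_bracket: "additive_map (pm_bracket bracket p)" "additive_map (\<lambda>p. pm_bracket bracket p q)"
  by (simp_all add: additive_map_def pm_bracket_add)

lemma pm_bracket_single: "pm_bracket bracket (sgl j a) (sgl k b) = sgl (j + k) (bracket a b)"
  unfolding pm_bracket_ext by (simp add: pm_ext_single pm_ext_def[of _ 0] bracket_0)

lemma pm_bracket_scale:
  "pm_bracket bracket (pm_scale scale c p) q = pm_scale scale c (pm_bracket bracket p q)"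
  "pm_bracket bracket p (pm_scale scale c q) = pm_scale scale c (pm_bracket bracket p q)"
proof -
  note add = pm_bracket_add additive_map_add[OF additive_pm_scale]
  have "pm_bracket bracket (pm_scale scale c (sgl k a)) q = pm_scale scale c (pm_bracket bracket (sgl k a) q)" for k a
    by (induction q rule: pm_induct) (simp_all add: add pm_scale_single pm_bracket_single bracket_scale_left)
  then show "pm_bracket bracket (pm_scale scale c p) q = pm_scale scale c (pm_bracket bracket p q)"
    by (induction p rule: pm_induct) (simp_all add: add)
  have "pm_bracket bracket (sgl k a) (pm_scale scale c q) = pm_scale scale c (pm_bracket bracket (sgl k a) q)" for k a
    by (induction q rule: pm_induct) (simp_all add: add pm_scale_single pm_bracket_single bracket_scale_right)
  then show "pm_bracket bracket p (pm_scale scale c q) = pm_scale scale c (pm_bracket bracket p q)"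
    by (induction p rule: pm_induct) (simp_all add: add)
qed

lemma pm_jacobi_ad:
  fixes p q r :: "'k::comm_monoid_add \<Rightarrow>\<^sub>0 'g"
  shows "pm_bracket bracket (pm_bracket bracket p q) r =
    pm_bracket bracket p (pm_bracket bracket q r) - pm_bracket bracket q (pm_bracket bracket p r)"
proof -
  have 1: "pm_bracket bracket (pm_bracket bracket (sgl j a) (sgl k b)) r =
    pm_bracket bracket (sgl j a) (pm_bracket bracket (sgl k b) r) - pm_bracket bracket (sgl k b) (pm_bracket bracket (sgl j a) r)"
    for j k :: 'k and a b
    by (induction r rule: pm_induct)
       (simp_all add: pm_bracket_add pm_bracket_single jacobi_ad single_diff ac_simps)
  have 2: "pm_bracket bracket (pm_bracket bracket (sgl j a) q) r =
    pm_bracket bracket (sgl j a) (pm_bracket bracket q r) - pm_bracket bracket q (pm_bracket bracket (sgl j a) r)"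
    for j :: 'k and a
    by (induction q rule: pm_induct) (simp_all add: pm_bracket_add 1)
  show ?thesis
    by (induction p rule: pm_induct) (simp_all add: pm_bracket_add 2)
qed

text \<open>A matrix coefficient of the adjoint representation: a word acts on \<open>v\<close> by
  iterated brackets, and the Jacobi identity turns commutators into brackets.\<close>

lemma pm_foldr_uea_fun:
  assumes "additive_map l" "\<And>c p. l (pm_scale scale c p) = c * l p"
  shows "uea_fun (pm_scale scale) (pm_bracket bracket :: ('k::comm_monoid_add \<Rightarrow>\<^sub>0 'g) \<Rightarrow> _)
    (\<lambda>w. l (foldr (pm_bracket bracket) w v))"
proof -
  let ?f = "\<lambda>u. foldr (pm_bracket bracket) u"
  have add: "additive_map (?f u)" for u :: "('k \<Rightarrow>\<^sub>0 'g) list"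
    by (induction u) (simp_all add: additive_map_def pm_bracket_add)
  have sc: "?f u (pm_scale scale c p) = pm_scale scale c (?f u p)" for u :: "('k \<Rightarrow>\<^sub>0 'g) list" and c p
    by (induction u) (simp_all add: pm_bracket_scale)
  show ?thesis
    unfolding uea_fun_def
    by (simp add: pm_bracket_add pm_bracket_scale pm_jacobi_ad additive_map_add[OF add]
        additive_map_add[OF assms(1)] additive_map_diff[OF add] additive_map_diff[OF assms(1)] sc assms(2))
qed

lemma lookup_pm_bracket_single_0:
  "coef (pm_bracket bracket p (sgl 0 b)) k = bracket (coef p k) b"
  by (induction p rule: pm_induct)
     (simp_all add: pm_bracket_add pm_bracket_single lookup_add bracket_add_left lookup_single when_def bracket_0)

text \<open>Bracketing with a constant \<open>sgl 0 y\<close> acts on each coefficient separately. A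
  nonzero coefficient of \<open>p\<close> fails to commute with some \<open>y\<close>, and a
  coordinate of the resulting bracket supplies the functional.\<close>

lemma current_separated:
  fixes p :: "'k::comm_monoid_add \<Rightarrow>\<^sub>0 'g"
  assumes centreless: "\<And>x. x \<noteq> 0 \<Longrightarrow> \<exists>y. bracket x y \<noteq> 0" and "p \<noteq> 0"
  shows "\<exists>f. uea_fun (pm_scale scale) (pm_bracket bracket) f \<and> f [] = 0 \<and> f [p] \<noteq> 0"
proof -
  obtain k where "coef p k \<noteq> 0" using \<open>p \<noteq> 0\<close> by (metis lookup_zero poly_mapping_eqI)
  then obtain y where y: "bracket (coef p k) y \<noteq> 0" using centreless by blast
  obtain B where B: "independent B" "span B = UNIV"
    using basis_exists[of UNIV] by (metis subspace_UNIV top.extremum_uniqueI)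
  obtain b where b: "representation B (bracket (coef p k) y) b \<noteq> 0"
    using y sum_nonzero_representation_eq[OF B(1), of "bracket (coef p k) y"] B(2)
    by (metis (mono_tags, lifting) UNIV_I empty_Collect_eq sum.empty)
  define l :: "('k \<Rightarrow>\<^sub>0 'g) \<Rightarrow> complex" where "l = (\<lambda>p. representation B (coef p k) b)"
  \<comment> \<open>The multiple of the counit makes the value at the empty word zero and does not
    change the values at nonempty words.\<close>
  let ?f = "\<lambda>w. l (foldr (pm_bracket bracket) w (sgl 0 y)) + (- l (sgl 0 y)) * (if w = [] then 1 else 0)"
  have "uea_fun (pm_scale scale) (pm_bracket bracket) ?f"
  proof (intro uea_fun_add uea_fun_cmult uea_fun_counit pm_foldr_uea_fun)
    show "additive_map l" unfolding additive_map_def l_def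
      by (simp add: lookup_add representation_add[OF B(1)] B(2))
    show "l (pm_scale scale c q) = c * l q" for c q
      unfolding l_def by (simp add: lookup_pm_scale representation_scale[OF B(1)] B(2))
  qed
  moreover have "?f [] = 0" by simp
  moreover have "?f [p] \<noteq> 0" using b by (simp add: l_def lookup_pm_bracket_single_0)
  ultimately show ?thesis by (intro exI[of _ ?f] conjI)
qed

end

section \<open>Operators on the loop algebra\<close>

locale involutive_lie_algebra = lie_algebra scale bracket
  for scale :: "complex \<Rightarrow> 'g::ab_group_add \<Rightarrow> 'g" and bracket :: "'g \<Rightarrow> 'g \<Rightarrow> 'g" +
  fixes om :: "'g \<Rightarrow> 'g"
  assumes om_add: "om (x + y) = om x + om y"
    and om_scale: "om (scale c x) = scale c (om x)"
    and om_bracket: "om (bracket x y) = bracket (om x) (om y)"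
    and om_om: "om (om x) = x"
begin

abbreviation "brk \<equiv> pm_bracket bracket"
abbreviation "msc \<equiv> pm_scale scale"

lemma additive_om: "additive_map om"
  by (simp add: additive_map_def om_add)

lemmas om_0 = additive_map_0[OF additive_om]

text \<open>Multiplication by \<open>t^j\<close>.\<close>

definition shift :: "int \<Rightarrow> (int \<Rightarrow>\<^sub>0 'g) \<Rightarrow> (int \<Rightarrow>\<^sub>0 'g)" where
  "shift j = pm_ext (\<lambda>k a. sgl (k + j) a)"

text \<open>Evaluation at \<open>t = 1\<close>, that is, reduction modulo
  \<open>t - 1\<close>.\<close>

definition ev1 :: "(int \<Rightarrow>\<^sub>0 'g) \<Rightarrow> 'g" where
  "ev1 = pm_ext (\<lambda>k a. a)"

text \<open>Multiplication by \<open>t - 1\<close>.\<close>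

definition dop :: "(int \<Rightarrow>\<^sub>0 'g) \<Rightarrow> (int \<Rightarrow>\<^sub>0 'g)" where
  "dop p = shift 1 p - p"

abbreviation "lom \<equiv> loop_omega om"

lemma additive_shift: "additive_map (shift j)"
  unfolding shift_def by (intro additive_pm_ext additive_single)

lemma shift_single: "shift j (sgl k a) = sgl (k + j) a"
  unfolding shift_def by (simp add: pm_ext_single)

lemma additive_ev1: "additive_map ev1"
  unfolding ev1_def by (intro additive_pm_ext) (simp add: additive_map_def)

lemma ev1_single: "ev1 (sgl k a) = a"
  unfolding ev1_def by (simp add: pm_ext_single)

lemma additive_dop: "additive_map dop"
  by (rule additive_mapI) (simp add: dop_def additive_map_add[OF additive_shift])

lemma additive_lom: "additive_map lom"
proof -
  have "lom = pm_ext (\<lambda>k a. sgl (- k) (om a))" by (rule ext) (simp add: loop_omega_def pm_ext_def)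
  then show ?thesis by (simp only:) (intro additive_pm_ext additive_mapI, simp add: om_add single_add)
qed

lemma lom_single: "lom (sgl k a) = sgl (- k) (om a)"
  by (simp add: loop_omega_def om_0)

lemmas loop_adds = additive_map_add[OF additive_shift] additive_map_add[OF additive_ev1]
  additive_map_add[OF additive_dop] additive_map_add[OF additive_lom] additive_map_add[OF additive_pm_scale]
  pm_bracket_add om_add
lemmas loop_diffs = additive_map_diff[OF additive_shift] additive_map_diff[OF additive_ev1]
  additive_map_diff[OF additive_dop] additive_map_diff[OF additive_lom] additive_map_diff[OF additive_pm_scale]
  additive_map_diff[OF additive_pm_bracket(1)] additive_map_diff[OF additive_pm_bracket(2)]
  additive_map_diff[OF additive_om]
lemmas loop_singles = shift_single ev1_single lom_single pm_scale_single pm_bracket_single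

lemma ev1_simps:
  "ev1 (shift j p) = ev1 p" "ev1 (dop p) = 0" "ev1 (lom p) = om (ev1 p)"
  "ev1 (msc c p) = scale c (ev1 p)" "ev1 (brk p q) = bracket (ev1 p) (ev1 q)"
proof -
  show s: "ev1 (shift j p) = ev1 p" for j
    by (induction p rule: pm_induct) (simp_all add: loop_adds loop_singles)
  show "ev1 (dop p) = 0" by (simp add: dop_def loop_diffs s)
  show "ev1 (lom p) = om (ev1 p)"
    by (induction p rule: pm_induct) (simp_all add: loop_adds loop_singles)
  show "ev1 (msc c p) = scale c (ev1 p)"
    by (induction p rule: pm_induct) (simp_all add: loop_adds loop_singles scale_right_distrib)
  have "ev1 (brk (sgl k a) q) = bracket a (ev1 q)" for k a
    by (induction q rule: pm_induct) (simp_all add: loop_adds loop_singles bracket_add_right)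
  then show "ev1 (brk p q) = bracket (ev1 p) (ev1 q)"
    by (induction p rule: pm_induct) (simp_all add: loop_adds loop_singles bracket_add_left)
qed

lemma shift_brk: "brk (shift j p) q = shift j (brk p q)" "brk p (shift j q) = shift j (brk p q)"
proof -
  have "brk (shift j (sgl k a)) q = shift j (brk (sgl k a) q)" for k a
    by (induction q rule: pm_induct) (simp_all add: loop_adds loop_singles ac_simps)
  then show "brk (shift j p) q = shift j (brk p q)"
    by (induction p rule: pm_induct) (simp_all add: loop_adds)
  have "brk (sgl k a) (shift j q) = shift j (brk (sgl k a) q)" for k a
    by (induction q rule: pm_induct) (simp_all add: loop_adds loop_singles ac_simps)
  then show "brk p (shift j q) = shift j (brk p q)"
    by (induction p rule: pm_induct) (simp_all add: loop_adds)
qed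

lemma dop_brk: "brk (dop p) q = dop (brk p q)" "brk p (dop q) = dop (brk p q)"
  by (simp_all add: dop_def loop_diffs shift_brk)

text \<open>The bracket is bilinear over Laurent polynomials, so powers of \<open>t - 1\<close> can
  be pulled out of both arguments.\<close>

lemma dop_pow_brk: "brk ((dop ^^ i) p) ((dop ^^ j) q) = (dop ^^ (i + j)) (brk p q)"
proof -
  have "brk p ((dop ^^ j) q) = (dop ^^ j) (brk p q)"
    by (induction j) (simp_all add: dop_brk)
  moreover have "brk ((dop ^^ i) p) q' = (dop ^^ i) (brk p q')" for q'
    by (induction i) (simp_all add: dop_brk)
  ultimately show ?thesis by (simp add: funpow_add)
qed

lemma additive_dop_pow: "additive_map (dop ^^ r)"
  by (induction r) (simp_all add: additive_map_def loop_adds)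

lemma shift_shift: "shift i (shift j p) = shift (i + j) p"
  by (induction p rule: pm_induct) (simp_all add: loop_adds loop_singles ac_simps)

lemma shift_0: "shift 0 p = p"
  by (induction p rule: pm_induct) (simp_all add: loop_adds loop_singles)

lemma dop_shift: "dop (shift j p) = shift j (dop p)"
  by (simp add: dop_def loop_diffs shift_shift add.commute)

lemma msc_shift: "msc c (shift j p) = shift j (msc c p)"
  by (induction p rule: pm_induct) (simp_all add: loop_adds loop_singles)

lemma msc_dop_pow: "msc c ((dop ^^ r) p) = (dop ^^ r) (msc c p)"
  by (induction r) (simp_all add: dop_def loop_diffs msc_shift)

lemma lom_msc: "lom (msc c p) = msc c (lom p)"
  by (induction p rule: pm_induct) (simp_all add: loop_adds loop_singles om_scale)

lemma lom_lom: "lom (lom p) = p"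
  by (induction p rule: pm_induct) (simp_all add: loop_adds loop_singles om_om)

lemma lom_brk: "lom (brk p q) = brk (lom p) (lom q)"
proof -
  have "lom (brk (sgl k a) q) = brk (lom (sgl k a)) (lom q)" for k a
    by (induction q rule: pm_induct) (simp_all add: loop_adds loop_singles om_bracket)
  then show ?thesis by (induction p rule: pm_induct) (simp_all add: loop_adds)
qed

lemma lom_shift: "lom (shift j p) = shift (- j) (lom p)"
  by (induction p rule: pm_induct) (simp_all add: loop_adds loop_singles)

lemma msc_1: "msc 1 p = p" "msc c (msc d p) = msc (c * d) p" "msc (-1) p = - p" "msc c (- p) = msc (- c) p"
  by (rule poly_mapping_eqI; simp add: lookup_pm_scale)+

text \<open>Since \<open>t\<^sup>-\<^sup>1 - 1 = - t\<^sup>-\<^sup>1 (t - 1)\<close>.\<close>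

lemma lom_dop_pow: "lom ((dop ^^ r) p) = (dop ^^ r) (msc ((- 1) ^ r) (shift (- int r) (lom p)))"
proof (induction r arbitrary: p)
  case (Suc r)
  have d: "lom (dop p) = dop (msc (- 1) (shift (- 1) (lom p)))"
    by (simp add: dop_def loop_diffs lom_shift msc_1 shift_shift shift_0 additive_map_uminus[OF additive_shift])
  have "lom ((dop ^^ Suc r) p) = (dop ^^ r) (msc ((- 1) ^ r) (shift (- int r) (lom (dop p))))"
    by (simp add: Suc.IH funpow_swap1)
  also have "\<dots> = (dop ^^ Suc r) (msc ((- 1) ^ Suc r) (shift (- int (Suc r)) (lom p)))"
    unfolding d using msc_dop_pow[of _ 1]
    by (simp add: dop_shift[symmetric] msc_shift shift_shift msc_1 funpow_swap1 algebra_simps)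
  finally show ?case .
qed (simp add: msc_1 shift_0)

text \<open>Since \<open>t^(k+1) - t^k = (t - 1) t^k\<close>, every monomial is congruent modulo
  \<open>t - 1\<close> to its coefficient placed in degree 0. The integer induction goes from 0 in
  both directions.\<close>

lemma ev1_eq_imp_dop:
  assumes "ev1 p = ev1 q" shows "\<exists>r. p = q + dop r"
proof -
  have step: "\<exists>r. sgl k a = sgl 0 a + dop r" for k a
  proof (induction k rule: int_induct[where k = 0])
    case base
    show ?case by (intro exI[of _ 0]) (simp add: additive_map_0[OF additive_dop])
  next
    case (step1 k)
    then obtain r where "sgl k a = sgl 0 a + dop r" by blast
    moreover have "sgl (k + 1) a = sgl k a + dop (sgl k a)" by (simp add: dop_def shift_single)
    ultimately have "sgl (k + 1) a = sgl 0 a + dop (r + sgl k a)"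
      by (simp only: additive_map_add[OF additive_dop] add.assoc)
    then show ?case by blast
  next
    case (step2 k)
    then obtain r where "sgl k a = sgl 0 a + dop r" by blast
    then show ?case
      by (intro exI[of _ "r - sgl (k - 1) a"]) (simp add: loop_diffs dop_def[of "sgl (k - 1) a"] shift_single)
  qed
  have "\<exists>r. p = sgl 0 (ev1 p) + dop r" for p
  proof (induction p rule: pm_induct)
    case (single k a)
    show ?case using step by (simp add: ev1_single)
  next
    case (add p q)
    then obtain r s where "p = sgl 0 (ev1 p) + dop r" "q = sgl 0 (ev1 q) + dop s" by blast
    then have "p + q = sgl 0 (ev1 (p + q)) + dop (r + s)"
      by (simp add: loop_adds single_add) (metis (no_types, lifting) add.assoc add.left_commute)
    then show ?case by blast
  qed
  then obtain r s where "p = sgl 0 (ev1 p) + dop r" "q = sgl 0 (ev1 q) + dop s" by meson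
  then have "p = q + dop (r - s)" using assms by (simp add: loop_diffs) (metis add_diff_cancel_left' diff_add_cancel add.assoc add_diff_eq)
  then show ?thesis by blast
qed

lemma loop_elem_eq: "loop_elem scale g r k = (dop ^^ r) (sgl k g)"
proof -
  \<comment> \<open>The map \<open>T\<close> tensors a complex Laurent polynomial with
    \<open>g\<close>; it carries multiplication by \<open>t\<close> to
    \<open>shift 1\<close>.\<close>
  define T :: "(int \<Rightarrow>\<^sub>0 complex) \<Rightarrow> (int \<Rightarrow>\<^sub>0 'g)" where "T = Poly_Mapping.map (\<lambda>c. scale c g)"
  have lT: "coef (T p) j = scale (coef p j) g" for p j
    by (simp add: T_def map.rep_eq when_def)
  have T: "T (p + q) = T p + T q" "T (p - q) = T p - T q" for p q
    by (rule poly_mapping_eqI; simp add: lT lookup_add lookup_minus scale_left_distrib scale_left_diff_distrib)+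
  have Ts: "T (sgl j c) = sgl j (scale c g)" for j c
    by (rule poly_mapping_eqI) (simp add: lT lookup_single when_def)
  have sh: "T (sgl 1 1 * p) = shift 1 (T p)" for p
    by (induction p rule: pm_induct) (simp_all add: T Ts mult_single distrib_left loop_adds loop_singles add.commute)
  have "T ((sgl 1 1 - 1) ^ r * p) = (dop ^^ r) (T p)" for p
    by (induction r) (simp_all add: dop_def T sh left_diff_distrib mult.assoc)
  then show ?thesis by (simp add: loop_elem_def T_def[symmetric] Ts)
qed

section \<open>The filtration by powers of \<open>t - 1\<close>\<close>

definition lev :: "nat \<Rightarrow> (int \<Rightarrow>\<^sub>0 'g) set" where
  "lev r = range (dop ^^ r)"

definition fixlev :: "nat \<Rightarrow> (int \<Rightarrow>\<^sub>0 'g) set" where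
  "fixlev r = lev r \<inter> loop_fixed om"

lemma lev_0: "lev 0 = UNIV"
  by (simp add: lev_def)

text \<open>Modulo the next level, an element \<open>(t - 1)^r p\<close> is determined by the value
  of \<open>p\<close> at \<open>t = 1\<close>. All comparisons of leading terms below rest on
  this.\<close>

lemma dop_pow_diff_in_lev:
  assumes "ev1 p = ev1 q" shows "(dop ^^ r) p - (dop ^^ r) q \<in> lev (Suc r)"
proof -
  obtain s where "p = q + dop s" using ev1_eq_imp_dop[OF assms] by blast
  then have "(dop ^^ r) p - (dop ^^ r) q = (dop ^^ Suc r) s"
    by (simp add: additive_map_add[OF additive_dop_pow] funpow_swap1)
  then show ?thesis unfolding lev_def by blast
qed

lemma loop_fixed_closed:
  "0 \<in> loop_fixed om" "x \<in> loop_fixed om \<Longrightarrow> y \<in> loop_fixed om \<Longrightarrow> x + y \<in> loop_fixed om"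
  "x \<in> loop_fixed om \<Longrightarrow> y \<in> loop_fixed om \<Longrightarrow> x - y \<in> loop_fixed om"
  "x \<in> loop_fixed om \<Longrightarrow> msc c x \<in> loop_fixed om"
  "x \<in> loop_fixed om \<Longrightarrow> y \<in> loop_fixed om \<Longrightarrow> brk x y \<in> loop_fixed om"
  by (simp_all add: loop_fixed_def loop_adds loop_diffs lom_msc lom_brk additive_map_0[OF additive_lom])

lemma fixlev_0: "fixlev 0 = loop_fixed om"
  by (simp add: fixlev_def lev_0)

text \<open>The lift \<open>g u\<^sup>r \<mapsto> g (t - 1)\<^sup>r (1 + t\<^sup>-\<^sup>r) / 2\<close> of degree \<open>r\<close> components.\<close>

definition lift_pre :: "nat \<Rightarrow> 'g \<Rightarrow> (int \<Rightarrow>\<^sub>0 'g)" where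
  "lift_pre r a = sgl 0 (scale (1/2) a) + sgl (- int r) (scale (1/2) a)"

definition lift :: "nat \<Rightarrow> (nat \<Rightarrow>\<^sub>0 'g) \<Rightarrow> (int \<Rightarrow>\<^sub>0 'g)" where
  "lift r x = (dop ^^ r) (lift_pre r (coef x r))"

lemma half: "scale (1/2) a + scale (1/2) a = a"
  by (simp flip: scale_left_distrib)

lemma ev1_lift_pre: "ev1 (lift_pre r a) = a"
  by (simp add: lift_pre_def loop_adds ev1_single half)

lemma additive_lift: "additive_map (lift r)"
  unfolding lift_def lift_pre_def
  by (intro additive_mapI)
     (simp add: lookup_add scale_right_distrib single_add flip: additive_map_add[OF additive_dop_pow], simp add: ac_simps)

lemma lift_msc: "lift r (msc c x) = msc c (lift r x)"
  by (simp add: lift_def msc_dop_pow lift_pre_def loop_adds loop_singles lookup_pm_scale scale_left_commute)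

lemma lift_in_lev: "lift r x \<in> lev r"
  by (simp add: lift_def lev_def)

lemma lift_single_other: "r \<noteq> s \<Longrightarrow> lift r (sgl s a) = 0"
  by (simp add: lift_def lookup_single lift_pre_def additive_map_0[OF additive_dop_pow])

lemma lift_single_same: "lift r (sgl r a) = (dop ^^ r) (lift_pre r a)"
  by (simp add: lift_def)

lemma current_omega_lookup: "coef (current_omega scale om p) r = scale ((- 1) ^ r) (om (coef p r))"
proof -
  have "current_omega scale om p = pm_ext (\<lambda>r a. sgl r (scale ((- 1) ^ r) (om a))) p"
    by (simp add: current_omega_def pm_ext_def)
  moreover have "additive_map (pm_ext (\<lambda>r a. sgl r (scale ((- 1) ^ r) (om a))))"
    by (intro additive_pm_ext additive_mapI) (simp add: om_add scale_right_distrib single_add)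
  then have "coef (pm_ext (\<lambda>r a. sgl r (scale ((- 1) ^ r) (om a))) p) r = scale ((- 1) ^ r) (om (coef p r))"
    by (induction p rule: pm_induct)
       (auto simp: additive_map_add lookup_add pm_ext_single om_0 om_add scale_right_distrib lookup_single when_def)
  ultimately show ?thesis by simp
qed

lemma current_fixed_iff: "p \<in> current_fixed scale om \<longleftrightarrow> (\<forall>r. scale ((- 1) ^ r) (om (coef p r)) = coef p r)"
  by (simp add: current_fixed_def poly_mapping_eq_iff fun_eq_iff current_omega_lookup)

lemma single_in_current_fixed:
  "scale ((- 1) ^ r) (om a) = a \<Longrightarrow> sgl r a \<in> current_fixed scale om"
  by (auto simp: current_fixed_iff lookup_single when_def om_0)

text \<open>The sign condition cancels the sign produced by \<open>lom_dop_pow\<close>, and the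
  twist by \<open>t^-r\<close> exchanges the two summands of \<open>lift_pre\<close>.\<close>

lemma lift_pre_fixed:
  assumes "scale ((- 1) ^ r) (om a) = a"
  shows "(dop ^^ r) (lift_pre r a) \<in> loop_fixed om"
proof -
  have "msc ((- 1) ^ r) (shift (- int r) (lom (lift_pre r a))) = lift_pre r a"
    by (simp add: lift_pre_def loop_adds loop_singles om_scale scale_left_commute[of "(-1)^r"] assms add.commute
        del: scale_scale)
  then show ?thesis by (simp add: loop_fixed_def lom_dop_pow)
qed

lemma lift_in_fixlev: "x \<in> current_fixed scale om \<Longrightarrow> lift r x \<in> fixlev r"
  unfolding fixlev_def using lift_in_lev
  by (simp add: lift_def lift_pre_fixed current_fixed_iff)

text \<open>A fixed element divisible by \<open>(t - 1)^r\<close> has an admissible leading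
  coefficient, whose lift is again fixed. Subtracting the lift therefore stays within the fixed
  subalgebra.\<close>

lemma fixlev_leading:
  assumes "y \<in> fixlev r"
  shows "\<exists>a. scale ((- 1) ^ r) (om a) = a \<and> y - lift r (sgl r a) \<in> fixlev (Suc r)"
proof -
  obtain q where q: "y = (dop ^^ r) q" using assms by (auto simp: fixlev_def lev_def)
  have fx: "lom y = y" using assms by (simp add: fixlev_def loop_fixed_def)
  \<comment> \<open>The quotient \<open>q\<close> is replaced by its average under the twisted
    involution. As \<open>y\<close> is fixed, the product with \<open>(t - 1)^r\<close> is still
    \<open>y\<close>, and the sign condition for the value at \<open>t = 1\<close> can be read off
    without cancelling powers of \<open>t - 1\<close>.\<close>
  define q' where "q' = msc (1/2) (q + msc ((- 1) ^ r) (shift (- int r) (lom q)))"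
  define a where "a = ev1 q'"
  have "(dop ^^ r) q' = msc (1/2) (y + lom y)"
    unfolding q'_def q lom_dop_pow by (simp add: msc_dop_pow[symmetric] additive_map_add[OF additive_dop_pow])
  also have "\<dots> = y" unfolding fx by (rule poly_mapping_eqI) (simp add: lookup_pm_scale lookup_add scale_right_distrib half)
  finally have y: "y = (dop ^^ r) q'" by simp
  have a: "scale ((- 1) ^ r) (om a) = a"
    by (simp add: a_def q'_def ev1_simps loop_adds om_scale om_om scale_right_distrib scale_left_commute
        flip: power_mult_distrib)
  have "y - lift r (sgl r a) \<in> lev (Suc r)"
    unfolding y lift_single_same by (rule dop_pow_diff_in_lev) (simp add: ev1_lift_pre a_def)
  moreover have "y - lift r (sgl r a) \<in> loop_fixed om"
    using assms lift_in_fixlev[OF single_in_current_fixed[OF a], of r]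
    by (intro loop_fixed_closed) (simp_all add: fixlev_def)
  ultimately show ?thesis using a by (auto simp: fixlev_def)
qed

lemma lookup_brk_nat: "coef (brk p q) b = (\<Sum>i\<le>b. bracket (coef p i) (coef q (b - i)))"
  for p q :: "nat \<Rightarrow>\<^sub>0 'g"
proof -
  have 1: "coef (brk (sgl k a) (sgl l c)) b = (\<Sum>i\<le>b. bracket (coef (sgl k a) i) (coef (sgl l c) (b - i)))" for k l a c
  proof -
    have "(\<Sum>i\<le>b. bracket (coef (sgl k a) i) (coef (sgl l c) (b - i))) =
       (\<Sum>i\<le>b. if i = k then bracket a (coef (sgl l c) (b - k)) else 0)"
      by (intro sum.cong) (auto simp: lookup_single when_def bracket_0)
    then show ?thesis by (auto simp: loop_singles lookup_single when_def bracket_0)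
  qed
  have "coef (brk (sgl k a) q) b = (\<Sum>i\<le>b. bracket (coef (sgl k a) i) (coef q (b - i)))" for k a
    by (induction q rule: pm_induct) (simp_all add: 1 pm_bracket_add lookup_add bracket_add_right sum.distrib)
  then show ?thesis
    by (induction p rule: pm_induct) (simp_all add: pm_bracket_add lookup_add bracket_add_left sum.distrib)
qed

text \<open>Both terms are \<open>(t - 1)^(i + j)\<close> times elements with the same value at
  \<open>t = 1\<close>, and both are fixed. This is the sense in which \<open>lift\<close> respects
  brackets.\<close>

lemma lift_brk:
  assumes "x \<in> current_fixed scale om" "y \<in> current_fixed scale om"
  shows "brk (lift i x) (lift j y) - lift (i + j) (sgl (i + j) (bracket (coef x i) (coef y j))) \<in> fixlev (Suc (i + j))"
proof -
  have "brk (lift i x) (lift j y) - lift (i + j) (sgl (i + j) (bracket (coef x i) (coef y j))) \<in> lev (Suc (i + j))"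
    unfolding lift_single_same unfolding lift_def dop_pow_brk
    by (rule dop_pow_diff_in_lev) (simp add: ev1_simps ev1_lift_pre)
  moreover have "scale ((- 1) ^ (i + j)) (om (bracket (coef x i) (coef y j))) = bracket (coef x i) (coef y j)"
  proof -
    have "bracket (scale ((- 1) ^ i) (om (coef x i))) (scale ((- 1) ^ j) (om (coef y j))) = bracket (coef x i) (coef y j)"
      using assms by (simp add: current_fixed_iff)
    then show ?thesis by (simp add: bracket_scale_left bracket_scale_right om_bracket power_add mult.commute)
  qed
  then have "lift (i + j) (sgl (i + j) (bracket (coef x i) (coef y j))) \<in> loop_fixed om"
    using lift_in_fixlev[OF single_in_current_fixed] unfolding fixlev_def by blast
  moreover have "brk (lift i x) (lift j y) \<in> loop_fixed om"
    using assms lift_in_fixlev unfolding fixlev_def by (intro loop_fixed_closed) blast+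
  ultimately show ?thesis unfolding fixlev_def using loop_fixed_closed(3) by blast
qed

lemma lift_brk_sum:
  "lift b (brk x y) = (\<Sum>i\<le>b. lift b (sgl b (bracket (coef x i) (coef y (b - i)))))"
proof -
  have "lift b (brk x y) = lift b (sgl b (\<Sum>i\<le>b. bracket (coef x i) (coef y (b - i))))"
    by (simp add: lift_def lookup_brk_nat)
  then show ?thesis by (simp add: additive_map_sum[OF additive_single] additive_map_sum[OF additive_lift])
qed

lemma current_fixed_lie_sub: "lie_sub msc brk (current_fixed scale om)"
proof
  show "0 \<in> current_fixed scale om" by (simp add: current_fixed_iff om_0)
  show "x + y \<in> current_fixed scale om" if "x \<in> current_fixed scale om" "y \<in> current_fixed scale om" for x y
    using that by (simp add: current_fixed_iff lookup_add om_add scale_right_distrib)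
  show "msc c x \<in> current_fixed scale om" if "x \<in> current_fixed scale om" for x c
    using that by (simp add: current_fixed_iff lookup_pm_scale om_scale scale_left_commute del: scale_scale)
  show "brk x y \<in> current_fixed scale om" if "x \<in> current_fixed scale om" "y \<in> current_fixed scale om" for x y
  proof -
    have "scale ((- 1) ^ r) (om (bracket (coef x i) (coef y (r - i)))) = bracket (coef x i) (coef y (r - i))" if "i \<le> r" for i r
    proof -
      have "bracket (scale ((- 1) ^ i) (om (coef x i))) (scale ((- 1) ^ (r - i)) (om (coef y (r - i)))) = bracket (coef x i) (coef y (r - i))"
        using \<open>x \<in> _\<close> \<open>y \<in> _\<close> by (simp add: current_fixed_iff)
      then show ?thesis using that
        by (simp add: bracket_scale_left bracket_scale_right om_bracket mult.commute flip: power_add)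
    qed
    then show ?thesis unfolding current_fixed_iff lookup_brk_nat
      by (simp add: additive_map_sum[OF additive_om] scale_sum_right)
  qed
qed

lemma loop_fixed_lie_sub: "lie_sub msc brk (loop_fixed om)"
  by unfold_locales (simp_all add: loop_fixed_closed)

section \<open>The distinguished elements\<close>

text \<open>The binomial theorem for complex Laurent polynomials, multiplied by \<open>a\<close>. It
  recognizes the alternating sums of \<open>theta_rl\<close> and \<open>beta_rk\<close> as multiples
  of \<open>(t - 1)^r\<close>.\<close>

lemma binomial_dop_pow:
  "(\<Sum>s = 0..r. msc ((- 1) ^ (r - s) * of_nat (r choose s)) (sgl (int s + l) a)) = (dop ^^ r) (sgl l a)"
proof -
  define T :: "(int \<Rightarrow>\<^sub>0 complex) \<Rightarrow> (int \<Rightarrow>\<^sub>0 'g)" where "T = Poly_Mapping.map (\<lambda>c. scale c a)"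
  have lT: "coef (T p) j = scale (coef p j) a" for p j
    by (simp add: T_def map.rep_eq when_def)
  have aT: "additive_map T"
    by (rule additive_mapI, rule poly_mapping_eqI) (simp add: lT lookup_add scale_left_distrib)
  have Ts: "T (sgl j c) = sgl j (scale c a)" for j c
    by (rule poly_mapping_eqI) (simp add: lT lookup_single when_def)
  have pow: "sgl j c ^ s = sgl (int s * j) (c ^ s)" for j and c :: complex and s
    by (induction s) (simp_all add: mult_single algebra_simps)
  have "(sgl 1 1 - 1) ^ r * sgl l 1 = (\<Sum>s\<le>r. sgl (int s + l) ((- 1) ^ (r - s) * of_nat (r choose s) :: complex))"
  proof -
    have "(sgl 1 1 - 1 :: int \<Rightarrow>\<^sub>0 complex) = sgl 1 1 + sgl 0 (- 1)" by (simp add: single_uminus)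
    then have "(sgl 1 1 - 1 :: int \<Rightarrow>\<^sub>0 complex) ^ r = (\<Sum>s\<le>r. of_nat (r choose s) * sgl 1 1 ^ s * sgl 0 (- 1) ^ (r - s))"
      by (simp only: binomial_ring)
    also have "\<dots> = (\<Sum>s\<le>r. sgl (int s) ((- 1) ^ (r - s) * of_nat (r choose s)))"
      by (intro sum.cong refl) (simp only: pow single_of_nat[symmetric] mult_single, simp add: mult.commute)
    finally show ?thesis by (simp add: sum_distrib_right mult_single)
  qed
  then have "loop_elem scale a r l = (\<Sum>s\<le>r. T (sgl (int s + l) ((- 1) ^ (r - s) * of_nat (r choose s))))"
    by (simp add: loop_elem_def T_def[symmetric] additive_map_sum[OF aT])
  then show ?thesis
    by (simp add: loop_elem_eq Ts pm_scale_single atMost_atLeast0)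
qed

text \<open>The element \<open>y\<close> is the sum of \<open>a (t - 1)^r t^l\<close> and its image
  under the involution, so its leading coefficient is \<open>a\<close> plus \<open>(-1)^r\<close>
  times \<open>om a\<close>. With \<open>a = h i\<close> and \<open>r\<close> odd this gives the
  leading term of \<open>theta_rl\<close>, and with \<open>a = - e i\<close> that of
  \<open>beta_rk\<close>.\<close>

lemma symmetrized_leading:
  fixes r :: nat and a :: 'g and l :: int
  defines "y \<equiv> (\<Sum>s = 0..r. msc ((- 1) ^ (r - s) * of_nat (r choose s)) (sgl (int s + l) a + lom (sgl (int s + l) a)))"
    and "b \<equiv> a + scale ((- 1) ^ r) (om a)"
  shows "scale ((- 1) ^ r) (om b) = b" "y \<in> fixlev r" "y - lift r (sgl r b) \<in> fixlev (Suc r)"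
proof -
  show b: "scale ((- 1) ^ r) (om b) = b"
    by (simp add: b_def om_add om_scale om_om scale_right_distrib add.commute flip: power_mult_distrib)
  have y: "y = (dop ^^ r) (sgl l a) + lom ((dop ^^ r) (sgl l a))"
    unfolding binomial_dop_pow[symmetric] y_def
    by (simp only: additive_map_sum[OF additive_lom] loop_adds(5) lom_msc sum.distrib)
  then have fx: "y \<in> loop_fixed om" by (simp add: loop_fixed_def loop_adds lom_lom add.commute)
  define q where "q = sgl l a + msc ((- 1) ^ r) (shift (- int r) (lom (sgl l a)))"
  have yq: "y = (dop ^^ r) q" unfolding y lom_dop_pow q_def by (simp only: additive_map_add[OF additive_dop_pow])
  then show "y \<in> fixlev r" using fx by (auto simp: fixlev_def lev_def)
  have "y - lift r (sgl r b) \<in> lev (Suc r)"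
    unfolding yq lift_single_same
    by (rule dop_pow_diff_in_lev) (simp add: ev1_lift_pre q_def b_def loop_adds ev1_single ev1_simps)
  moreover have "y - lift r (sgl r b) \<in> loop_fixed om"
    using fx lift_in_fixlev[OF single_in_current_fixed[OF b]] by (intro loop_fixed_closed) (simp_all add: fixlev_def)
  ultimately show "y - lift r (sgl r b) \<in> fixlev (Suc r)" by (simp add: fixlev_def)
qed

end

section \<open>Associated graded algebras\<close>

lemma (in ring) minus_eqI: "z \<in> carrier R \<Longrightarrow> y \<in> carrier R \<Longrightarrow> z \<oplus> y = x \<Longrightarrow> x \<ominus> y = z"
  by (auto simp: minus_eq a_assoc r_neg)

locale filtered_algebra = ring A for A :: "(complex, 'a, 'x) module_scheme" (structure) +
  fixes K :: "nat \<Rightarrow> 'a set"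
  assumes K_ideal: "ideal (K n) A" and K_Suc: "K (Suc n) \<subseteq> K n"
    and K_mult: "x \<in> K i \<Longrightarrow> y \<in> K j \<Longrightarrow> x \<otimes> y \<in> K (i + j)"
    and smult_carrier: "x \<in> carrier A \<Longrightarrow> c \<odot>\<^bsub>A\<^esub> x \<in> carrier A"
    and smult_add: "x \<in> carrier A \<Longrightarrow> y \<in> carrier A \<Longrightarrow> c \<odot>\<^bsub>A\<^esub> (x \<oplus> y) = c \<odot>\<^bsub>A\<^esub> x \<oplus> c \<odot>\<^bsub>A\<^esub> y"
    and smult_K: "x \<in> K n \<Longrightarrow> c \<odot>\<^bsub>A\<^esub> x \<in> K n"
begin

text \<open>Elements of \<open>Gr A K\<close> given by one representative in each degree. Membership
  and finiteness conditions are kept separate, so that operations can be computed on representatives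
  first.\<close>

definition gr_seq :: "(nat \<Rightarrow> 'a) \<Rightarrow> nat \<Rightarrow> 'a set" where
  "gr_seq x = (\<lambda>n. K (Suc n) +> x n)"

lemma K_carrier: "x \<in> K n \<Longrightarrow> x \<in> carrier A"
  using ideal.Icarr[OF K_ideal] by blast

lemma K_abelian_subgroup: "abelian_subgroup (K n) A"
  by (rule abelian_subgroupI3[OF ideal.axioms(1)[OF K_ideal] is_abelian_group])

lemma K_coset_eq_iff:
  "x \<in> carrier A \<Longrightarrow> y \<in> carrier A \<Longrightarrow> K n +> x = K n +> y \<longleftrightarrow> x \<ominus> y \<in> K n"
  using quotient_eq_iff_same_a_r_cos[OF K_ideal] by blast

text \<open>Products, scalar multiples and \<open>gr_incl\<close> are unions over cosets; they are
  evaluated at a representative on which the family does not depend.\<close>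

lemma K_coset_Union:
  assumes "x \<in> carrier A" "\<And>k. k \<in> K n \<Longrightarrow> G (k \<oplus> x) = G x"
  shows "(\<Union>y\<in>K n +> x. G y) = G x"
proof -
  have "x \<in> K n +> x" using abelian_subgroup.a_rcos_self[OF K_abelian_subgroup assms(1)] .
  moreover have "G y = G x" if "y \<in> K n +> x" for y
    using that assms(2) by (auto simp: a_r_coset_def r_coset_def)
  ultimately show ?thesis by fast
qed

lemma K_coset_absorb:
  assumes "k \<in> K n" "x \<in> carrier A" shows "K n +> (k \<oplus> x) = K n +> x"
  by (subst K_coset_eq_iff)
     (use assms K_carrier in \<open>simp_all add: minus_eq a_assoc r_neg\<close>)

lemma gr_seq_add:
  assumes "\<And>n. x n \<in> carrier A" "\<And>n. y n \<in> carrier A"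
  shows "gr_seq x \<oplus>\<^bsub>Gr A K\<^esub> gr_seq y = gr_seq (\<lambda>n. x n \<oplus> y n)"
  using abelian_subgroup.a_rcos_sum[OF K_abelian_subgroup] assms by (simp add: Gr_def gr_seq_def)

lemma gr_seq_smult:
  assumes x: "\<And>n. x n \<in> carrier A"
  shows "c \<odot>\<^bsub>Gr A K\<^esub> gr_seq x = gr_seq (\<lambda>n. c \<odot>\<^bsub>A\<^esub> x n)"
proof -
  have "(\<Union>y\<in>K (Suc n) +> x n. K (Suc n) +> (c \<odot>\<^bsub>A\<^esub> y)) = K (Suc n) +> (c \<odot>\<^bsub>A\<^esub> x n)" for n
  proof (rule K_coset_Union[OF x])
    fix k assume "k \<in> K (Suc n)"
    then show "K (Suc n) +> (c \<odot>\<^bsub>A\<^esub> (k \<oplus> x n)) = K (Suc n) +> (c \<odot>\<^bsub>A\<^esub> x n)"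
      using x K_carrier by (simp add: smult_add smult_K smult_carrier K_coset_absorb)
  qed
  then show ?thesis by (simp add: Gr_def gr_seq_def)
qed

lemma gr_class_eq: "x \<in> K r \<Longrightarrow> gr_class A K r x = gr_seq (\<lambda>n. if n = r then x else \<zero>)"
proof -
  have "K n +> \<zero> = K n" for n
    using K_coset_eq_iff abelian_subgroup.a_rcos_const[OF K_abelian_subgroup]
      additive_subgroup.zero_closed[OF ideal.axioms(1)[OF K_ideal]] by blast
  then show ?thesis by (auto simp: gr_class_def gr_seq_def fun_eq_iff)
qed

text \<open>The two factors are cosets of different ideals and the product is formed modulo a third.
  Changing the representatives alters the product only by elements of
  \<open>K (Suc (i + j))\<close>, because the filtration is multiplicative.\<close>

lemma coset_mult:
  assumes "x \<in> K i" "y \<in> K j"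
  shows "[mod K (Suc (i + j)):] (K (Suc i) +> x) \<Otimes>\<^bsub>A\<^esub> (K (Suc j) +> y) = K (Suc (i + j)) +> (x \<otimes> y)"
proof -
  have c: "x \<in> carrier A" "y \<in> carrier A" using assms K_carrier by auto
  have in2: "k \<otimes> y' \<in> K (Suc (i + j))" if "k \<in> K (Suc i)" "y' \<in> K j" for k y'
    using K_mult[OF that] by simp
  have in1: "x \<otimes> k \<in> K (Suc (i + j))" if "k \<in> K (Suc j)" for k
    using K_mult[OF assms(1) that] by simp
  have inner: "(\<Union>b\<in>K (Suc j) +> y. K (Suc (i + j)) +> (k \<oplus> x) \<otimes> b) = K (Suc (i + j)) +> (k \<oplus> x) \<otimes> y"
    if k: "k \<in> K (Suc i)" for k
  proof (rule K_coset_Union[OF c(2)])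
    fix l assume l: "l \<in> K (Suc j)"
    have kx: "k \<oplus> x \<in> K i"
      using k K_Suc assms(1) additive_subgroup.a_closed[OF ideal.axioms(1)[OF K_ideal]] by blast
    have "(k \<oplus> x) \<otimes> l \<in> K (Suc (i + j))" using K_mult[OF kx l] by simp
    moreover have "(k \<oplus> x) \<otimes> (l \<oplus> y) = (k \<oplus> x) \<otimes> l \<oplus> (k \<oplus> x) \<otimes> y"
      using k l c K_carrier by (simp add: r_distr)
    ultimately show "K (Suc (i + j)) +> (k \<oplus> x) \<otimes> (l \<oplus> y) = K (Suc (i + j)) +> (k \<oplus> x) \<otimes> y"
      using k c K_carrier by (simp add: K_coset_absorb)
  qed
  have z: "\<zero> \<in> K (Suc i)" using additive_subgroup.zero_closed[OF ideal.axioms(1)[OF K_ideal]] .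
  show ?thesis unfolding rcoset_mult_def
  proof (subst K_coset_Union[OF c(1)])
    fix k assume k: "k \<in> K (Suc i)"
    have "(k \<oplus> x) \<otimes> y = k \<otimes> y \<oplus> x \<otimes> y" using k c K_carrier by (simp add: l_distr)
    then show "(\<Union>b\<in>K (Suc j) +> y. K (Suc (i + j)) +> (k \<oplus> x) \<otimes> b) = (\<Union>b\<in>K (Suc j) +> y. K (Suc (i + j)) +> x \<otimes> b)"
      using inner[OF k] inner[OF z] in2[OF k assms(2)] c by (simp add: K_coset_absorb)
  next
    show "(\<Union>b\<in>K (Suc j) +> y. K (Suc (i + j)) +> x \<otimes> b) = K (Suc (i + j)) +> x \<otimes> y"
      using inner[OF z] c by simp
  qed
qed

lemma finsum_coset:
  assumes "finite B" "\<And>i. i \<in> B \<Longrightarrow> g i \<in> carrier A"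
  shows "finsum (A Quot K n) (\<lambda>i. K n +> g i) B = K n +> finsum A g B"
  using assms
proof (induction B rule: finite_induct)
  interpret Q: ring "A Quot K n" by (rule ideal.quotient_is_ring[OF K_ideal])
  case empty
  have "K n +> \<zero> = K n"
    by (rule abelian_subgroup.a_rcos_const[OF K_abelian_subgroup additive_subgroup.zero_closed[OF ideal.axioms(1)[OF K_ideal]]])
  moreover have "\<zero>\<^bsub>A Quot K n\<^esub> = K n" by (simp add: FactRing_def)
  ultimately show ?case by (simp only: Q.finsum_empty finsum_empty)
next
  case (insert i B)
  interpret Q: ring "A Quot K n" by (rule ideal.quotient_is_ring[OF K_ideal])
  have Qc: "K n +> g j \<in> carrier (A Quot K n)" if "j \<in> insert i B" for j
    using insert.prems[OF that] by (auto simp: FactRing_def A_RCOSETS_def')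
  have "finsum (A Quot K n) (\<lambda>i. K n +> g i) (insert i B) =
     (K n +> g i) \<oplus>\<^bsub>A Quot K n\<^esub> finsum (A Quot K n) (\<lambda>i. K n +> g i) B"
    using insert.hyps Qc by (intro Q.finsum_insert) auto
  also have "\<dots> = (K n +> g i) <+> (K n +> finsum A g B)"
    using insert by (simp add: FactRing_def)
  also have "\<dots> = K n +> (g i \<oplus> finsum A g B)"
    using insert.prems by (intro abelian_subgroup.a_rcos_sum[OF K_abelian_subgroup] finsum_closed) auto
  also have "g i \<oplus> finsum A g B = finsum A g (insert i B)"
    using insert by (intro finsum_insert[symmetric]) auto
  finally show ?case .
qed

lemma gr_seq_mult:
  assumes x: "\<And>n. x n \<in> K n" and y: "\<And>n. y n \<in> K n"
  shows "gr_seq x \<otimes>\<^bsub>Gr A K\<^esub> gr_seq y = gr_seq (\<lambda>n. \<Oplus>i\<in>{..n}. x i \<otimes> y (n - i))"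
proof
  fix n
  have eq: "[mod K (Suc n):] (K (Suc i) +> x i) \<Otimes>\<^bsub>A\<^esub> (K (Suc (n - i)) +> y (n - i)) = K (Suc n) +> (x i \<otimes> y (n - i))"
    if "i \<le> n" for i
    using coset_mult[OF x y, of i "n - i"] that by simp
  have "(gr_seq x \<otimes>\<^bsub>Gr A K\<^esub> gr_seq y) n = finsum (A Quot K (Suc n))
      (\<lambda>i. [mod K (Suc n):] (K (Suc i) +> x i) \<Otimes>\<^bsub>A\<^esub> (K (Suc (n - i)) +> y (n - i))) {..n}"
    by (simp add: Gr_def gr_seq_def)
  also have "\<dots> = finsum (A Quot K (Suc n)) (\<lambda>i. K (Suc n) +> (x i \<otimes> y (n - i))) {..n}"
  proof -
    interpret Q: ring "A Quot K (Suc n)" by (rule ideal.quotient_is_ring[OF K_ideal])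
    have "K (Suc n) +> (x i \<otimes> y (n - i)) \<in> carrier (A Quot K (Suc n))" for i
      using m_closed[OF K_carrier[OF x[of i]] K_carrier[OF y[of "n - i"]]]
      by (auto simp: FactRing_def A_RCOSETS_def')
    then show ?thesis by (intro Q.finsum_cong') (auto simp: eq)
  qed
  also have "\<dots> = gr_seq (\<lambda>n. \<Oplus>i\<in>{..n}. x i \<otimes> y (n - i)) n"
    unfolding gr_seq_def by (intro finsum_coset m_closed K_carrier[OF x] K_carrier[OF y] finite_atMost)
  finally show "(gr_seq x \<otimes>\<^bsub>Gr A K\<^esub> gr_seq y) n = gr_seq (\<lambda>n. \<Oplus>i\<in>{..n}. x i \<otimes> y (n - i)) n" .
qed

lemma gr_seq_eq_iff:
  assumes "\<And>n. x n \<in> carrier A" "\<And>n. y n \<in> carrier A"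
  shows "gr_seq x = gr_seq y \<longleftrightarrow> (\<forall>n. x n \<ominus> y n \<in> K (Suc n))"
  unfolding gr_seq_def fun_eq_iff using assms K_coset_eq_iff by simp

lemma gr_seq_eq_K_iff:
  assumes "x n \<in> carrier A"
  shows "gr_seq x n = K (Suc n) \<longleftrightarrow> x n \<in> K (Suc n)"
  unfolding gr_seq_def using assms abelian_subgroup.a_rcos_const[OF K_abelian_subgroup]
    abelian_subgroup.a_rcos_self[OF K_abelian_subgroup] by blast

lemma gr_carrierE:
  assumes "\<xi> \<in> carrier (Gr A K)"
  obtains x where "\<xi> = gr_seq x" "\<And>n. x n \<in> K n" "finite {n. x n \<notin> K (Suc n)}"
proof -
  have "\<forall>n. \<exists>x\<in>K n. \<xi> n = K (Suc n) +> x" using assms by (simp add: Gr_def)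
  then obtain x where x: "\<And>n. x n \<in> K n" "\<And>n. \<xi> n = K (Suc n) +> x n" by metis
  then have eq: "\<xi> = gr_seq x" by (simp add: gr_seq_def fun_eq_iff)
  moreover have "gr_seq x n = K (Suc n) \<longleftrightarrow> x n \<in> K (Suc n)" for n
    by (rule gr_seq_eq_K_iff[OF K_carrier[OF x(1)]])
  then have "finite {n. x n \<notin> K (Suc n)}"
    using assms unfolding eq by (simp add: Gr_def)
  ultimately show ?thesis using x(1) that by blast
qed

lemma gr_carrierI:
  assumes "\<And>n. x n \<in> K n" "finite {n. x n \<notin> K (Suc n)}"
  shows "gr_seq x \<in> carrier (Gr A K)"
proof -
  have "gr_seq x n = K (Suc n) \<longleftrightarrow> x n \<in> K (Suc n)" for n
    by (rule gr_seq_eq_K_iff[OF K_carrier[OF assms(1)]])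
  then have "finite {n. gr_seq x n \<noteq> K (Suc n)}" using assms(2) by simp
  then show ?thesis using assms(1) by (auto simp: Gr_def gr_seq_def)
qed

end

section \<open>The filtrations by word weight\<close>

context involutive_lie_algebra
begin

interpretation L: lie_sub msc "brk :: (int \<Rightarrow>\<^sub>0 'g) \<Rightarrow> _" UNIV by unfold_locales auto
interpretation LF: lie_sub msc "brk :: (int \<Rightarrow>\<^sub>0 'g) \<Rightarrow> _" "loop_fixed om" by (rule loop_fixed_lie_sub)
interpretation C: lie_sub msc "brk :: (nat \<Rightarrow>\<^sub>0 'g) \<Rightarrow> _" UNIV by unfold_locales auto
interpretation CF: lie_sub msc "brk :: (nat \<Rightarrow>\<^sub>0 'g) \<Rightarrow> _" "current_fixed scale om" by (rule current_fixed_lie_sub)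

lemma carrier_free_UNIV: "carrier (free_alg UNIV) = UNIV"
  by simp

lemma LI_mult: "p \<in> L.I \<Longrightarrow> p * q \<in> L.I" "p \<in> L.I \<Longrightarrow> q * p \<in> L.I"
  using L.I_simps(5,6)[of p q] by simp_all

lemma LI_sum: "(\<And>i. i \<in> A \<Longrightarrow> g i \<in> L.I) \<Longrightarrow> sum g A \<in> L.I"
  by (induction A rule: infinite_finite_induct) (simp_all add: L.I_simps)

lemma LI_add: "sgl [x + y] 1 - sgl [x] 1 - sgl [y] 1 \<in> L.I"
  by (rule L.I_rels) simp_all

lemma LI_zero: "sgl [0] c \<in> L.I"
proof -
  have "sgl [0] 1 \<in> L.I" using L.I_simps(2)[OF LI_add[of 0 0]] by simp
  then have "sgl [] c * sgl [0] 1 \<in> L.I" by (rule LI_mult)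
  then show ?thesis by (simp add: word_mult)
qed

lemma LI_diff: "sgl [x] 1 - sgl [y] 1 - sgl [x - y] 1 \<in> L.I"
  using LI_add[of y "x - y"] by simp

lemma LI_sum_letter: "sgl [(\<Sum>i\<in>A. g i)] 1 - (\<Sum>i\<in>A. sgl [g i] 1) \<in> L.I"
proof (induction A rule: infinite_finite_induct)
  case (insert i A)
  have "(sgl [g i + (\<Sum>i\<in>A. g i)] 1 - sgl [g i] 1 - sgl [(\<Sum>i\<in>A. g i)] 1) + (sgl [(\<Sum>i\<in>A. g i)] 1 - (\<Sum>i\<in>A. sgl [g i] 1)) \<in> L.I"
    by (rule L.I_simps(3)[OF LI_add insert.IH])
  then show ?case using insert.hyps by (simp add: algebra_simps)
qed (simp_all add: LI_zero)

text \<open>A filtration by weight, pulled back to the free algebra: a letter in \<open>Q s\<close>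
  may be counted with weight \<open>s\<close>, and each letter of a word may use its own
  \<open>s\<close>. With \<open>Q = lev\<close> it describes \<open>kappa\<close>; with
  \<open>Q = fixlev\<close> it is the filtration \<open>\<kappa>'\<close>. Closure under
  multiplication by arbitrary elements is not built in, since it would leave the fixed
  subalgebra.\<close>

inductive_set wfilt :: "(nat \<Rightarrow> (int \<Rightarrow>\<^sub>0 'g) set) \<Rightarrow> nat \<Rightarrow> ((int \<Rightarrow>\<^sub>0 'g) list \<Rightarrow>\<^sub>0 complex) set"
  for Q r where
  wfilt_I: "p \<in> L.I \<Longrightarrow> p \<in> wfilt Q r"
| wfilt_word: "list_all2 (\<lambda>y s. y \<in> Q s) w rs \<Longrightarrow> r \<le> sum_list rs \<Longrightarrow> sgl w c \<in> wfilt Q r"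
| wfilt_add: "p \<in> wfilt Q r \<Longrightarrow> q \<in> wfilt Q r \<Longrightarrow> p + q \<in> wfilt Q r"

lemma wfilt_0: "0 \<in> wfilt Q r"
  by (rule wfilt_I[OF L.I_simps(1)])

lemma wfilt_uminus: "p \<in> wfilt Q r \<Longrightarrow> - p \<in> wfilt Q r"
proof (induction rule: wfilt.induct)
  case (wfilt_word w rs c)
  then have "sgl w (- c) \<in> wfilt Q r" by (rule wfilt.wfilt_word)
  then show ?case by (simp add: single_uminus)
next
  case (wfilt_add p q)
  then show ?case using wfilt.wfilt_add[of "- p" Q r "- q"] by simp
qed (intro wfilt_I L.I_simps)

lemma wfilt_diff: "p \<in> wfilt Q r \<Longrightarrow> q \<in> wfilt Q r \<Longrightarrow> p - q \<in> wfilt Q r"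
  using wfilt_add[OF _ wfilt_uminus, of p Q r q] by simp

lemma wfilt_sum: "(\<And>i. i \<in> A \<Longrightarrow> g i \<in> wfilt Q r) \<Longrightarrow> sum g A \<in> wfilt Q r"
  by (induction A rule: infinite_finite_induct) (simp_all add: wfilt_0 wfilt_add)

lemma wfilt_letter: "y \<in> Q s \<Longrightarrow> sgl [y] c \<in> wfilt Q s"
  by (rule wfilt_word[of _ _ "[s]"]) simp_all

lemma wfilt_one: "1 \<in> wfilt Q 0"
  using wfilt_word[of Q "[]" "[]" 0 1] by simp

lemma wfilt_antimono: "p \<in> wfilt Q r \<Longrightarrow> s \<le> r \<Longrightarrow> p \<in> wfilt Q s"
  by (induction rule: wfilt.induct) (auto intro: wfilt_I wfilt_word wfilt_add)

lemma wfilt_mono: "p \<in> wfilt Q r \<Longrightarrow> (\<And>s. Q s \<subseteq> Q' s) \<Longrightarrow> p \<in> wfilt Q' r"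
proof (induction rule: wfilt.induct)
  case (wfilt_word w rs c)
  have "list_all2 (\<lambda>y s. y \<in> Q' s) w rs"
    using wfilt_word(1) by (rule list_all2_mono) (use wfilt_word(3) in blast)
  then show ?case using wfilt_word(2) by (rule wfilt.wfilt_word)
qed (auto intro: wfilt_I wfilt_add)

lemma wfilt_mult:
  assumes "p \<in> wfilt Q r" "q \<in> wfilt Q s"
  shows "p * q \<in> wfilt Q (r + s)"
  using assms(1)
proof (induction rule: wfilt.induct)
  case (wfilt_I p)
  then show ?case by (intro wfilt.wfilt_I LI_mult)
next
  case (wfilt_word w rs c)
  show ?case using assms(2)
  proof (induction rule: wfilt.induct)
    case (wfilt_I p)
    then show ?case by (intro wfilt.wfilt_I LI_mult)
  next
    case word: (wfilt_word v ss d)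
    have "sgl (w @ v) (c * d) \<in> wfilt Q (r + s)"
      using word wfilt_word by (intro wfilt.wfilt_word[of _ _ "rs @ ss"] list_all2_appendI) auto
    then show ?case by (simp add: word_mult)
  next
    case (wfilt_add p q)
    then show ?case by (simp add: distrib_left wfilt.wfilt_add)
  qed
next
  case (wfilt_add p q)
  then show ?case by (simp add: distrib_right wfilt.wfilt_add)
qed

lemma wfilt_lev_0: "p \<in> wfilt lev 0"
proof (induction p rule: pm_induct)
  case (single w c)
  have "list_all2 (\<lambda>y s. y \<in> lev s) w (replicate (length w) 0)"
    by (simp add: list_all2_conv_all_nth lev_0)
  then show ?case by (rule wfilt_word) simp
qed (rule wfilt_add)

text \<open>Every letter belongs to \<open>lev 0\<close>, so the whole free algebra has weight 0 and
  each term is a two-sided ideal.\<close>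

lemma wfilt_lev_mult: "p \<in> wfilt lev r \<Longrightarrow> p * q \<in> wfilt lev r" "p \<in> wfilt lev r \<Longrightarrow> q * p \<in> wfilt lev r"
  using wfilt_mult[of p lev r q 0] wfilt_mult[of q lev 0 p r] wfilt_lev_0[of q] by simp_all

lemma wfilt_fixlev_lev: "p \<in> wfilt fixlev r \<Longrightarrow> p \<in> wfilt lev r"
  by (erule wfilt_mono) (auto simp: fixlev_def)

lemma uea_gen_L: "loop_gen scale bracket x = L.proj (sgl [x] 1)"
  by (rule L.uea_gen_eq)

lemma proj_in_image_iff:
  assumes "L.I \<subseteq> X" "\<And>p q. p \<in> X \<Longrightarrow> q \<in> X \<Longrightarrow> p + q \<in> X"
  shows "L.proj p \<in> L.proj ` X \<longleftrightarrow> p \<in> X"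
proof
  assume "L.proj p \<in> L.proj ` X"
  then obtain q where q: "q \<in> X" "p - q \<in> L.I" by (auto simp: L.proj_eq_iff)
  then have "q + (p - q) \<in> X" using assms by blast
  then show "p \<in> X" by simp
qed blast

lemma proj_wf_iff: "L.proj p \<in> L.proj ` wfilt Q r \<longleftrightarrow> p \<in> wfilt Q r"
  by (rule proj_in_image_iff) (auto intro: wfilt_I wfilt_add)

definition gen_word :: "('g \<times> nat \<times> int) list \<Rightarrow> (int \<Rightarrow>\<^sub>0 'g) list" where
  "gen_word ws = map (\<lambda>(g, s, k). loop_elem scale g s k) ws"

lemma gen_word_foldr:
  "foldr (\<lambda>(g, s, k) z. loop_gen scale bracket (loop_elem scale g s k) \<otimes>\<^bsub>U_loop scale bracket\<^esub> z) ws
     \<one>\<^bsub>U_loop scale bracket\<^esub> = L.proj (sgl (gen_word ws) 1)"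
proof (induction ws)
  case Nil
  show ?case by (simp add: L.U_one gen_word_def)
next
  case (Cons a ws)
  obtain g s k where a: "a = (g, s, k)" by (metis prod_cases3)
  show ?case using Cons by (simp add: a uea_gen_L L.U_mult word_mult gen_word_def)
qed

lemma U_loop_carrier_upd: "U_loop scale bracket\<lparr>carrier := L.proj ` UNIV\<rparr> = U_loop scale bracket"
proof -
  have "L.proj ` UNIV = carrier (U_loop scale bracket)" by (simp add: L.U_carrier)
  then show ?thesis by simp
qed

lemma ideal_proj_wf: "ideal (L.proj ` wfilt lev r) (U_loop scale bracket)"
proof -
  have "ideal (L.proj ` wfilt lev r) (L.U\<lparr>carrier := L.proj ` UNIV\<rparr>)"
    by (rule L.ideal_proj_image)
       (simp_all only: carrier_free_UNIV subset_UNIV UNIV_I wfilt_0 wfilt_add wfilt_uminus wfilt_lev_mult)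
  then show ?thesis by (simp only: U_loop_carrier_upd)
qed

text \<open>The generators of \<open>kappa\<close> use only letters of the form
  \<open>g (t - 1)^s t^k\<close>, while \<open>wfilt lev\<close> allows all of \<open>lev s\<close>.
  Each element of \<open>lev s\<close> is a sum of such letters, and additivity in one letter at a
  time expands any word.\<close>

lemma kappa_eq: "kappa scale bracket r = L.proj ` wfilt lev r"
proof
  let ?U = "U_loop scale bracket"
  define gens where "gens = {L.proj (sgl (gen_word ws) 1) | ws. r \<le> (\<Sum>(g, s, k)\<leftarrow>ws. s)}"
  have kap: "kappa scale bracket r = Idl\<^bsub>?U\<^esub> gens"
    unfolding kappa_def gens_def gen_word_foldr ..
  have gens_wf: "L.proj (sgl (gen_word ws) 1) \<in> L.proj ` wfilt lev r" if "r \<le> (\<Sum>(g, s, k)\<leftarrow>ws. s)" for ws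
  proof (intro imageI wfilt_word)
    show "list_all2 (\<lambda>y s. y \<in> lev s) (gen_word ws) (map (\<lambda>(g, s, k). s) ws)"
      by (auto simp: gen_word_def list_all2_conv_all_nth loop_elem_eq lev_def split: prod.splits)
  qed (use that in simp)
  show "kappa scale bracket r \<subseteq> L.proj ` wfilt lev r"
    unfolding kap
  proof (rule ring.genideal_minimal[OF L.ring_U ideal_proj_wf])
    show "gens \<subseteq> L.proj ` wfilt lev r" unfolding gens_def by clarify (rule gens_wf)
  qed
  have carr: "gens \<subseteq> carrier ?U" unfolding gens_def using L.U_memI by auto
  have id: "ideal (kappa scale bracket r) ?U"
    unfolding kap by (rule ring.genideal_ideal[OF L.ring_U carr])
  have sub: "gens \<subseteq> kappa scale bracket r"
    unfolding kap by (rule ring.genideal_self[OF L.ring_U carr])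
  interpret K: ideal "kappa scale bracket r" ?U by (rule id)
  have add: "L.proj (p + q) \<in> kappa scale bracket r"
    if "L.proj p \<in> kappa scale bracket r" "L.proj q \<in> kappa scale bracket r" for p q
    using additive_subgroup.a_closed[OF K.is_additive_subgroup that] by (simp add: L.U_add)
  have zero: "L.proj 0 \<in> kappa scale bracket r"
    using additive_subgroup.zero_closed[OF K.is_additive_subgroup] by (simp add: L.U_zero)
  \<comment> \<open>The prefix \<open>gen_word ws\<close> consists of the letters already expanded,
    and the bound on the weight is shared between it and the remaining letters.\<close>
  have word: "L.proj (sgl (gen_word ws @ w) 1) \<in> kappa scale bracket r"
    if "list_all2 (\<lambda>y s. y \<in> lev s) w rs" "r \<le> (\<Sum>(g, s, k)\<leftarrow>ws. s) + sum_list rs" for ws w rs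
    using that
  proof (induction w arbitrary: ws rs rule: list.induct)
    case Nil
    then show ?case using sub unfolding gens_def by auto
  next
    case (Cons y w)
    then obtain s ss where rs: "rs = s # ss" "y \<in> lev s" "list_all2 (\<lambda>y s. y \<in> lev s) w ss"
      by (auto simp: list_all2_Cons1)
    then obtain q where y: "y = (dop ^^ s) q" by (auto simp: lev_def)
    show ?case unfolding y
    proof (induction q rule: pm_induct)
      case (single k g)
      have "L.proj (sgl (gen_word (ws @ [(g, s, k)]) @ w) 1) \<in> kappa scale bracket r"
        using Cons.prems rs by (intro Cons.IH) auto
      then show ?case by (simp add: gen_word_def loop_elem_eq)
    next
      case (add p q)
      let ?w = "\<lambda>y. sgl (gen_word ws @ y # w) 1"
      let ?p = "(dop ^^ s) p" and ?q = "(dop ^^ s) q"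
      have "sgl (gen_word ws) 1 * (sgl [?p + ?q] 1 - sgl [?p] 1 - sgl [?q] 1) * sgl w 1 \<in> L.I"
        by (intro LI_mult LI_add)
      then have "?w (?p + ?q) - (?w ?p + ?w ?q) \<in> L.I"
        by (simp add: algebra_simps word_mult)
      then have "L.proj (?w (?p + ?q)) = L.proj (?w ?p + ?w ?q)" by (simp add: L.proj_eq_iff)
      then show ?case using \<open>\<And>p q. _ \<Longrightarrow> _ \<Longrightarrow> L.proj (p + q) \<in> _\<close>[OF add]
        by (simp add: additive_map_add[OF additive_dop_pow])
    qed
  qed
  show "L.proj ` wfilt lev r \<subseteq> kappa scale bracket r"
  proof clarify
    fix p assume "p \<in> wfilt lev r"
    then show "L.proj p \<in> kappa scale bracket r"
    proof (induction rule: wfilt.induct)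
      case (wfilt_I p)
      then have "L.proj p = L.proj 0" by (simp add: L.proj_eq_iff)
      then show ?case using zero by simp
    next
      case (wfilt_word w rs c)
      have "L.proj (sgl [] c) \<otimes>\<^bsub>?U\<^esub> L.proj (sgl (gen_word [] @ w) 1) \<in> kappa scale bracket r"
        using wfilt_word by (intro K.I_l_closed word L.U_memI) auto
      then show ?case by (simp add: L.U_mult word_mult gen_word_def)
    next
      case (wfilt_add p q)
      then show ?case by (intro add)
    qed
  qed
qed

text \<open>Weight 0 demands only that all letters be fixed, because \<open>fixlev 0\<close> is the
  whole fixed subalgebra and contains every \<open>fixlev s\<close>.\<close>

lemma wfilt_fixlev_0: "L.proj ` wfilt fixlev 0 = carrier (U_loop_fixed scale bracket om)"
proof -
  have "carrier (U_loop_fixed scale bracket om) = L.proj ` carrier LF.F"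
    by (simp add: U_loop_fixed_def LF.U_carrier image_image LF.uea_incl_proj del: free_alg_simps)
  also have "\<dots> = L.proj ` wfilt fixlev 0"
  proof (intro equalityI image_subsetI)
    fix p assume "p \<in> carrier LF.F"
    then have "Poly_Mapping.keys p \<subseteq> lists (loop_fixed om)" by simp
    then have "p \<in> wfilt fixlev 0"
    proof (induction p rule: pm_induct_on)
      case (single w c)
      have "list_all2 (\<lambda>y s. y \<in> fixlev s) w (replicate (length w) 0)"
        using single by (auto simp: list_all2_conv_all_nth fixlev_0)
      then show ?case by (rule wfilt_word) simp
    qed (auto intro: wfilt_add wfilt_0)
    then show "L.proj p \<in> L.proj ` wfilt fixlev 0" by blast
  next
    fix p assume "p \<in> wfilt fixlev 0"
    then show "L.proj p \<in> L.proj ` carrier LF.F"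
    proof (induction rule: wfilt.induct)
      case (wfilt_I p)
      then have "L.proj p = L.proj 0" by (simp add: L.proj_eq_iff)
      then show ?case using LF.carrier_F_closed(5) by blast
    next
      case (wfilt_word w rs c)
      have "x \<in> loop_fixed om" if "x \<in> set w" for x
        using that wfilt_word(1) by (auto simp: list_all2_conv_all_nth in_set_conv_nth fixlev_def)
      then have "sgl w c \<in> carrier LF.F" by auto
      then show ?case by blast
    next
      case (wfilt_add p q)
      then obtain p' q' where "p' \<in> carrier LF.F" "p - p' \<in> L.I" "q' \<in> carrier LF.F" "q - q' \<in> L.I"
        by (auto simp: L.proj_eq_iff simp del: free_alg_simps)
      then have "p' + q' \<in> carrier LF.F" "(p + q) - (p' + q') \<in> L.I"
        using LF.carrier_F_closed(1) L.I_simps(3)[of "p - p'" "q - q'"] by (simp_all add: add_diff_add del: free_alg_simps)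
      then show ?case using L.proj_eq_iff by blast
    qed
  qed
  finally show ?thesis ..
qed

text \<open>Both sets contain the kernel of the projection, so taking images commutes with the
  intersection.\<close>

lemma kappa_i_eq: "kappa_i scale bracket om m = L.proj ` (wfilt lev m \<inter> wfilt fixlev 0)"
proof -
  have "L.proj ` (wfilt lev m \<inter> wfilt fixlev 0) = L.proj ` wfilt lev m \<inter> L.proj ` wfilt fixlev 0"
    using proj_wf_iff by blast
  then show ?thesis unfolding kappa_i_def kappa_eq wfilt_fixlev_0 by blast
qed

lemma U_loop_fixed_upd: "U_loop_fixed scale bracket om = U_loop scale bracket\<lparr>carrier := L.proj ` wfilt fixlev 0\<rparr>"
  unfolding wfilt_fixlev_0 by (simp add: U_loop_fixed_def)

sublocale loop: filtered_algebra "U_loop scale bracket" "kappa scale bracket"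
proof (rule filtered_algebra.intro[OF L.ring_U], rule filtered_algebra_axioms.intro)
  show "ideal (kappa scale bracket n) (U_loop scale bracket)" for n
    unfolding kappa_eq by (rule ideal_proj_wf)
  show "kappa scale bracket (Suc n) \<subseteq> kappa scale bracket n" for n
    unfolding kappa_eq using wfilt_antimono[of _ lev "Suc n" n] by auto
  show "x \<otimes>\<^bsub>L.U\<^esub> y \<in> kappa scale bracket (i + j)" if "x \<in> kappa scale bracket i" "y \<in> kappa scale bracket j" for x y i j
    using that unfolding kappa_eq by (auto simp: L.U_mult intro: wfilt_mult)
  fix c
  show "c \<odot>\<^bsub>L.U\<^esub> x \<in> carrier L.U" if "x \<in> carrier L.U" for x
    using that by (elim L.U_memE) (simp add: L.U_smult L.U_memI)
  show "c \<odot>\<^bsub>L.U\<^esub> (x \<oplus>\<^bsub>L.U\<^esub> y) = c \<odot>\<^bsub>L.U\<^esub> x \<oplus>\<^bsub>L.U\<^esub> c \<odot>\<^bsub>L.U\<^esub> y" if "x \<in> carrier L.U" "y \<in> carrier L.U" for x y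
    using that by (elim L.U_memE) (simp add: L.U_smult L.U_add distrib_left)
  show "c \<odot>\<^bsub>L.U\<^esub> x \<in> kappa scale bracket n" if "x \<in> kappa scale bracket n" for x n
    using that unfolding kappa_eq by (auto simp: L.U_smult intro: wfilt_lev_mult)
qed

sublocale fixed: filtered_algebra "U_loop_fixed scale bracket om" "kappa_i scale bracket om"
proof -
  let ?X = "\<lambda>n. wfilt lev n \<inter> wfilt fixlev 0"
  have scal: "sgl [] c \<in> wfilt fixlev 0" for c
    by (rule wfilt_word[of _ _ "[]"]) simp_all
  have mult0: "p * q \<in> wfilt fixlev 0" if "p \<in> wfilt fixlev 0" "q \<in> wfilt fixlev 0" for p q
    using wfilt_mult[OF that] by simp
  have ops: "monoid.mult (U_loop_fixed scale bracket om) = monoid.mult L.U" "add (U_loop_fixed scale bracket om) = add L.U"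
    "smult (U_loop_fixed scale bracket om) = smult L.U"
    by (simp_all add: U_loop_fixed_def)
  have id: "ideal (kappa_i scale bracket om n) (U_loop_fixed scale bracket om)" for n
    unfolding kappa_i_eq U_loop_fixed_upd
    by (rule L.ideal_proj_image) (auto intro: wfilt_0 wfilt_add wfilt_uminus wfilt_lev_mult mult0 wfilt_one)
  show "filtered_algebra (U_loop_fixed scale bracket om) (kappa_i scale bracket om)"
  proof (rule filtered_algebra.intro[OF ideal.axioms(2)[OF id[of 0]]], rule filtered_algebra_axioms.intro)
    show "ideal (kappa_i scale bracket om n) (U_loop_fixed scale bracket om)" for n by (rule id)
    show "kappa_i scale bracket om (Suc n) \<subseteq> kappa_i scale bracket om n" for n
      unfolding kappa_i_eq using wfilt_antimono[of _ lev "Suc n" n] by auto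
    show "x \<otimes>\<^bsub>U_loop_fixed scale bracket om\<^esub> y \<in> kappa_i scale bracket om (i + j)"
      if "x \<in> kappa_i scale bracket om i" "y \<in> kappa_i scale bracket om j" for x y i j
      using that unfolding kappa_i_eq ops by (auto simp: L.U_mult intro!: wfilt_mult mult0)
    fix c
    note carr = wfilt_fixlev_0[symmetric]
    show "c \<odot>\<^bsub>U_loop_fixed scale bracket om\<^esub> x \<in> carrier (U_loop_fixed scale bracket om)"
      if "x \<in> carrier (U_loop_fixed scale bracket om)" for x
      using that unfolding carr ops by (auto simp: L.U_smult intro!: mult0 scal)
    show "c \<odot>\<^bsub>U_loop_fixed scale bracket om\<^esub> (x \<oplus>\<^bsub>U_loop_fixed scale bracket om\<^esub> y) =
       c \<odot>\<^bsub>U_loop_fixed scale bracket om\<^esub> x \<oplus>\<^bsub>U_loop_fixed scale bracket om\<^esub> c \<odot>\<^bsub>U_loop_fixed scale bracket om\<^esub> y"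
      if "x \<in> carrier (U_loop_fixed scale bracket om)" "y \<in> carrier (U_loop_fixed scale bracket om)" for x y
      using that unfolding carr ops by (auto simp: L.U_smult L.U_add distrib_left)
    show "c \<odot>\<^bsub>U_loop_fixed scale bracket om\<^esub> x \<in> kappa_i scale bracket om n" if "x \<in> kappa_i scale bracket om n" for x n
      using that unfolding kappa_i_eq ops by (auto simp: L.U_smult intro!: wfilt_lev_mult mult0 scal)
  qed
qed

end

section \<open>Lifting the enveloping algebra of the current algebra\<close>

lemma sum_convolution_assoc:
  fixes g :: "nat \<Rightarrow> nat \<Rightarrow> nat \<Rightarrow> 'b::comm_monoid_add"
  shows "(\<Sum>i\<le>k. \<Sum>j\<le>k - i. g i j (k - i - j)) = (\<Sum>m\<le>k. \<Sum>i\<le>m. g i (m - i) (k - m))"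
  by (subst (1 2) sum.Sigma, simp, simp, simp, simp,
      rule sum.reindex_bij_witness[where j = "\<lambda>(i, j). (i + j, i)" and i = "\<lambda>(m, i). (i, m - i)"]) auto

context involutive_lie_algebra
begin

interpretation L: lie_sub msc "brk :: (int \<Rightarrow>\<^sub>0 'g) \<Rightarrow> _" UNIV by unfold_locales auto
interpretation C: lie_sub msc "brk :: (nat \<Rightarrow>\<^sub>0 'g) \<Rightarrow> _" UNIV by unfold_locales auto
interpretation CF: lie_sub msc "brk :: (nat \<Rightarrow>\<^sub>0 'g) \<Rightarrow> _" "current_fixed scale om" by (rule current_fixed_lie_sub)

text \<open>The coefficient of \<open>q^k\<close> in the product, over the letters \<open>x\<close>
  of the word, of the generating functions with coefficients \<open>sgl [lift i x] 1\<close> at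
  \<open>q^i\<close>. It is defined for all words over \<open>\<gg>[u]\<close>, fixed or not, so
  that it can be compared with \<open>\<Phi>\<close>.\<close>

fun psi_word :: "nat \<Rightarrow> (nat \<Rightarrow>\<^sub>0 'g) list \<Rightarrow> (int \<Rightarrow>\<^sub>0 'g) list \<Rightarrow>\<^sub>0 complex" where
  "psi_word k [] = (if k = 0 then 1 else 0)"
| "psi_word k (x # w) = (\<Sum>i\<le>k. sgl [lift i x] 1 * psi_word (k - i) w)"

definition psi :: "nat \<Rightarrow> ((nat \<Rightarrow>\<^sub>0 'g) list \<Rightarrow>\<^sub>0 complex) \<Rightarrow> (int \<Rightarrow>\<^sub>0 'g) list \<Rightarrow>\<^sub>0 complex" where
  "psi k = pm_ext (\<lambda>w c. sgl [] c * psi_word k w)"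

lemma psi_word_append: "psi_word k (u @ v) = (\<Sum>i\<le>k. psi_word i u * psi_word (k - i) v)"
proof (induction u arbitrary: k)
  case Nil
  have "(\<Sum>i\<le>k. psi_word i [] * psi_word (k - i) v) = (\<Sum>i\<le>k. if i = 0 then psi_word k v else 0)"
    by (intro sum.cong) auto
  then show ?case by simp
next
  case (Cons x u)
  have "psi_word k ((x # u) @ v) = (\<Sum>i\<le>k. \<Sum>j\<le>k - i. sgl [lift i x] 1 * psi_word j u * psi_word (k - i - j) v)"
    by (simp add: Cons.IH sum_distrib_left mult.assoc)
  also have "\<dots> = (\<Sum>m\<le>k. \<Sum>i\<le>m. sgl [lift i x] 1 * psi_word (m - i) u * psi_word (k - m) v)"
    by (rule sum_convolution_assoc)
  finally show ?case by (simp add: sum_distrib_right)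
qed

lemma additive_psi: "additive_map (psi k)"
  unfolding psi_def by (intro additive_pm_ext additive_mapI) (simp add: single_add distrib_right)

lemma psi_single: "psi k (sgl w c) = sgl [] c * psi_word k w"
  unfolding psi_def by (simp add: pm_ext_single)

lemmas psi_simps = psi_single additive_map_add[OF additive_psi] additive_map_diff[OF additive_psi]
  additive_map_0[OF additive_psi]

lemma psi_mult: "psi k (p * q) = (\<Sum>i\<le>k. psi i p * psi (k - i) q)"
proof -
  have 1: "psi k (sgl u c * sgl v d) = (\<Sum>i\<le>k. psi i (sgl u c) * psi (k - i) (sgl v d))" for u v c d
  proof -
    have "sgl [] c * psi_word i u * (sgl [] d * psi_word (k - i) v) = sgl [] (c * d) * (psi_word i u * psi_word (k - i) v)" for i
    proof -
      have "psi_word i u * (sgl [] d * psi_word (k - i) v) = (sgl [] d * psi_word i u) * psi_word (k - i) v"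
        by (metis Nil_mult_commute mult.assoc)
      moreover have "sgl [] c * (sgl [] d * (psi_word i u * psi_word (k - i) v)) = sgl [] (c * d) * (psi_word i u * psi_word (k - i) v)"
        by (simp add: word_mult flip: mult.assoc)
      ultimately show ?thesis by (simp add: mult.assoc)
    qed
    then show ?thesis
      by (simp add: word_mult psi_single psi_word_append sum_distrib_left)
  qed
  have 2: "psi k (sgl u c * q) = (\<Sum>i\<le>k. psi i (sgl u c) * psi (k - i) q)" for u c
    by (induction q rule: pm_induct) (simp_all only: 1 psi_simps(2) distrib_left sum.distrib)
  show ?thesis
    by (induction p rule: pm_induct) (simp_all only: 2 psi_simps(2) distrib_right sum.distrib)
qed

lemma psi_scalar: "psi k (sgl [] c * p) = sgl [] c * psi k p"
proof -
  have "psi k (sgl [] c * p) = (\<Sum>i\<le>k. if i = 0 then sgl [] c * psi k p else 0)"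
    unfolding psi_mult by (intro sum.cong) (auto simp: psi_single)
  then show ?thesis by simp
qed

lemma psi_word_letter: "psi_word k [x] = sgl [lift k x] 1"
proof -
  have "psi_word k [x] = (\<Sum>i\<le>k. if i = k then sgl [lift k x] 1 else 0)"
    unfolding psi_word.simps by (intro sum.cong) auto
  then show ?thesis by simp
qed

lemma psi_one: "psi k 1 = (if k = 0 then 1 else 0)"
  using psi_single[of k "[]" 1] by simp

lemma psi_letter: "psi k (sgl [x] c) = sgl [lift k x] c"
  unfolding psi_single psi_word_letter by (simp add: word_mult)

lemma psi_wf:
  assumes "\<And>x i. x \<in> S \<Longrightarrow> lift i x \<in> Q i" "Poly_Mapping.keys z \<subseteq> lists S"
  shows "psi k z \<in> wfilt Q k"
proof -
  have "psi_word k w \<in> wfilt Q k" if "w \<in> lists S" for w k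
    using that
  proof (induction w arbitrary: k rule: list.induct)
    case Nil
    show ?case by (simp add: wfilt_one wfilt_0)
  next
    case (Cons x w)
    have "sgl [lift i x] 1 * psi_word (k - i) w \<in> wfilt Q (i + (k - i))" for i
      using Cons assms(1) by (intro wfilt_mult wfilt_letter) auto
    then have "sgl [lift i x] 1 * psi_word (k - i) w \<in> wfilt Q k" if "i \<le> k" for i
      using that by (metis le_add_diff_inverse)
    then show ?case by (auto intro!: wfilt_sum)
  qed
  then have "sgl [] c * psi_word k w \<in> wfilt Q (0 + k)" if "w \<in> lists S" for w c
    using that by (intro wfilt_mult wfilt_word[of _ "[]" "[]"]) simp_all
  with assms(2) show ?thesis
    by (induction z rule: pm_induct_on) (simp_all add: psi_simps wfilt_0 wfilt_add)
qed

lemma psi_lev: "psi k z \<in> wfilt lev k"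
  by (rule psi_wf[of UNIV]) (simp_all add: lift_in_lev)

lemma psi_fixlev: "z \<in> carrier CF.F \<Longrightarrow> psi k z \<in> wfilt fixlev k"
  by (rule psi_wf[of "current_fixed scale om"]) (simp_all add: lift_in_fixlev)

lemma wfilt_letter_diff: "x - y \<in> Q k \<Longrightarrow> sgl [x] 1 - sgl [y] 1 \<in> wfilt Q k"
  using wfilt_add[OF wfilt_I[OF LI_diff[of x y]] wfilt_letter[of "x - y" Q k 1]] by simp

lemma LI_scale: "sgl [msc c x] 1 - sgl [x] c \<in> L.I"
  by (rule L.I_rels) simp

lemma LI_bracket: "sgl [x, y] 1 - sgl [y, x] 1 - sgl [brk x y] 1 \<in> L.I"
  by (rule L.I_rels) simp_all

text \<open>Commutators of lifts are letters given by brackets of lifts, modulo \<open>L.I\<close>.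
  By \<open>lift_brk\<close> these agree with lifts of brackets up to weight
  \<open>Suc b\<close>.\<close>

lemma psi_rel_bracket:
  assumes x: "x \<in> current_fixed scale om" and y: "y \<in> current_fixed scale om"
  shows "psi b (sgl [x, y] 1 - sgl [y, x] 1 - sgl [brk x y] 1) \<in> wfilt fixlev (Suc b)"
proof -
  define c where "c i = lift b (sgl b (bracket (coef x i) (coef y (b - i))))" for i
  have two: "psi_word b [x, y] = (\<Sum>i\<le>b. sgl [lift i x, lift (b - i) y] 1)" for x y
    unfolding psi_word.simps(2)[of b x] psi_word_letter by (simp add: word_mult)
  \<comment> \<open>Reindexing pairs each word with the one in which the same two lifts are
    swapped.\<close>
  have rev: "(\<Sum>i\<le>b. sgl [lift i y, lift (b - i) x] 1) = (\<Sum>i\<le>b. sgl [lift (b - i) y, lift i x] (1::complex))"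
    by (rule sum.reindex_bij_witness[where i = "\<lambda>i. b - i" and j = "\<lambda>i. b - i"]) auto
  have "(sgl [lift i x, lift (b - i) y] 1 - sgl [lift (b - i) y, lift i x] 1 - sgl [brk (lift i x) (lift (b - i) y)] 1) +
     (sgl [brk (lift i x) (lift (b - i) y)] 1 - sgl [c i] 1) \<in> wfilt fixlev (Suc b)" if "i \<le> b" for i
    using lift_brk[OF x y, of i "b - i"] that
    by (intro wfilt_add wfilt_I[OF LI_bracket] wfilt_letter_diff) (simp add: c_def)
  then have "(\<Sum>i\<le>b. (sgl [lift i x, lift (b - i) y] 1 - sgl [lift (b - i) y, lift i x] 1 - sgl [brk (lift i x) (lift (b - i) y)] 1) +
     (sgl [brk (lift i x) (lift (b - i) y)] 1 - sgl [c i] 1)) \<in> wfilt fixlev (Suc b)"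
    by (intro wfilt_sum) simp
  then have "(\<Sum>i\<le>b. sgl [lift i x, lift (b - i) y] 1) - (\<Sum>i\<le>b. sgl [lift (b - i) y, lift i x] 1) - (\<Sum>i\<le>b. sgl [c i] 1)
     \<in> wfilt fixlev (Suc b)"
    by (simp add: sum_subtractf)
  moreover have "sgl [lift b (brk x y)] 1 - (\<Sum>i\<le>b. sgl [c i] 1) \<in> wfilt fixlev (Suc b)"
    unfolding lift_brk_sum c_def by (rule wfilt_I[OF LI_sum_letter])
  ultimately have "(\<Sum>i\<le>b. sgl [lift i x, lift (b - i) y] 1) - (\<Sum>i\<le>b. sgl [lift (b - i) y, lift i x] 1) - (\<Sum>i\<le>b. sgl [c i] 1)
      - (sgl [lift b (brk x y)] 1 - (\<Sum>i\<le>b. sgl [c i] 1)) \<in> wfilt fixlev (Suc b)"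
    by (rule wfilt_diff)
  moreover have "psi b (sgl [x, y] 1 - sgl [y, x] 1 - sgl [brk x y] 1) =
      (\<Sum>i\<le>b. sgl [lift i x, lift (b - i) y] 1) - (\<Sum>i\<le>b. sgl [lift (b - i) y, lift i x] 1) - sgl [lift b (brk x y)] 1"
    unfolding psi_simps(3) psi_single two psi_word_letter by (simp add: rev)
  ultimately show ?thesis by simp
qed

text \<open>So \<open>psi k\<close> descends to a map from the enveloping algebra of the fixed
  current algebra to the degree \<open>k\<close> piece of the graded algebra of
  \<open>\<kappa>'\<close>. The ideal in the proof imposes the condition for all \<open>k\<close>
  together, since \<open>psi_mult\<close> mixes degrees.\<close>

lemma psi_uea_ideal:
  assumes "z \<in> CF.I"
  shows "psi k z \<in> wfilt fixlev (Suc k)"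
proof -
  let ?X = "{z \<in> carrier CF.F. \<forall>k. psi k z \<in> wfilt fixlev (Suc k)}"
  have "CF.I \<subseteq> ?X"
  proof (rule CF.I_minimal)
    show "ideal ?X CF.F"
    proof (rule free_alg_idealI)
      fix p q assume p: "p \<in> ?X" and q: "q \<in> carrier CF.F"
      have "psi i q * psi (k - i) p \<in> wfilt fixlev (Suc k)" if "i \<le> k" for i k
        using wfilt_mult[of "psi i q" fixlev i "psi (k - i) p" "Suc (k - i)"] p psi_fixlev[OF q] that by simp
      then show "q * p \<in> ?X" using p q CF.carrier_F_closed(3)[OF q, of p]
        by (auto simp: psi_mult intro!: wfilt_sum simp del: free_alg_simps)
      have "psi i p * psi (k - i) q \<in> wfilt fixlev (Suc k)" if "i \<le> k" for i k
        using wfilt_mult[of "psi i p" fixlev "Suc i" "psi (k - i) q" "k - i"] p psi_fixlev[OF q] that by simp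
      then show "p * q \<in> ?X" using p q CF.carrier_F_closed(3)[of p q]
        by (auto simp: psi_mult intro!: wfilt_sum simp del: free_alg_simps)
    next
      show "?X \<subseteq> carrier CF.F" by blast
      show "0 \<in> ?X" using CF.carrier_F_closed(5) by (simp add: psi_simps wfilt_0)
      show "p + q \<in> ?X" if "p \<in> ?X" "q \<in> ?X" for p q
        using that CF.carrier_F_closed(1)[of p q] by (simp add: psi_simps wfilt_add del: free_alg_simps)
    qed
    show "uea_rels msc brk (current_fixed scale om) \<subseteq> ?X"
    proof (intro subsetI CollectI conjI allI)
      show "r \<in> carrier CF.F" if "r \<in> uea_rels msc brk (current_fixed scale om)" for r
        using that CF.rels_closed by blast
      fix r k assume "r \<in> uea_rels msc brk (current_fixed scale om)"
      then consider
        (add) x y where "r = sgl [x + y] 1 - sgl [x] 1 - sgl [y] 1"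
      | (scale) c x where "r = sgl [msc c x] 1 - sgl [x] c"
      | (bracket) x y where "x \<in> current_fixed scale om" "y \<in> current_fixed scale om"
          "r = sgl [x, y] 1 - sgl [y, x] 1 - sgl [brk x y] 1"
        unfolding uea_rels_def by (elim UnE CollectE exE conjE) metis+
      then show "psi k r \<in> wfilt fixlev (Suc k)"
      proof cases
        case (add x y)
        show ?thesis using wfilt_I[OF LI_add[of "lift k x" "lift k y"]]
          by (simp add: add psi_letter psi_simps(2,3) additive_map_add[OF additive_lift])
      next
        case (scale c x)
        show ?thesis using wfilt_I[OF LI_scale[of c "lift k x"]]
          by (simp add: scale psi_letter psi_simps(2,3) lift_msc)
      next
        case (bracket x y)
        show ?thesis unfolding bracket(3) by (rule psi_rel_bracket[OF bracket(1,2)])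
      qed
    qed
  qed
  then show ?thesis using assms by blast
qed

text \<open>Each letter is replaced by its leading coefficient from \<open>fixlev_leading\<close>,
  placed in the degree of its weight. The resulting word is homogeneous, so its \<open>psi\<close>
  is trivial in all other degrees.\<close>

lemma psi_word_homogeneous:
  assumes "list_all2 (\<lambda>y s. y \<in> fixlev s) w rs"
  shows "\<exists>v\<in>lists (current_fixed scale om). \<forall>j.
    (if j = sum_list rs then sgl w 1 - psi_word j v \<in> wfilt fixlev (Suc j) else psi_word j v \<in> L.I)"
  using assms
proof (induction w rs rule: list_all2_induct)
  case Nil
  show ?case by (intro bexI[of _ "[]"]) (simp_all add: L.I_simps wfilt_0)
next
  case (Cons y w s rs)
  then obtain v where v: "v \<in> lists (current_fixed scale om)"
    "\<And>j. if j = sum_list rs then sgl w 1 - psi_word j v \<in> wfilt fixlev (Suc j) else psi_word j v \<in> L.I" by blast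
  obtain a where a: "scale ((- 1) ^ s) (om a) = a" "y - lift s (sgl s a) \<in> fixlev (Suc s)"
    using fixlev_leading Cons.hyps(1) by blast
  let ?x = "sgl s a"
  have xc: "?x \<in> current_fixed scale om" by (rule single_in_current_fixed[OF a(1)])
  have yx: "sgl [y] 1 - sgl [lift s ?x] 1 \<in> wfilt fixlev (Suc s)"
    by (rule wfilt_letter_diff[where Q = fixlev, OF a(2)])
  \<comment> \<open>The lift in a wrong degree is the letter 0, which is not zero in the free
    algebra but lies in \<open>L.I\<close>.\<close>
  have other: "sgl [lift i ?x] 1 * p \<in> L.I" if "i \<noteq> s" for i p
    using that LI_mult(1)[OF LI_zero] by (simp add: lift_single_other)
  have "if j = s + sum_list rs then sgl (y # w) 1 - psi_word j (?x # v) \<in> wfilt fixlev (Suc j)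
      else psi_word j (?x # v) \<in> L.I" for j
  proof (cases "s \<le> j")
    case False
    then have "psi_word j (?x # v) \<in> L.I" by (auto intro!: LI_sum other)
    then show ?thesis using False by simp
  next
    case True
    have "psi_word j (?x # v) = sgl [lift s ?x] 1 * psi_word (j - s) v +
        (\<Sum>i\<in>{..j} - {s}. sgl [lift i ?x] 1 * psi_word (j - i) v)"
      using True by (simp add: sum.remove[of "{..j}" s])
    moreover have rest: "(\<Sum>i\<in>{..j} - {s}. sgl [lift i ?x] 1 * psi_word (j - i) v) \<in> L.I"
      by (intro LI_sum other) simp
    ultimately obtain e where e: "e \<in> L.I" "psi_word j (?x # v) = sgl [lift s ?x] 1 * psi_word (j - s) v + e"
      by blast
    show ?thesis
    proof (cases "j = s + sum_list rs")
      case False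
      then have "psi_word (j - s) v \<in> L.I" using v(2)[of "j - s"] True by (auto split: if_splits)
      then show ?thesis using False e by (simp add: L.I_simps LI_mult)
    next
      case j: True
      have w: "sgl w 1 - psi_word (sum_list rs) v \<in> wfilt fixlev (Suc (sum_list rs))"
        using v(2)[of "sum_list rs"] by simp
      have "sgl w 1 \<in> wfilt fixlev (sum_list rs)" using Cons.hyps(2) by (rule wfilt_word) simp
      \<comment> \<open>The difference of two products \<open>y w - l v\<close> is split as
        \<open>(y - l) w + l (w - v)\<close>; in each summand one factor gains one unit of
        weight.\<close>
      then have "(sgl [y] 1 - sgl [lift s ?x] 1) * sgl w 1 \<in> wfilt fixlev (Suc s + sum_list rs)"
        using yx by (intro wfilt_mult)
      moreover have "sgl [lift s ?x] 1 * (sgl w 1 - psi_word (sum_list rs) v) \<in> wfilt fixlev (s + Suc (sum_list rs))"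
        using lift_in_fixlev[OF xc] by (intro wfilt_mult wfilt_letter w)
      ultimately have "(sgl [y] 1 - sgl [lift s ?x] 1) * sgl w 1 +
          sgl [lift s ?x] 1 * (sgl w 1 - psi_word (sum_list rs) v) - e \<in> wfilt fixlev (Suc j)"
        unfolding j using wfilt_I[OF e(1)] by (auto intro!: wfilt_add wfilt_diff)
      then show ?thesis using e(2) j by (simp add: algebra_simps word_mult)
    qed
  qed
  moreover have "?x # v \<in> lists (current_fixed scale om)" using v(1) xc by simp
  ultimately show ?case unfolding sum_list.Cons by (intro bexI[of _ "?x # v"] allI)
qed

text \<open>Surjectivity in degree \<open>k\<close>. The homogeneity of \<open>z\<close> lets
  preimages in different degrees be added in \<open>Phi_i_surj\<close> and is used again in
  \<open>wfilt_lev_fixlev\<close>.\<close>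

lemma psi_leading:
  assumes "y \<in> wfilt fixlev k"
  shows "\<exists>z\<in>carrier CF.F. y - psi k z \<in> wfilt fixlev (Suc k) \<and> (\<forall>j. j \<noteq> k \<longrightarrow> psi j z \<in> L.I)"
  using assms
proof (induction rule: wfilt.induct)
  case (wfilt_I p)
  show ?case using CF.carrier_F_closed(5) wfilt_I
    by (intro bexI[of _ 0]) (auto simp: psi_simps L.I_simps intro: wfilt.wfilt_I simp del: free_alg_simps)
next
  case (wfilt_word w rs c)
  show ?case
  proof (cases "sum_list rs = k")
    case False
    then have "Suc k \<le> sum_list rs" using wfilt_word(2) by simp
    then have "sgl w c \<in> wfilt fixlev (Suc k)" using wfilt_word(1) by (intro wfilt.wfilt_word)
    then show ?thesis using CF.carrier_F_closed(5)
      by (intro bexI[of _ 0]) (simp_all add: psi_simps L.I_simps del: free_alg_simps)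
  next
    case True
    obtain v where v: "v \<in> lists (current_fixed scale om)"
      "\<And>j. if j = k then sgl w 1 - psi_word j v \<in> wfilt fixlev (Suc j) else psi_word j v \<in> L.I"
      using psi_word_homogeneous[OF wfilt_word(1)] unfolding True by blast
    have "sgl [] c * (sgl w 1 - psi_word k v) \<in> wfilt fixlev (0 + Suc k)"
      using v(2)[of k] by (intro wfilt_mult wfilt.wfilt_word[of _ "[]" "[]"]) simp_all
    then have "sgl w c - psi k (sgl v c) \<in> wfilt fixlev (Suc k)"
      by (simp add: psi_single right_diff_distrib word_mult)
    moreover have "psi j (sgl v c) \<in> L.I" if "j \<noteq> k" for j
      using v(2)[of j] that by (simp add: psi_single LI_mult)
    moreover have "sgl v c \<in> carrier CF.F" using v(1) by simp
    ultimately show ?thesis by blast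
  qed
next
  case (wfilt_add p q)
  then obtain y z where yz: "y \<in> carrier CF.F" "p - psi k y \<in> wfilt fixlev (Suc k)" "\<And>j. j \<noteq> k \<Longrightarrow> psi j y \<in> L.I"
    "z \<in> carrier CF.F" "q - psi k z \<in> wfilt fixlev (Suc k)" "\<And>j. j \<noteq> k \<Longrightarrow> psi j z \<in> L.I" by blast
  have "(p - psi k y) + (q - psi k z) \<in> wfilt fixlev (Suc k)" using yz by (intro wfilt.wfilt_add)
  then show ?case using yz CF.carrier_F_closed(1)[OF yz(1,4)]
    by (intro bexI[of _ "y + z"]) (simp_all add: psi_simps add_diff_add L.I_simps del: free_alg_simps)
qed

section \<open>The two graded algebras in terms of representatives in the free algebra\<close>

lemma loop_gr_seq_eq_iff:
  "loop.gr_seq (\<lambda>n. L.proj (a n)) = loop.gr_seq (\<lambda>n. L.proj (b n)) \<longleftrightarrow> (\<forall>n. a n - b n \<in> wfilt lev (Suc n))"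
proof -
  have "L.proj p \<ominus>\<^bsub>L.U\<^esub> L.proj q = L.proj (p - q)" for p q
    by (rule loop.minus_eqI) (simp_all add: L.U_memI L.U_add)
  then show ?thesis by (subst loop.gr_seq_eq_iff) (simp_all add: L.U_memI kappa_eq proj_wf_iff)
qed

lemma fixed_carrier: "L.proj p \<in> carrier (U_loop_fixed scale bracket om) \<longleftrightarrow> p \<in> wfilt fixlev 0"
  unfolding wfilt_fixlev_0[symmetric] by (rule proj_wf_iff)

lemma kappa_i_proj: "L.proj p \<in> kappa_i scale bracket om m \<longleftrightarrow> p \<in> wfilt lev m \<and> p \<in> wfilt fixlev 0"
  by (simp add: kappa_i_def kappa_eq proj_wf_iff fixed_carrier)

lemma fixed_add: "L.proj p \<oplus>\<^bsub>U_loop_fixed scale bracket om\<^esub> L.proj q = L.proj (p + q)"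
  by (simp add: U_loop_fixed_def L.U_add)

lemma fixed_mult: "L.proj p \<otimes>\<^bsub>U_loop_fixed scale bracket om\<^esub> L.proj q = L.proj (p * q)"
  by (simp add: U_loop_fixed_def L.U_mult)

lemma fixed_smult: "c \<odot>\<^bsub>U_loop_fixed scale bracket om\<^esub> L.proj p = L.proj (sgl [] c * p)"
  by (simp add: U_loop_fixed_def L.U_smult)

lemma fixed_zero: "\<zero>\<^bsub>U_loop_fixed scale bracket om\<^esub> = L.proj 0"
  by (simp add: U_loop_fixed_def L.U_zero)

lemma fixed_one: "\<one>\<^bsub>U_loop_fixed scale bracket om\<^esub> = L.proj 1"
  by (simp add: U_loop_fixed_def L.U_one)

lemma fixed_gr_seq_eq_iff:
  assumes "\<And>n. a n \<in> wfilt fixlev 0" "\<And>n. b n \<in> wfilt fixlev 0"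
  shows "fixed.gr_seq (\<lambda>n. L.proj (a n)) = fixed.gr_seq (\<lambda>n. L.proj (b n)) \<longleftrightarrow> (\<forall>n. a n - b n \<in> wfilt lev (Suc n))"
proof -
  have "L.proj (a n) \<ominus>\<^bsub>U_loop_fixed scale bracket om\<^esub> L.proj (b n) = L.proj (a n - b n)" for n
    using assms by (intro fixed.minus_eqI) (simp_all add: fixed_carrier fixed_add wfilt_diff)
  then show ?thesis using assms
    by (subst fixed.gr_seq_eq_iff) (simp_all add: fixed_carrier kappa_i_proj wfilt_diff)
qed

lemma fixed_finsum:
  assumes "\<And>i. i \<in> B \<Longrightarrow> g i \<in> wfilt fixlev 0" "finite B"
  shows "finsum (U_loop_fixed scale bracket om) (\<lambda>i. L.proj (g i)) B = L.proj (sum g B)"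
  using assms(2,1)
proof (induction B rule: finite_induct)
  case (insert i B)
  then show ?case
    by (subst fixed.finsum_insert) (auto simp: fixed_carrier fixed_add)
qed (simp add: fixed_zero)

lemma gr_incl_fixed:
  assumes "\<And>n. L.proj (a n) \<in> kappa_i scale bracket om n"
  shows "gr_incl (U_loop scale bracket) (kappa scale bracket) (fixed.gr_seq (\<lambda>n. L.proj (a n))) = loop.gr_seq (\<lambda>n. L.proj (a n))"
proof
  fix n
  have c: "L.proj (a n) \<in> carrier (U_loop_fixed scale bracket om)" using assms by (rule fixed.K_carrier)
  have "(\<Union>x\<in>kappa_i scale bracket om (Suc n) +>\<^bsub>U_loop_fixed scale bracket om\<^esub> L.proj (a n). kappa scale bracket (Suc n) +>\<^bsub>L.U\<^esub> x)
     = kappa scale bracket (Suc n) +>\<^bsub>L.U\<^esub> L.proj (a n)"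
  proof (rule fixed.K_coset_Union[OF c])
    fix k assume "k \<in> kappa_i scale bracket om (Suc n)"
    then have "k \<in> kappa scale bracket (Suc n)" by (simp add: kappa_i_def)
    then have "kappa scale bracket (Suc n) +>\<^bsub>L.U\<^esub> (k \<oplus>\<^bsub>L.U\<^esub> L.proj (a n)) = kappa scale bracket (Suc n) +>\<^bsub>L.U\<^esub> L.proj (a n)"
      by (rule loop.K_coset_absorb) (simp add: L.U_memI)
    then show "kappa scale bracket (Suc n) +>\<^bsub>L.U\<^esub> (k \<oplus>\<^bsub>U_loop_fixed scale bracket om\<^esub> L.proj (a n)) =
      kappa scale bracket (Suc n) +>\<^bsub>L.U\<^esub> L.proj (a n)" by (simp add: U_loop_fixed_def)
  qed
  then show "gr_incl (U_loop scale bracket) (kappa scale bracket) (fixed.gr_seq (\<lambda>n. L.proj (a n))) n = loop.gr_seq (\<lambda>n. L.proj (a n)) n"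
    by (simp add: gr_incl_def fixed.gr_seq_def loop.gr_seq_def)
qed

end

section \<open>Comparison with \<open>\<Phi>\<close> and construction of
  \<open>Phi_i\<close>\<close>

locale graded_current = involutive_lie_algebra scale bracket om
  for scale :: "complex \<Rightarrow> 'g::ab_group_add \<Rightarrow> 'g" and bracket :: "'g \<Rightarrow> 'g \<Rightarrow> 'g" and om :: "'g \<Rightarrow> 'g" +
  fixes \<Phi> :: "((nat \<Rightarrow>\<^sub>0 'g) list \<Rightarrow>\<^sub>0 complex) set \<Rightarrow> nat \<Rightarrow> ((int \<Rightarrow>\<^sub>0 'g) list \<Rightarrow>\<^sub>0 complex) set set"
  assumes centreless: "x \<noteq> 0 \<Longrightarrow> \<exists>y. bracket x y \<noteq> 0"
    and Phi_iso: "\<Phi> \<in> alg_iso (U_current scale bracket) (Gr_kappa scale bracket)"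
    and Phi_gen: "\<Phi> (uea_gen msc brk UNIV (sgl r g)) =
      gr_class (U_loop scale bracket) (kappa scale bracket) r (loop_gen scale bracket (loop_elem scale g r 0))"
begin

interpretation L: lie_sub msc "brk :: (int \<Rightarrow>\<^sub>0 'g) \<Rightarrow> _" UNIV by unfold_locales auto
interpretation C: lie_sub msc "brk :: (nat \<Rightarrow>\<^sub>0 'g) \<Rightarrow> _" UNIV by unfold_locales auto
interpretation CF: lie_sub msc "brk :: (nat \<Rightarrow>\<^sub>0 'g) \<Rightarrow> _" "current_fixed scale om" by (rule current_fixed_lie_sub)

lemma Phi_hom:
  "C.proj p \<in> carrier C.U"
  "\<Phi> (C.proj (p + q)) = \<Phi> (C.proj p) \<oplus>\<^bsub>Gr_kappa scale bracket\<^esub> \<Phi> (C.proj q)"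
  "\<Phi> (C.proj (p * q)) = \<Phi> (C.proj p) \<otimes>\<^bsub>Gr_kappa scale bracket\<^esub> \<Phi> (C.proj q)"
  "\<Phi> (C.proj 1) = \<one>\<^bsub>Gr_kappa scale bracket\<^esub>"
  "\<Phi> (C.proj (sgl [] c * p)) = c \<odot>\<^bsub>Gr_kappa scale bracket\<^esub> \<Phi> (C.proj p)"
  "\<Phi> (C.proj p) = \<Phi> (C.proj q) \<longleftrightarrow> p - q \<in> C.I"
proof -
  show c: "C.proj p \<in> carrier C.U" for p by (simp add: C.U_memI)
  have hom: "\<Phi> \<in> ring_hom C.U (Gr_kappa scale bracket)" and bij: "bij_betw \<Phi> (carrier C.U) (carrier (Gr_kappa scale bracket))"
    and sm: "\<And>c x. x \<in> carrier C.U \<Longrightarrow> \<Phi> (c \<odot>\<^bsub>C.U\<^esub> x) = c \<odot>\<^bsub>Gr_kappa scale bracket\<^esub> \<Phi> x"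
    using Phi_iso by (auto simp: alg_iso_def ring_iso_def)
  show "\<Phi> (C.proj (p + q)) = \<Phi> (C.proj p) \<oplus>\<^bsub>Gr_kappa scale bracket\<^esub> \<Phi> (C.proj q)"
    using ring_hom_add[OF hom c c, of p q] by (simp add: C.U_add)
  show "\<Phi> (C.proj (p * q)) = \<Phi> (C.proj p) \<otimes>\<^bsub>Gr_kappa scale bracket\<^esub> \<Phi> (C.proj q)"
    using ring_hom_mult[OF hom c c, of p q] by (simp add: C.U_mult)
  show "\<Phi> (C.proj 1) = \<one>\<^bsub>Gr_kappa scale bracket\<^esub>"
    using ring_hom_one[OF hom] by (simp add: C.U_one)
  show "\<Phi> (C.proj (sgl [] c * p)) = c \<odot>\<^bsub>Gr_kappa scale bracket\<^esub> \<Phi> (C.proj p)"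
    using sm[OF \<open>C.proj p \<in> _\<close>, of c] by (simp add: C.U_smult)
  show "\<Phi> (C.proj p) = \<Phi> (C.proj q) \<longleftrightarrow> p - q \<in> C.I"
    using inj_on_eq_iff[OF bij_betw_imp_inj_on[OF bij] c c, of p q] by (simp add: C.proj_eq_iff)
qed

lemma L_proj_carrier: "L.proj p \<in> carrier L.U"
  by (simp add: L.U_memI)

text \<open>The lift of \<open>g u^r\<close> and \<open>g (t - 1)^r\<close> have the same leading
  coefficient even if \<open>g\<close> does not satisfy the sign condition; hence the formula holds
  on all of \<open>\<gg>[u]\<close>.\<close>

lemma Phi_letter: "\<Phi> (C.proj (sgl [x] 1)) = loop.gr_seq (\<lambda>n. L.proj (sgl [lift n x] 1))"
proof (induction x rule: pm_induct)
  case (single r g)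
  have D: "(dop ^^ r) (sgl 0 g) - lift r (sgl r g) \<in> lev (Suc r)"
    unfolding lift_single_same by (rule dop_pow_diff_in_lev) (simp add: ev1_single ev1_lift_pre)
  have in_kappa: "L.proj (sgl [(dop ^^ r) (sgl 0 g)] 1) \<in> kappa scale bracket r"
    unfolding kappa_eq by (intro imageI wfilt_letter) (simp add: lev_def)
  have "\<Phi> (C.proj (sgl [sgl r g] 1)) = gr_class L.U (kappa scale bracket) r (L.proj (sgl [(dop ^^ r) (sgl 0 g)] 1))"
    using Phi_gen[of r g] unfolding C.uea_gen_eq L.uea_gen_eq loop_elem_eq .
  also have "\<dots> = loop.gr_seq (\<lambda>n. L.proj (if n = r then sgl [(dop ^^ r) (sgl 0 g)] 1 else 0))"
    unfolding loop.gr_class_eq[OF in_kappa] by (rule arg_cong[where f = loop.gr_seq], rule ext) (simp add: L.U_zero)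
  also have "\<dots> = loop.gr_seq (\<lambda>n. L.proj (sgl [lift n (sgl r g)] 1))"
    unfolding loop_gr_seq_eq_iff
  proof
    fix n
    show "(if n = r then sgl [(dop ^^ r) (sgl 0 g)] 1 else 0) - sgl [lift n (sgl r g)] 1 \<in> wfilt lev (Suc n)"
      using wfilt_letter_diff[where Q = lev, OF D] wfilt_uminus[OF wfilt_I[OF LI_zero]] by (simp add: lift_single_other)
  qed
  finally show ?case .
next
  case (add x y)
  have "C.proj (sgl [x + y] 1) = C.proj (sgl [x] 1 + sgl [y] 1)"
    using C.I_rels(1)[of x y] by (simp add: C.proj_eq_iff algebra_simps)
  then have "\<Phi> (C.proj (sgl [x + y] 1)) = loop.gr_seq (\<lambda>n. L.proj (sgl [lift n x] 1 + sgl [lift n y] 1))"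
    by (simp add: Phi_hom add loop.gr_seq_add L_proj_carrier L.U_add)
  also have "\<dots> = loop.gr_seq (\<lambda>n. L.proj (sgl [lift n (x + y)] 1))"
    unfolding loop_gr_seq_eq_iff
  proof
    fix n
    show "sgl [lift n x] 1 + sgl [lift n y] 1 - sgl [lift n (x + y)] 1 \<in> wfilt lev (Suc n)"
      using wfilt_uminus[OF wfilt_I[OF LI_add[of "lift n x" "lift n y"]]]
      by (simp add: additive_map_add[OF additive_lift] algebra_simps)
  qed
  finally show ?case .
qed

lemma gr_seq_psi_mult:
  "loop.gr_seq (\<lambda>n. L.proj (psi n p)) \<otimes>\<^bsub>Gr_kappa scale bracket\<^esub> loop.gr_seq (\<lambda>n. L.proj (psi n q)) =
   loop.gr_seq (\<lambda>n. L.proj (psi n (p * q)))"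
proof -
  have "L.proj (psi n p) \<in> kappa scale bracket n" for n p
    unfolding kappa_eq using psi_lev by blast
  then have "loop.gr_seq (\<lambda>n. L.proj (psi n p)) \<otimes>\<^bsub>Gr_kappa scale bracket\<^esub> loop.gr_seq (\<lambda>n. L.proj (psi n q)) =
    loop.gr_seq (\<lambda>n. \<Oplus>\<^bsub>L.U\<^esub>i\<in>{..n}. L.proj (psi i p) \<otimes>\<^bsub>L.U\<^esub> L.proj (psi (n - i) q))"
    by (intro loop.gr_seq_mult)
  then show ?thesis
    using L.finsum_proj[of "{..n}" "\<lambda>i. psi i p * psi (n - i) q" for n] by (simp add: L.U_mult psi_mult)
qed

text \<open>Both sides are linear and multiplicative on the free algebra and agree on letters. Thus
  the injectivity of \<open>\<Phi>\<close> becomes a statement about \<open>psi\<close>.\<close>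

lemma Phi_psi: "\<Phi> (C.proj z) = loop.gr_seq (\<lambda>n. L.proj (psi n z))"
proof -
  have word: "\<Phi> (C.proj (sgl w 1)) = loop.gr_seq (\<lambda>n. L.proj (psi n (sgl w 1)))" for w
  proof (induction w)
    case Nil
    have one: "\<one>\<^bsub>L.U\<^esub> \<in> kappa scale bracket 0" using wfilt_lev_0 by (auto simp: kappa_eq L.U_one)
    have "\<Phi> (C.proj 1) = gr_class L.U (kappa scale bracket) 0 \<one>\<^bsub>L.U\<^esub>"
      by (simp add: Phi_hom Gr_def)
    also have "\<dots> = loop.gr_seq (\<lambda>n. L.proj (psi n 1))"
      unfolding loop.gr_class_eq[OF one] by (rule arg_cong[where f = loop.gr_seq], rule ext) (simp add: L.U_zero L.U_one psi_one)
    finally show ?case by simp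
  next
    case (Cons x w)
    have "sgl (x # w) 1 = sgl [x] (1::complex) * sgl w 1" by (simp add: word_mult)
    moreover have "\<Phi> (C.proj (sgl [x] 1)) = loop.gr_seq (\<lambda>n. L.proj (psi n (sgl [x] 1)))"
      unfolding psi_letter by (rule Phi_letter)
    ultimately show ?case by (simp only: Phi_hom(3) Cons.IH gr_seq_psi_mult)
  qed
  show ?thesis
  proof (induction z rule: pm_induct)
    case (single w c)
    have "sgl w c = sgl [] c * sgl w 1" by (simp add: word_mult)
    then show ?case
      by (simp only: Phi_hom(5) word loop.gr_seq_smult[OF L_proj_carrier] L.U_smult psi_scalar)
  next
    case (add p q)
    then show ?case
      by (simp add: Phi_hom(2) loop.gr_seq_add[OF L_proj_carrier L_proj_carrier] L.U_add psi_simps)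
  qed
qed

interpretation sep: lie_sub_separated msc "brk :: (nat \<Rightarrow>\<^sub>0 'g) \<Rightarrow> _" "current_fixed scale om"
proof (intro lie_sub_separated.intro lie_sub_separated_axioms.intro)
  show "lie_sub msc (brk :: (nat \<Rightarrow>\<^sub>0 'g) \<Rightarrow> _) (current_fixed scale om)" by (rule current_fixed_lie_sub)
  show "vector_space (msc :: complex \<Rightarrow> (nat \<Rightarrow>\<^sub>0 'g) \<Rightarrow> _)" by (rule vector_space_pm_scale)
  show "\<exists>f. uea_fun msc brk f \<and> f [] = 0 \<and> f [x] \<noteq> 0" if "x \<noteq> 0" for x :: "nat \<Rightarrow>\<^sub>0 'g"
    by (rule current_separated[OF centreless that])
qed

text \<open>Injectivity of \<open>\<Phi>\<close> puts \<open>z\<close> into the ideal for all of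
  \<open>\<gg>[u]\<close>, and \<open>uea_ideal_contracts\<close> brings it back to the ideal for
  the fixed subalgebra.\<close>

lemma psi_lev_imp_uea_ideal:
  assumes "z \<in> carrier CF.F" "\<And>n. psi n z \<in> wfilt lev (Suc n)"
  shows "z \<in> CF.I"
proof -
  have "\<Phi> (C.proj z) = \<Phi> (C.proj 0)"
    unfolding Phi_psi loop_gr_seq_eq_iff using assms(2) by (simp add: psi_simps)
  then have "z \<in> C.I" by (simp add: Phi_hom(6))
  then show ?thesis using assms(1) by (intro sep.uea_ideal_contracts)
qed

text \<open>If \<open>p\<close> has weight \<open>m\<close> in fixed letters, its leading part there
  is \<open>psi m z\<close> with \<open>z\<close> homogeneous. Being of weight \<open>Suc m\<close>
  in the ambient filtration makes \<open>psi n z\<close> negligible for every \<open>n\<close>, so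
  \<open>z\<close> is zero in the enveloping algebra and the leading part of \<open>p\<close>
  vanishes.\<close>

lemma wfilt_lev_fixlev: "p \<in> wfilt lev m \<Longrightarrow> p \<in> wfilt fixlev 0 \<Longrightarrow> p \<in> wfilt fixlev m"
proof (induction m)
  case (Suc m)
  then have "p \<in> wfilt fixlev m" using wfilt_antimono[of p lev "Suc m" m] by simp
  then obtain z where z: "z \<in> carrier CF.F" "p - psi m z \<in> wfilt fixlev (Suc m)"
    "\<And>j. j \<noteq> m \<Longrightarrow> psi j z \<in> L.I" using psi_leading by blast
  have "p - (p - psi m z) \<in> wfilt lev (Suc m)"
    by (rule wfilt_diff[OF Suc.prems(1) wfilt_fixlev_lev[OF z(2)]])
  then have "psi n z \<in> wfilt lev (Suc n)" for n
    using z(3)[of n] by (cases "n = m") (auto intro: wfilt_I)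
  then have "z \<in> CF.I" by (rule psi_lev_imp_uea_ideal[OF z(1)])
  then have "(p - psi m z) + psi m z \<in> wfilt fixlev (Suc m)" by (intro wfilt_add z(2) psi_uea_ideal)
  then show ?case by simp
qed

lemma kappa_i_fixlev: "L.proj p \<in> kappa_i scale bracket om m \<longleftrightarrow> p \<in> wfilt fixlev m"
  unfolding kappa_i_proj using wfilt_lev_fixlev[of p m] wfilt_fixlev_lev[of p m] wfilt_antimono[of p fixlev m 0] by auto

text \<open>A representative in the free algebra is chosen; \<open>Phi_i_proj\<close> shows that the
  value does not depend on it.\<close>

definition Phi_i :: "((nat \<Rightarrow>\<^sub>0 'g) list \<Rightarrow>\<^sub>0 complex) set \<Rightarrow> nat \<Rightarrow> ((int \<Rightarrow>\<^sub>0 'g) list \<Rightarrow>\<^sub>0 complex) set set" where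
  "Phi_i X = fixed.gr_seq (\<lambda>n. L.proj (psi n (SOME z. z \<in> carrier CF.F \<and> X = CF.proj z)))"

lemma psi_fixlev_0: "z \<in> carrier CF.F \<Longrightarrow> psi n z \<in> wfilt fixlev 0"
  by (rule wfilt_antimono[OF psi_fixlev]) simp_all

lemma Phi_i_proj:
  assumes "z \<in> carrier CF.F"
  shows "Phi_i (CF.proj z) = fixed.gr_seq (\<lambda>n. L.proj (psi n z))"
proof -
  define z' where "z' = (SOME z'. z' \<in> carrier CF.F \<and> CF.proj z = CF.proj z')"
  have z': "z' \<in> carrier CF.F" "CF.proj z = CF.proj z'"
    using someI[of "\<lambda>z'. z' \<in> carrier CF.F \<and> CF.proj z = CF.proj z'" z] assms unfolding z'_def by blast+
  then have "z' - z \<in> CF.I" by (metis CF.proj_eq_iff)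
  then have "psi n z' - psi n z \<in> wfilt lev (Suc n)" for n
    using wfilt_fixlev_lev[OF psi_uea_ideal] by (metis psi_simps(3))
  then have "fixed.gr_seq (\<lambda>n. L.proj (psi n z')) = fixed.gr_seq (\<lambda>n. L.proj (psi n z))"
    using assms z'(1) psi_fixlev_0 by (subst fixed_gr_seq_eq_iff) blast+
  then show ?thesis unfolding Phi_i_def z'_def .
qed

lemma psi_kappa_i: "z \<in> carrier CF.F \<Longrightarrow> L.proj (psi n z) \<in> kappa_i scale bracket om n"
  unfolding kappa_i_fixlev by (rule psi_fixlev)

lemma Phi_i_commutes:
  assumes "z \<in> carrier CF.F"
  shows "\<Phi> (C.proj z) = gr_incl (U_loop scale bracket) (kappa scale bracket) (Phi_i (CF.proj z))"
  unfolding Phi_i_proj[OF assms] gr_incl_fixed[of "\<lambda>n. psi n z", OF psi_kappa_i[OF assms]] by (rule Phi_psi)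

text \<open>Finiteness is inherited from the value of \<open>\<Phi>\<close>, whose nonzero
  components are finite in number, through the equality of the two filtrations on fixed
  elements.\<close>

lemma psi_eventually_fixlev:
  assumes z: "z \<in> carrier CF.F"
  shows "finite {n. psi n z \<notin> wfilt fixlev (Suc n)}"
proof -
  have "\<Phi> (C.proj z) \<in> carrier (Gr_kappa scale bracket)"
    using Phi_iso Phi_hom(1) unfolding alg_iso_def ring_iso_def by (auto dest: ring_hom_closed)
  then have fin: "finite {n. \<Phi> (C.proj z) n \<noteq> kappa scale bracket (Suc n)}"
    by (simp add: Gr_def)
  have "\<Phi> (C.proj z) n \<noteq> kappa scale bracket (Suc n)" if "psi n z \<notin> wfilt fixlev (Suc n)" for n
  proof
    assume "\<Phi> (C.proj z) n = kappa scale bracket (Suc n)"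
    then have "L.proj (psi n z) \<in> kappa scale bracket (Suc n)"
      unfolding Phi_psi using loop.gr_seq_eq_K_iff[of "\<lambda>n. L.proj (psi n z)" n, OF L_proj_carrier] by simp
    then show False using that wfilt_lev_fixlev psi_fixlev_0[OF z] by (simp add: kappa_eq proj_wf_iff)
  qed
  then have "{n. psi n z \<notin> wfilt fixlev (Suc n)} \<subseteq> {n. \<Phi> (C.proj z) n \<noteq> kappa scale bracket (Suc n)}" by blast
  then show ?thesis by (rule finite_subset) (rule fin)
qed

lemma Phi_i_surj:
  assumes "\<xi> \<in> carrier (Gr_kappa_i scale bracket om)"
  shows "\<exists>z\<in>carrier CF.F. \<xi> = Phi_i (CF.proj z)"
proof -
  obtain x where x: "\<xi> = fixed.gr_seq x" "\<And>n. x n \<in> kappa_i scale bracket om n"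
    "finite {n. x n \<notin> kappa_i scale bracket om (Suc n)}" by (rule fixed.gr_carrierE[OF assms]) (rule that)
  have "\<exists>p. x n = L.proj p" for n
    using x(2)[of n] unfolding kappa_i_def kappa_eq by blast
  then obtain p where p: "\<And>n. x n = L.proj (p n)" by metis
  have pk: "p n \<in> wfilt fixlev n" for n using x(2)[of n] by (simp add: p kappa_i_fixlev)
  define N where "N = {n. p n \<notin> wfilt fixlev (Suc n)}"
  have fin: "finite N" using x(3) by (simp add: p kappa_i_fixlev N_def)
  have "\<exists>z\<in>carrier CF.F. p k - psi k z \<in> wfilt fixlev (Suc k) \<and> (\<forall>j. j \<noteq> k \<longrightarrow> psi j z \<in> L.I)" for k
    by (rule psi_leading[OF pk])
  then obtain z where z: "\<And>k. z k \<in> carrier CF.F" "\<And>k. p k - psi k (z k) \<in> wfilt fixlev (Suc k)"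
    "\<And>k j. j \<noteq> k \<Longrightarrow> psi j (z k) \<in> L.I" by metis
  \<comment> \<open>The preimages are homogeneous, so the summand for \<open>k\<close> contributes
    only to degree \<open>k\<close>; degrees outside \<open>N\<close> already have zero
    class.\<close>
  define y where "y = (\<Sum>k\<in>N. z k)"
  have y: "y \<in> carrier CF.F" unfolding y_def
    using fin z(1) CF.carrier_F_closed(1,5)
    by (induction N rule: finite_induct) (simp_all del: free_alg_simps)
  have "p n - psi n y \<in> wfilt fixlev (Suc n)" for n
  proof (cases "n \<in> N")
    case True
    have "psi n y = psi n (z n) + (\<Sum>k\<in>N - {n}. psi n (z k))"
      unfolding y_def additive_map_sum[OF additive_psi] by (rule sum.remove[OF fin True])
    moreover have "(\<Sum>k\<in>N - {n}. psi n (z k)) \<in> L.I" by (intro LI_sum z(3)) auto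
    ultimately have "p n - psi n y = (p n - psi n (z n)) - (\<Sum>k\<in>N - {n}. psi n (z k))"
      "(\<Sum>k\<in>N - {n}. psi n (z k)) \<in> wfilt fixlev (Suc n)" by (auto intro: wfilt_I)
    then show ?thesis using wfilt_diff[OF z(2)] by metis
  next
    case False
    have "psi n y \<in> L.I" unfolding y_def additive_map_sum[OF additive_psi] using False by (intro LI_sum z(3)) auto
    then have "psi n y \<in> wfilt fixlev (Suc n)" by (rule wfilt_I)
    then show ?thesis using False unfolding N_def by (intro wfilt_diff) auto
  qed
  then have "p n - psi n y \<in> wfilt lev (Suc n)" for n by (rule wfilt_fixlev_lev)
  moreover have "p n \<in> wfilt fixlev 0" for n using pk by (rule wfilt_antimono) simp
  ultimately have "fixed.gr_seq (\<lambda>n. L.proj (p n)) = fixed.gr_seq (\<lambda>n. L.proj (psi n y))"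
    using psi_fixlev_0[OF y] by (subst fixed_gr_seq_eq_iff) blast+
  then show ?thesis using y unfolding x(1) p Phi_i_proj[OF y, symmetric] by blast
qed

lemma Phi_i_inj:
  assumes "z \<in> carrier CF.F" "z' \<in> carrier CF.F" "Phi_i (CF.proj z) = Phi_i (CF.proj z')"
  shows "CF.proj z = CF.proj z'"
proof -
  have "psi n (z - z') \<in> wfilt lev (Suc n)" for n
    using assms(3) unfolding Phi_i_proj[OF assms(1)] Phi_i_proj[OF assms(2)] psi_simps(3)
    by (subst (asm) fixed_gr_seq_eq_iff) (use assms psi_fixlev_0 in blast)+
  then have "z - z' \<in> CF.I" using assms CF.carrier_F_closed(2) by (intro psi_lev_imp_uea_ideal)
  then show ?thesis by (simp add: CF.proj_eq_iff)
qed

lemma Phi_i_alg_iso: "Phi_i \<in> alg_iso (U_current_fixed scale bracket om) (Gr_kappa_i scale bracket om)"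
proof -
  have car: "Phi_i (CF.proj z) \<in> carrier (Gr_kappa_i scale bracket om)" if "z \<in> carrier CF.F" for z
    unfolding Phi_i_proj[OF that] using psi_kappa_i[OF that] psi_eventually_fixlev[OF that]
    by (intro fixed.gr_carrierI) (simp_all add: kappa_i_fixlev)
  have hc: "L.proj (psi n z) \<in> carrier (U_loop_fixed scale bracket om)" if "z \<in> carrier CF.F" for n z
    unfolding fixed_carrier by (rule psi_fixlev_0[OF that])
  have "Phi_i \<in> ring_hom CF.U (Gr_kappa_i scale bracket om)"
  proof (rule ring_hom_memI)
    show "Phi_i x \<in> carrier (Gr_kappa_i scale bracket om)" if "x \<in> carrier CF.U" for x
      using that by (elim CF.U_memE) (simp only: car)
    show "Phi_i (x \<otimes>\<^bsub>CF.U\<^esub> y) = Phi_i x \<otimes>\<^bsub>Gr_kappa_i scale bracket om\<^esub> Phi_i y"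
      if xy: "x \<in> carrier CF.U" "y \<in> carrier CF.U" for x y
    proof -
      obtain p q where pq: "p \<in> carrier CF.F" "x = CF.proj p" "q \<in> carrier CF.F" "y = CF.proj q"
        using xy by (elim CF.U_memE) blast
      have "Phi_i x \<otimes>\<^bsub>Gr_kappa_i scale bracket om\<^esub> Phi_i y = fixed.gr_seq (\<lambda>n.
          \<Oplus>\<^bsub>U_loop_fixed scale bracket om\<^esub>i\<in>{..n}. L.proj (psi i p * psi (n - i) q))"
        unfolding pq(2,4) Phi_i_proj[OF pq(1)] Phi_i_proj[OF pq(3)] fixed_mult[symmetric]
        by (intro fixed.gr_seq_mult psi_kappa_i pq)
      also have "\<dots> = fixed.gr_seq (\<lambda>n. L.proj (psi n (p * q)))"
      proof -
        have "psi i p * psi (n - i) q \<in> wfilt fixlev 0" for i n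
          using wfilt_mult[OF psi_fixlev_0[OF pq(1)] psi_fixlev_0[OF pq(3)]] by simp
        then show ?thesis by (simp add: fixed_finsum psi_mult)
      qed
      also have "\<dots> = Phi_i (x \<otimes>\<^bsub>CF.U\<^esub> y)"
        unfolding pq(2,4) CF.U_mult[OF pq(1,3)] by (rule Phi_i_proj[symmetric]) (rule CF.carrier_F_closed(3)[OF pq(1,3)])
      finally show ?thesis ..
    qed
    show "Phi_i (x \<oplus>\<^bsub>CF.U\<^esub> y) = Phi_i x \<oplus>\<^bsub>Gr_kappa_i scale bracket om\<^esub> Phi_i y"
      if xy: "x \<in> carrier CF.U" "y \<in> carrier CF.U" for x y
    proof -
      obtain p q where pq: "p \<in> carrier CF.F" "x = CF.proj p" "q \<in> carrier CF.F" "y = CF.proj q"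
        using xy by (elim CF.U_memE) blast
      show ?thesis
        unfolding pq(2,4) CF.U_add[OF pq(1,3)] Phi_i_proj[OF pq(1)] Phi_i_proj[OF pq(3)]
          Phi_i_proj[OF CF.carrier_F_closed(1)[OF pq(1,3)]] psi_simps(2) fixed_add[symmetric]
        by (rule fixed.gr_seq_add[symmetric]) (rule hc, rule pq)+
    qed
    have one: "\<one>\<^bsub>U_loop_fixed scale bracket om\<^esub> \<in> kappa_i scale bracket om 0"
      unfolding fixed_one kappa_i_fixlev by (rule wfilt_one)
    have "\<one>\<^bsub>Gr_kappa_i scale bracket om\<^esub> = gr_class (U_loop_fixed scale bracket om) (kappa_i scale bracket om) 0 \<one>\<^bsub>U_loop_fixed scale bracket om\<^esub>"
      by (simp add: Gr_def)
    also have "\<dots> = fixed.gr_seq (\<lambda>n. L.proj (psi n 1))"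
      unfolding fixed.gr_class_eq[OF one] by (rule arg_cong[where f = fixed.gr_seq], rule ext) (simp add: fixed_zero fixed_one psi_one)
    also have "\<dots> = Phi_i \<one>\<^bsub>CF.U\<^esub>"
      unfolding CF.U_one by (rule Phi_i_proj[symmetric]) (rule CF.carrier_F_closed(6))
    finally show "Phi_i \<one>\<^bsub>CF.U\<^esub> = \<one>\<^bsub>Gr_kappa_i scale bracket om\<^esub>" ..
  qed
  moreover have "bij_betw Phi_i (carrier CF.U) (carrier (Gr_kappa_i scale bracket om))"
  proof (rule bij_betwI')
    show "(Phi_i x = Phi_i y) = (x = y)" if "x \<in> carrier CF.U" "y \<in> carrier CF.U" for x y
      using that by (elim CF.U_memE) (metis Phi_i_inj)
    show "Phi_i x \<in> carrier (Gr_kappa_i scale bracket om)" if "x \<in> carrier CF.U" for x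
      using that by (elim CF.U_memE) (simp only: car)
    show "\<exists>x\<in>carrier CF.U. \<xi> = Phi_i x" if "\<xi> \<in> carrier (Gr_kappa_i scale bracket om)" for \<xi>
      using Phi_i_surj[OF that] CF.U_memI by blast
  qed
  moreover have "Phi_i (c \<odot>\<^bsub>CF.U\<^esub> x) = c \<odot>\<^bsub>Gr_kappa_i scale bracket om\<^esub> Phi_i x" if "x \<in> carrier CF.U" for c x
  proof -
    obtain p where p: "p \<in> carrier CF.F" "x = CF.proj p" using \<open>x \<in> _\<close> by (rule CF.U_memE)
    have cp: "sgl [] c * p \<in> carrier CF.F" by (rule CF.carrier_F_closed(3)[OF _ p(1)]) simp
    show ?thesis
      unfolding p(2) CF.U_smult Phi_i_proj[OF p(1)] Phi_i_proj[OF cp] psi_scalar fixed_smult[symmetric]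
      by (rule fixed.gr_seq_smult[symmetric]) (rule hc[OF p(1)])
  qed
  ultimately show ?thesis by (simp add: alg_iso_def ring_iso_def)
qed

text \<open>The image is determined by the leading coefficient, so \<open>lift r (sgl r a)\<close>
  may be replaced by any fixed \<open>y\<close> that shares it.\<close>

lemma Phi_i_homogeneous:
  assumes a: "scale ((- 1) ^ r) (om a) = a" and y: "y \<in> fixlev r" "y - lift r (sgl r a) \<in> fixlev (Suc r)"
  shows "Phi_i (CF.proj (sgl [sgl r a] 1)) =
    gr_class (U_loop_fixed scale bracket om) (kappa_i scale bracket om) r (loop_gen scale bracket y)"
proof -
  have z: "sgl [sgl r a] 1 \<in> carrier CF.F" using single_in_current_fixed[OF a] by simp
  have yk: "L.proj (sgl [y] 1) \<in> kappa_i scale bracket om r"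
    unfolding kappa_i_fixlev by (rule wfilt_letter[of _ fixlev, OF y(1)])
  have "gr_class (U_loop_fixed scale bracket om) (kappa_i scale bracket om) r (loop_gen scale bracket y) =
      fixed.gr_seq (\<lambda>n. L.proj (if n = r then sgl [y] 1 else 0))"
    unfolding L.uea_gen_eq fixed.gr_class_eq[OF yk] by (rule arg_cong[where f = fixed.gr_seq], rule ext) (simp add: fixed_zero)
  also have "\<dots> = fixed.gr_seq (\<lambda>n. L.proj (psi n (sgl [sgl r a] 1)))"
  proof (subst fixed_gr_seq_eq_iff)
    show "(if n = r then sgl [y] 1 else 0) \<in> wfilt fixlev 0" for n
      using wfilt_antimono[OF wfilt_letter[of y fixlev r 1, OF y(1)], of 0] by (simp add: wfilt_0)
    show "psi n (sgl [sgl r a] 1) \<in> wfilt fixlev 0" for n by (rule psi_fixlev_0[OF z])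
    show "\<forall>n. (if n = r then sgl [y] 1 else 0) - psi n (sgl [sgl r a] 1) \<in> wfilt lev (Suc n)"
      using wfilt_fixlev_lev[OF wfilt_letter_diff[where Q = fixlev, OF y(2)]] wfilt_uminus[OF wfilt_I[OF LI_zero]]
      by (simp add: psi_letter lift_single_other)
  qed
  finally show ?thesis unfolding Phi_i_proj[OF z] ..
qed

end

section \<open>The isomorphism\<close>

lemma (in chevalley_lie_algebra) involutive: "involutive_lie_algebra scale bracket \<omega>\<^sub>0"
  by (intro involutive_lie_algebra.intro lie_algebra_axioms involutive_lie_algebra_axioms.intro)
     (rule omega0_add omega0_scale omega0_bracket omega0_involution)+

text \<open>The centre is an ideal, and it is proper because the algebra is not abelian.\<close>

lemma (in fd_simple_lie_algebra) centreless:
  assumes "x \<noteq> 0" shows "\<exists>y. bracket x y \<noteq> 0"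
proof -
  let ?Z = "{x. \<forall>y. bracket x y = 0}"
  have "lie_ideal ?Z"
    unfolding lie_ideal_def
  proof
    show "subspace ?Z"
      by (rule subspaceI) (auto simp: bracket_add_left bracket_scale_left bracket_0)
    show "\<forall>x. \<forall>y\<in>?Z. bracket x y \<in> ?Z"
    proof (intro allI ballI)
      fix x y assume "y \<in> ?Z"
      then have "bracket x y = 0" by (subst bracket_skew) simp
      then show "bracket x y \<in> ?Z" by (simp add: bracket_0)
    qed
  qed
  then have "?Z = {0} \<or> ?Z = UNIV" by (rule simple)
  then show ?thesis using assms nonabelian by blast
qed

theorem proposition2p7:
  fixes scale :: "complex \<Rightarrow> 'g::ab_group_add \<Rightarrow> 'g"
    and br :: "'g \<Rightarrow> 'g \<Rightarrow> 'g"
    and n :: nat and A :: "nat \<Rightarrow> nat \<Rightarrow> int"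
    and e f h :: "nat \<Rightarrow> 'g" and \<omega>\<^sub>0 :: "'g \<Rightarrow> 'g"
    and \<Phi> :: "((nat \<Rightarrow>\<^sub>0 'g) list \<Rightarrow>\<^sub>0 complex) set \<Rightarrow> nat \<Rightarrow> ((int \<Rightarrow>\<^sub>0 'g) list \<Rightarrow>\<^sub>0 complex) set set"
  assumes "chevalley_lie_algebra scale br n A e f h \<omega>\<^sub>0"
    and "\<Phi> \<in> alg_iso (U_current scale br) (Gr_kappa scale br)"
    and "\<And>g r. \<Phi> (uea_gen (pm_scale scale) (pm_bracket br) UNIV (Poly_Mapping.single r g)) =
           gr_class (U_loop scale br) (kappa scale br) r (loop_gen scale br (loop_elem scale g r 0))"
  shows "\<exists>\<Phi>\<^sub>i \<in> alg_iso (U_current_fixed scale br \<omega>\<^sub>0) (Gr_kappa_i scale br \<omega>\<^sub>0).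
     (\<forall>i\<in>{1..n}. \<forall>r. odd r \<longrightarrow>
        \<Phi>\<^sub>i (2 \<odot>\<^bsub>U_current_fixed scale br \<omega>\<^sub>0\<^esub>
              uea_gen (pm_scale scale) (pm_bracket br) (current_fixed scale \<omega>\<^sub>0) (t_elem h i r)) =
        gr_class (U_loop_fixed scale br \<omega>\<^sub>0) (kappa_i scale br \<omega>\<^sub>0) r
          (loop_gen scale br (theta_rl scale h i r 1))) \<and>
     (\<forall>i\<in>{1..n}. \<forall>m.
        \<Phi>\<^sub>i (uea_gen (pm_scale scale) (pm_bracket br) (current_fixed scale \<omega>\<^sub>0) (x_elem scale e f i m)) =
        gr_class (U_loop_fixed scale br \<omega>\<^sub>0) (kappa_i scale br \<omega>\<^sub>0) m
          (loop_gen scale br (beta_rk scale e f i m 1))) \<and>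
     (\<forall>x\<in>carrier (U_current_fixed scale br \<omega>\<^sub>0).
        \<Phi> (uea_incl (pm_scale scale) (pm_bracket br) UNIV x) =
        gr_incl (U_loop scale br) (kappa scale br) (\<Phi>\<^sub>i x))"
proof -
  interpret chevalley_lie_algebra scale br n A e f h \<omega>\<^sub>0 by fact
  interpret inv: involutive_lie_algebra scale br \<omega>\<^sub>0 by (rule involutive)
  interpret gr: graded_current scale br \<omega>\<^sub>0 \<Phi>
    by (intro graded_current.intro graded_current_axioms.intro inv.involutive_lie_algebra_axioms centreless assms(2,3))
  interpret CF: lie_sub "pm_scale scale" "pm_bracket br :: (nat \<Rightarrow>\<^sub>0 'g) \<Rightarrow> _" "current_fixed scale \<omega>\<^sub>0"
    by (rule inv.current_fixed_lie_sub)
  have "gr.Phi_i (2 \<odot>\<^bsub>CF.U\<^esub> uea_gen (pm_scale scale) (pm_bracket br) (current_fixed scale \<omega>\<^sub>0) (t_elem h i r)) =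
      gr_class (U_loop_fixed scale br \<omega>\<^sub>0) (kappa_i scale br \<omega>\<^sub>0) r (loop_gen scale br (theta_rl scale h i r 1))"
    if i: "i \<in> {1..n}" and r: "odd r" for i r
  proof -
    have om: "\<omega>\<^sub>0 (h i) = - h i" by (rule omega0_h[OF i])
    \<comment> \<open>This is the origin of the factor 2: for odd \<open>r\<close> the sign
      \<open>(-1)^r\<close> cancels the sign in \<open>omega0_h\<close>, so symmetrizing doubles
      \<open>h i\<close>.\<close>
    have b: "h i + scale ((- 1) ^ r) (\<omega>\<^sub>0 (h i)) = scale 2 (h i)"
      using r by (simp add: om flip: scale_left_distrib[of 1 1, simplified])
    have "theta_rl scale h i r 1 = (\<Sum>s = 0..r. pm_scale scale ((- 1) ^ (r - s) * of_nat (r choose s))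
        (sgl (int s + 1) (h i) + loop_omega \<omega>\<^sub>0 (sgl (int s + 1) (h i))))"
      by (simp add: theta_rl_def theta_def inv.lom_single om single_uminus add.commute)
    \<comment> \<open>The scalar is moved into the letter, since \<open>Phi_i_homogeneous\<close>
      concerns a single letter with coefficient \<open>2 h i\<close>.\<close>
    moreover have "2 \<odot>\<^bsub>CF.U\<^esub> uea_gen (pm_scale scale) (pm_bracket br) (current_fixed scale \<omega>\<^sub>0) (t_elem h i r) =
        CF.proj (sgl [sgl r (scale 2 (h i))] 1)"
    proof -
      have "sgl r (h i) \<in> current_fixed scale \<omega>\<^sub>0"
        using r om by (intro inv.single_in_current_fixed) simp
      from CF.I_simps(2)[OF CF.I_rels(2)[OF this, of 2]] show ?thesis
        unfolding CF.uea_gen_eq CF.U_smult t_elem_def by (simp add: CF.proj_eq_iff word_mult pm_scale_single)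
    qed
    ultimately show ?thesis
      using gr.Phi_i_homogeneous[OF inv.symmetrized_leading(1)[of r "h i"]
          inv.symmetrized_leading(2,3)[where r = r and a = "h i" and l = 1]] unfolding b by simp
  qed
  moreover have "gr.Phi_i (uea_gen (pm_scale scale) (pm_bracket br) (current_fixed scale \<omega>\<^sub>0) (x_elem scale e f i m)) =
      gr_class (U_loop_fixed scale br \<omega>\<^sub>0) (kappa_i scale br \<omega>\<^sub>0) m (loop_gen scale br (beta_rk scale e f i m 1))"
    if i: "i \<in> {1..n}" for i m
  proof -
    \<comment> \<open>The element to symmetrize is \<open>- e i\<close> rather than
      \<open>f i\<close>, because it is the \<open>e\<close> term of \<open>b_elem\<close> that
      carries the exponent \<open>k\<close> itself, as \<open>binomial_dop_pow\<close>
      expects.\<close>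
    have om: "\<omega>\<^sub>0 (- e i) = f i"
      using omega0_e[OF i] additive_map_uminus[OF inv.additive_om, of "e i"] by simp
    have b: "- e i + scale ((- 1) ^ m) (\<omega>\<^sub>0 (- e i)) = scale ((- 1) ^ m) (f i) - e i" by (simp add: om)
    have "sgl k (- e i) + loop_omega \<omega>\<^sub>0 (sgl k (- e i)) = b_elem e f i k" for k
      unfolding inv.lom_single om b_elem_def by (simp add: single_uminus)
    then have "beta_rk scale e f i m 1 = (\<Sum>s = 0..m. pm_scale scale ((- 1) ^ (m - s) * of_nat (m choose s))
        (sgl (int s + 1) (- e i) + loop_omega \<omega>\<^sub>0 (sgl (int s + 1) (- e i))))"
      by (simp only: beta_rk_def)
    then show ?thesis
      using gr.Phi_i_homogeneous[OF inv.symmetrized_leading(1)[of m "- e i"]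
          inv.symmetrized_leading(2,3)[where r = m and a = "- e i" and l = 1]]
      unfolding b CF.uea_gen_eq x_elem_def by simp
  qed
  moreover have "\<Phi> (uea_incl (pm_scale scale) (pm_bracket br) UNIV x) =
      gr_incl (U_loop scale br) (kappa scale br) (gr.Phi_i x)" if "x \<in> carrier CF.U" for x
    using that by (elim CF.U_memE) (simp only: CF.uea_incl_proj gr.Phi_i_commutes)
  ultimately show ?thesis using gr.Phi_i_alg_iso by (intro bexI[of _ gr.Phi_i]) blast+
qed

end
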